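(* Let $M$ be a (finite) multigraph without loops with $e(M)\ge 1$ such that \[\max_{\mu\subseteq V(M),\ |\mu|\ge 2}\frac{e(M[\mu])}{|\mu|-1}=\frac{e(M)}{v(M)-1}.\] Then there exists a constant $C>0$ such that for every $p=p(n)\in[0,1]$ lying in one of the ranges below, a.a.s. \[\mathrm{ex}(G_{n,p},F_M)=\begin{cases} \Theta(p^{1/2}n^{3/2}) & n^{-\frac{v(M)-1}{v(M)+2e(M)-1}}(\log n)^{C}\le p,\\ n^{2-\frac{v(M)+e(M)-1}{v(M)+2e(M)-1}}(\log n)^{\Theta(1)} & n^{-\frac{v(M)+e(M)-1}{v(M)+2e(M)-1}}\ll p\le n^{-\frac{v(M)-1}{v(M)+2e(M)-1}}(\log n)^{C},\\ (1+o(1))p\binom n2 & n^{-2}\ll p\ll n^{-\frac{v(M)+e(M)-1}{v(M)+2e(M)-1}}. \end{cases}\]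
   Context: For a multigraph $M$ without loops, $F_M$ is the (simple) graph obtained by subdividing each edge of $M$ (each edge, counted with multiplicity, is replaced by a path of length 2 through its own new vertex) and then adding a new vertex $v^*$ which is made adjacent to every vertex in $V(M)$. $v(M)$ and $e(M)$ denote the number of vertices and the number of edges (with multiplicity) of $M$, and $M[\mu]$ is the sub-multigraph induced by $\mu$. $G_{n,p}$ is the random graph on $n$ vertices in which each possible edge is included independently with probability $p$, and $\mathrm{ex}(G_{n,p},F)$ is the maximum number of edges in an $F$-free subgraph of $G_{n,p}$. A sequence of events $A_n$ holds asymptotically almost surely (a.a.s.) if $\Pr[A_n]\to1$. $f(n)\ll g(n)$ means $f(n)/g(n)\to0$ as $n\to\infty$. For a random variable $X_n$: "a.a.s. $X_n=\Theta(g(n))$" means there is a constant $K>0$ depending only on $M$ such that a.a.s. $K^{-1}g(n)\le X_n\le Kg(n)$; "a.a.s. $X_n=g(n)(\log n)^{\Theta(1)}$" means there is a constant $C'>0$ depending only on $M$ such that a.a.s. $g(n)(\log n)^{-C'}\le X_n\le g(n)(\log n)^{C'}$; "a.a.s. $X_n=(1+o(1))g(n)$" means that for every $\varepsilon>0$, a.a.s. $|X_n-g(n)|\le\varepsilon g(n)$. *)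

theory Defs
  imports "HOL-Probability.Probability" "HOL-Library.Ramsey" "HOL-Library.Landau_Symbols"
begin

subsection \<open>Simple graphs\<close>

record 'a graph =
  verts :: "'a set"
  edges :: "'a set set"

definition simple_graph :: "'a graph \<Rightarrow> bool" where
  "simple_graph G \<longleftrightarrow> edges G \<subseteq> [verts G]\<^bsup>2\<^esup>"

definition subgraph :: "'a graph \<Rightarrow> 'a graph \<Rightarrow> bool" where
  "subgraph H G \<longleftrightarrow> simple_graph H \<and> verts H \<subseteq> verts G \<and> edges H \<subseteq> edges G"

text \<open>\<open>H\<close> contains a (not necessarily induced) copy of \<open>F\<close>.\<close>

definition contains_copy :: "'a graph \<Rightarrow> 'b graph \<Rightarrow> bool" where
  "contains_copy H F \<longleftrightarrow>
     (\<exists>\<phi>. inj_on \<phi> (verts F) \<and> \<phi> ` verts F \<subseteq> verts H \<and> (\<forall>e\<in>edges F. \<phi> ` e \<in> edges H))"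

text \<open>The maximum is over a finite set if \<open>G\<close> is finite, and over a nonempty set as soon as \<open>F\<close> has
  at least one edge (the edgeless subgraph is then \<open>F\<close>-free).\<close>

definition ex_number :: "'a graph \<Rightarrow> 'b graph \<Rightarrow> nat" where
  "ex_number G F = Max {card (edges H) | H. subgraph H G \<and> \<not> contains_copy H F}"

subsection \<open>Multigraphs without loops\<close>

text \<open>Edges are named objects, and several edges may have the same pair of ends.\<close>

record ('a, 'b) multigraph =
  mverts :: "'a set"
  medges :: "'b set"
  ends :: "'b \<Rightarrow> 'a set"

definition loopless_multigraph :: "('a, 'b) multigraph \<Rightarrow> bool" where
  "loopless_multigraph M \<longleftrightarrow>
     finite (mverts M) \<and> finite (medges M) \<and> (\<forall>e\<in>medges M. ends M e \<in> [mverts M]\<^bsup>2\<^esup>)"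

definition num_verts :: "('a, 'b) multigraph \<Rightarrow> nat" where
  "num_verts M = card (mverts M)"

definition num_edges :: "('a, 'b) multigraph \<Rightarrow> nat" where
  "num_edges M = card (medges M)"

definition induced :: "('a, 'b) multigraph \<Rightarrow> 'a set \<Rightarrow> ('a, 'b) multigraph" where
  "induced M \<mu> = M\<lparr>mverts := \<mu>, medges := {e \<in> medges M. ends M e \<subseteq> \<mu>}\<rparr>"

subsection \<open>The graph \<open>F\<^sub>M\<close>\<close>

datatype ('a, 'b) F_vertex = Branch 'a | Subdiv 'b | Apex

definition F_graph :: "('a, 'b) multigraph \<Rightarrow> ('a, 'b) F_vertex graph" where
  "F_graph M =
     \<lparr>verts = Branch ` mverts M \<union> Subdiv ` medges M \<union> {Apex},
      edges = {{Branch u, Subdiv e} | u e. e \<in> medges M \<and> u \<in> ends M e}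
            \<union> {{Apex, Branch u} | u. u \<in> mverts M}\<rparr>"

subsection \<open>Random graphs\<close>

definition gnp :: "nat \<Rightarrow> real \<Rightarrow> nat graph pmf" where
  "gnp n p =
     map_pmf (\<lambda>f. \<lparr>verts = {..<n}, edges = {e \<in> [{..<n}]\<^bsup>2\<^esup>. f e}\<rparr>)
       (Pi_pmf ([{..<n}]\<^bsup>2\<^esup>) False (\<lambda>_. bernoulli_pmf p))"

text \<open>Asymptotically almost surely: \<open>A n\<close> is an event in the probability space \<open>D n\<close>.\<close>

definition aas :: "(nat \<Rightarrow> 'a pmf) \<Rightarrow> (nat \<Rightarrow> 'a \<Rightarrow> bool) \<Rightarrow> bool" where
  "aas D A \<longleftrightarrow> (\<lambda>n. measure_pmf.prob (D n) {x. A n x}) \<longlonglongrightarrow> 1"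

text \<open>For \<open>f \<lless> g\<close> we use \<open>f \<in> o(g)\<close>. Unlike the literal limit of \<open>f n / g n\<close>, this rules out, for
  positive \<open>f\<close>, that \<open>g n = 0\<close> for infinitely many \<open>n\<close> (division by zero yields zero in HOL).\<close>

end

theory Submission
  imports Defs "HOL-Algebra.Algebraic_Closure_Type" "HOL-Library.Z2" "HOL-Real_Asymp.Real_Asymp"
begin

text \<open>
Let \<open>F\<close> be the graph of the multigraph \<open>M\<close>, let \<open>v\<close> and \<open>e\<close> be its numbers of vertices and edges, and let
\<open>m = p powr (1/2) * n powr (3/2)\<close>.

Upper bound in the dense range. The \<open>F\<close>-free subgraphs of the random graph are the random subsets of the
edge set of the complete graph that are independent in the hypergraph of copies of \<open>F\<close>. The hypergraph
container method (\<open>hypergraph_containers\<close>) covers the independent sets by few containers, provided that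
the hypergraph has a weighting whose degrees drop by a factor \<open>\<tau>\<close> with every additional vertex. Such a
weighting exists on every graph with at least \<open>K n powr (3/2)\<close> edges (\<open>balanced_supersaturation\<close>). A copy of
\<open>F\<close> consists of an apex, of branch vertices among its neighbours, and of one vertex in the common
neighbourhood of two branch vertices for each edge of \<open>M\<close>. Weighting each copy by the inverse product of
the codegrees makes the choice of the last vertices neutral, so that copies can be counted in graphs
with irregular codegrees. The admissible \<open>\<tau>\<close> is then determined by the subsets of copies that are
spanned by sets \<open>\<mu>\<close> of branch vertices, and the hypothesis on \<open>M\<close> says precisely that \<open>\<mu> = V(M)\<close> is the
worst of them (\<open>apex_numbers\<close>, \<open>no_apex_numbers\<close>). Iterating the containers until they have about
\<open>m / p\<close> edges, with a union bound in which fingerprints are weighted by their probability, gives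
\<open>ex \<le> K m\<close> without logarithmic loss (\<open>sparse_random_upper_tail\<close>, \<open>ex_number_gnp_upper\<close>). The method applies
as soon as \<open>m\<close> exceeds the contribution \<open>n powr (1 + e / (v + 2 e - 1))\<close> of whole copies to the
fingerprints by a factor \<open>(ln n)\<^sup>2\<close>, which is the dense range.

Lower bound in the dense range. As \<open>F\<close> contains a quadrilateral, it suffices to find a random
subgraph without quadrilaterals that has order \<open>m\<close> edges. Each vertex of the incidence graph of points and
lines in an affine plane is replaced by about \<open>1 / p\<close> vertices, and in each of the resulting bipartite
blocks the isolated random edges are kept (\<open>ex_number_gnp_lower\<close>).

Sparse range. Here the random graph has far fewer copies of \<open>F\<close> than edges, and one edge can be
deleted from each copy (\<open>ex_number_sparse\<close>).

Middle range. The extremal number is monotone in the graph and therefore, by coupling, in \<open>p\<close>. At both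
ends of the middle range the other two results give \<open>n powr (2 - b)\<close> up to powers of \<open>ln n\<close>.
\<close>

section \<open>Containers for balanced weighted hypergraphs\<close>

text \<open>A weighted \<open>s\<close>-uniform hypergraph on \<open>V\<close> is a function \<open>H\<close> on all finite sets, of which only the
values on \<open>s\<close>-subsets of \<open>V\<close> count; \<open>wdeg V s H T\<close> is the degree of \<open>T\<close>, and \<open>wdeg V s H {}\<close> the total
weight. Weights instead of edge sets allow links of several vertices to be added up, and later
allow copies to be weighted by their scarcity.\<close>

definition wdeg :: "'a set \<Rightarrow> nat \<Rightarrow> ('a set \<Rightarrow> real) \<Rightarrow> 'a set \<Rightarrow> real" where
  "wdeg V s H T = (\<Sum>e | e \<in> [V]\<^bsup>s\<^esup> \<and> T \<subseteq> e. H e)"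

definition windep :: "nat \<Rightarrow> ('a set \<Rightarrow> real) \<Rightarrow> 'a set \<Rightarrow> bool" where
  "windep s H I \<longleftrightarrow> (\<forall>e\<in>[I]\<^bsup>s\<^esup>. H e = 0)"

text \<open>In one container step a hypergraph \<open>H'\<close> of uniformity \<open>s\<close> is collected from links of vertices in
a hypergraph of uniformity \<open>s + 1\<close>. A set is saturated when its degree in \<open>H'\<close> has reached a
threshold that depends on its size; from then on no edge containing it is used, which keeps all
degrees of \<open>H'\<close> bounded.\<close>

definition saturated :: "'a set \<Rightarrow> nat \<Rightarrow> (nat \<Rightarrow> real) \<Rightarrow> ('a set \<Rightarrow> real) \<Rightarrow> 'a set \<Rightarrow> bool" where
  "saturated V s thr H' T \<longleftrightarrow> T \<noteq> {} \<and> T \<subseteq> V \<and> card T \<le> s \<and> wdeg V s H' T \<ge> thr (card T)"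

definition residual :: "'a set \<Rightarrow> nat \<Rightarrow> (nat \<Rightarrow> real) \<Rightarrow> ('a set \<Rightarrow> real) \<Rightarrow> 'a set \<Rightarrow> 'a set set" where
  "residual V s thr H' A = {e \<in> [A]\<^bsup>Suc s\<^esup>. \<forall>T\<subseteq>e. \<not> saturated V s thr H' T}"

definition add_link ::
  "('a set \<Rightarrow> real) \<Rightarrow> 'a set set \<Rightarrow> 'a \<Rightarrow> ('a set \<Rightarrow> real) \<Rightarrow> 'a set \<Rightarrow> real" where
  "add_link H R v H' e = H' e + (if v \<notin> e \<and> insert v e \<in> R then H (insert v e) else 0)"

lemma finite_nsets_Collect [simp]: "finite V \<Longrightarrow> finite {e \<in> [V]\<^bsup>s\<^esup>. P e}"
  by (simp add: finite_imp_finite_nsets)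

lemma wdeg_nonneg: "(\<And>e. H e \<ge> 0) \<Longrightarrow> wdeg V s H T \<ge> 0"
  unfolding wdeg_def by (intro sum_nonneg) auto

lemma residual_subset: "A \<subseteq> V \<Longrightarrow> residual V s thr H' A \<subseteq> [V]\<^bsup>Suc s\<^esup>"
  unfolding residual_def using nsets_mono[of A V "Suc s"] by auto

lemma wdeg_add_link:
  assumes fin: "finite V" and R: "R \<subseteq> [V]\<^bsup>Suc s\<^esup>"
  shows "wdeg V s (add_link H R v H') T = wdeg V s H' T + (\<Sum>e | e \<in> R \<and> v \<in> e \<and> T \<subseteq> e - {v}. H e)"
proof -
  have "(\<Sum>e | e \<in> [V]\<^bsup>s\<^esup> \<and> T \<subseteq> e. if v \<notin> e \<and> insert v e \<in> R then H (insert v e) else 0)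
      = (\<Sum>e | e \<in> [V]\<^bsup>s\<^esup> \<and> T \<subseteq> e \<and> v \<notin> e \<and> insert v e \<in> R. H (insert v e))"
    by (rule sum.mono_neutral_cong_right) (use fin in \<open>auto\<close>)
  also have "\<dots> = (\<Sum>e | e \<in> R \<and> v \<in> e \<and> T \<subseteq> e - {v}. H e)"
    by (rule sum.reindex_bij_witness[of _ "\<lambda>e. e - {v}" "insert v"])
       (use R in \<open>auto simp: nsets_def insert_absorb\<close>)
  finally show ?thesis
    unfolding wdeg_def add_link_def by (simp add: sum.distrib)
qed

definition degs_le :: "'a set \<Rightarrow> nat \<Rightarrow> ('a set \<Rightarrow> real) \<Rightarrow> (nat \<Rightarrow> real) \<Rightarrow> bool" where
  "degs_le V s H D \<longleftrightarrow> (\<forall>T\<subseteq>V. T \<noteq> {} \<longrightarrow> card T \<le> s \<longrightarrow> wdeg V s H T \<le> D (card T))"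

definition link_outcome where
  "link_outcome V s thr \<Delta> H \<theta> A H' I S A\<^sub>1 H\<^sub>1 \<longleftrightarrow>
     S \<subseteq> I \<inter> A \<and> A\<^sub>1 \<subseteq> A \<and> I \<inter> A \<subseteq> A\<^sub>1 \<union> S \<and> (\<forall>e. H\<^sub>1 e \<ge> 0) \<and>
     degs_le V s H\<^sub>1 (\<lambda>j. thr j + \<Delta> (Suc j)) \<and>
     wdeg V s H' {} + \<theta> * real (card S) \<le> wdeg V s H\<^sub>1 {} \<and>
     (\<forall>v\<in>A\<^sub>1. (\<Sum>e | e \<in> residual V s thr H\<^sub>1 A\<^sub>1 \<and> v \<in> e. H e) < \<theta>) \<and>
     (\<forall>e. H\<^sub>1 e \<noteq> 0 \<longrightarrow> H' e \<noteq> 0 \<or> (\<exists>v\<in>S. v \<notin> e \<and> H (insert v e) \<noteq> 0))"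

lemma link_outcomeD:
  assumes "link_outcome V s thr \<Delta> H \<theta> A H' I S A\<^sub>1 H\<^sub>1"
  shows "S \<subseteq> I \<inter> A" "A\<^sub>1 \<subseteq> A" "I \<inter> A \<subseteq> A\<^sub>1 \<union> S" "\<forall>e. H\<^sub>1 e \<ge> 0"
    "degs_le V s H\<^sub>1 (\<lambda>j. thr j + \<Delta> (Suc j))"
    "wdeg V s H' {} + \<theta> * real (card S) \<le> wdeg V s H\<^sub>1 {}"
    "\<forall>v\<in>A\<^sub>1. (\<Sum>e | e \<in> residual V s thr H\<^sub>1 A\<^sub>1 \<and> v \<in> e. H e) < \<theta>"
    "\<forall>e. H\<^sub>1 e \<noteq> 0 \<longrightarrow> H' e \<noteq> 0 \<or> (\<exists>v\<in>S. v \<notin> e \<and> H (insert v e) \<noteq> 0)"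
  using assms unfolding link_outcome_def by blast+

text \<open>The algorithm behind containers. While some vertex \<open>v\<close> of the active set \<open>A\<close> has residual degree at
least \<open>\<theta>\<close>, remove \<open>v\<close> from \<open>A\<close> and ask whether \<open>v \<in> I\<close>; if so, put \<open>v\<close> into the fingerprint \<open>S\<close> and
add its residual link to \<open>H'\<close>. The choice of \<open>v\<close> depends only on the earlier answers, so the
outcome is determined by \<open>S\<close>. This is recorded as invariance of \<open>fA\<close> and \<open>fH\<close> on all \<open>J\<close> between
\<open>S\<close> and \<open>I\<close>, which avoids any reference to the order in which vertices are processed. A set that is
not saturated before a step gains at most the degree of one larger set in \<open>H\<close>, hence the bound
\<open>thr j + \<Delta> (Suc j)\<close>.\<close>

lemma link_process:
  fixes H :: "'a set \<Rightarrow> real" and \<theta> :: real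
  assumes fin: "finite V"
    and H0: "\<And>e. H e \<ge> 0"
    and Delta0: "\<And>j. \<Delta> j \<ge> 0"
    and degH: "degs_le V (Suc s) H \<Delta>"
  shows "A \<subseteq> V \<Longrightarrow> \<forall>e. H' e \<ge> 0 \<Longrightarrow> degs_le V s H' (\<lambda>j. thr j + \<Delta> (Suc j)) \<Longrightarrow>
    \<exists>fA fH. \<forall>I\<subseteq>V. \<exists>S. link_outcome V s thr \<Delta> H \<theta> A H' I S (fA I) (fH I) \<and>
      (\<forall>J. S \<subseteq> J \<and> J \<subseteq> I \<longrightarrow> fA J = fA I \<and> fH J = fH I)"
proof (induction "card A" arbitrary: A H' rule: less_induct)
  case less
  note AV = less.prems(1) and H'0 = less.prems(2) and deg' = less.prems(3)
  have finA: "finite A" using AV fin finite_subset by blast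
  let ?R = "residual V s thr H' A"
  show ?case
  proof (cases "\<exists>v\<in>A. (\<Sum>e | e \<in> ?R \<and> v \<in> e. H e) \<ge> \<theta>")
    case False
    then have stuck: "\<forall>v\<in>A. (\<Sum>e | e \<in> ?R \<and> v \<in> e. H e) < \<theta>" by (simp add: not_le)
    have "link_outcome V s thr \<Delta> H \<theta> A H' I {} A H'" for I
      unfolding link_outcome_def
    proof (intro conjI)
      show "\<forall>e. H' e \<noteq> 0 \<longrightarrow> H' e \<noteq> 0 \<or> (\<exists>v\<in>{}. v \<notin> e \<and> H (insert v e) \<noteq> 0)" by simp
      show "wdeg V s H' {} + \<theta> * real (card {}) \<le> wdeg V s H' {}" by simp
      show "I \<inter> A \<subseteq> A \<union> {}" by simp
    qed (fact H'0 deg' stuck | simp)+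
    then show ?thesis
      by (intro exI[of _ "\<lambda>_. A"] exI[of _ "\<lambda>_. H'"] allI impI exI[of _ "{}"] conjI) simp_all
  next
    case True
    then obtain v where vA: "v \<in> A" and gain: "(\<Sum>e | e \<in> ?R \<and> v \<in> e. H e) \<ge> \<theta>" by blast
    let ?A = "A - {v}"
    define H1 where "H1 = add_link H ?R v H'"
    have smaller: "card ?A < card A" using card_Diff1_less[OF finA vA] .
    have A1: "?A \<subseteq> V" using AV by blast
    have RV: "?R \<subseteq> [V]\<^bsup>Suc s\<^esup>" using residual_subset[OF AV] .
    have H10: "\<forall>e. H1 e \<ge> 0"
      unfolding H1_def add_link_def using H'0 H0 by (auto intro!: add_nonneg_nonneg)
    have deg1: "degs_le V s H1 (\<lambda>j. thr j + \<Delta> (Suc j))"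
      unfolding degs_le_def
    proof (intro allI impI)
      fix T assume T: "T \<subseteq> V" "T \<noteq> {}" "card T \<le> s"
      have finT: "finite T" using T fin finite_subset by blast
      show "wdeg V s H1 T \<le> thr (card T) + \<Delta> (Suc (card T))"
      proof (cases "saturated V s thr H' T")
        case True
        have none: "{e. e \<in> ?R \<and> v \<in> e \<and> T \<subseteq> e - {v}} = {}" using True unfolding residual_def by auto
        show ?thesis unfolding H1_def wdeg_add_link[OF fin RV] none
          using deg' T unfolding degs_le_def by simp
      next
        case False
        then have a: "wdeg V s H' T \<le> thr (card T)" using T unfolding saturated_def by auto
        have "(\<Sum>e | e \<in> ?R \<and> v \<in> e \<and> T \<subseteq> e - {v}. H e) \<le> \<Delta> (Suc (card T))"
        proof (cases "v \<in> T")
          case True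
          then have none: "{e. e \<in> ?R \<and> v \<in> e \<and> T \<subseteq> e - {v}} = {}" by auto
          show ?thesis unfolding none using Delta0 by simp
        next
          case False
          have "(\<Sum>e | e \<in> ?R \<and> v \<in> e \<and> T \<subseteq> e - {v}. H e) \<le> wdeg V (Suc s) H (insert v T)"
            unfolding wdeg_def by (rule sum_mono2) (use RV fin H0 in auto)
          also have "\<dots> \<le> \<Delta> (card (insert v T))"
            using degH[unfolded degs_le_def, rule_format, of "insert v T"] T vA AV False finT by auto
          finally show ?thesis using False finT by simp
        qed
        then show ?thesis unfolding H1_def wdeg_add_link[OF fin RV] using a by simp
      qed
    qed
    have tot1: "wdeg V s H1 {} \<ge> wdeg V s H' {} + \<theta>"
      unfolding H1_def wdeg_add_link[OF fin RV] using gain by simp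
    \<comment> \<open>The two answers to the question about \<open>v\<close>: only a positive one changes \<open>H'\<close>.\<close>
    obtain fA1 fH1 where 1: "\<forall>I\<subseteq>V. \<exists>S. link_outcome V s thr \<Delta> H \<theta> ?A H1 I S (fA1 I) (fH1 I) \<and>
      (\<forall>J. S \<subseteq> J \<and> J \<subseteq> I \<longrightarrow> fA1 J = fA1 I \<and> fH1 J = fH1 I)"
      using less.hyps[OF smaller A1 H10 deg1] by (elim exE) (rule that)
    obtain fA2 fH2 where 2: "\<forall>I\<subseteq>V. \<exists>S. link_outcome V s thr \<Delta> H \<theta> ?A H' I S (fA2 I) (fH2 I) \<and>
      (\<forall>J. S \<subseteq> J \<and> J \<subseteq> I \<longrightarrow> fA2 J = fA2 I \<and> fH2 J = fH2 I)"
      using less.hyps[OF smaller A1 H'0 deg'] by (elim exE) (rule that)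
    define fA where "fA J = (if v \<in> J then fA1 J else fA2 J)" for J
    define fH where "fH J = (if v \<in> J then fH1 J else fH2 J)" for J
    have "\<exists>S. link_outcome V s thr \<Delta> H \<theta> A H' I S (fA I) (fH I) \<and>
      (\<forall>J. S \<subseteq> J \<and> J \<subseteq> I \<longrightarrow> fA J = fA I \<and> fH J = fH I)" if IV: "I \<subseteq> V" for I
    proof (cases "v \<in> I")
      case True
      obtain S where S: "link_outcome V s thr \<Delta> H \<theta> ?A H1 I S (fA1 I) (fH1 I)"
        "\<forall>J. S \<subseteq> J \<and> J \<subseteq> I \<longrightarrow> fA1 J = fA1 I \<and> fH1 J = fH1 I"
        using 1 IV by blast
      note S1 = link_outcomeD[OF S(1)]
      note SA = S1(1)
      have "finite S" "v \<notin> S" using SA finA finite_subset[of S A] by auto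
      then have c: "real (card (insert v S)) = card S + 1" by simp
      have tot: "wdeg V s H' {} + \<theta> * real (card (insert v S)) \<le> wdeg V s (fH1 I) {}"
        using S1(6) tot1 unfolding c by (simp add: algebra_simps)
      have step: "H' e \<noteq> 0 \<or> (\<exists>w\<in>insert v S. w \<notin> e \<and> H (insert w e) \<noteq> 0)" if ne: "fH1 I e \<noteq> 0" for e
      proof -
        consider "H1 e \<noteq> 0" | "\<exists>v\<in>S. v \<notin> e \<and> H (insert v e) \<noteq> 0"
          using S1(8) ne by blast
        then show ?thesis
        proof cases
          case 1
          then show ?thesis unfolding H1_def add_link_def by (auto split: if_splits)
        qed blast
      qed
      have "link_outcome V s thr \<Delta> H \<theta> A H' I (insert v S) (fA1 I) (fH1 I)"
        unfolding link_outcome_def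
      proof (intro conjI)
        show "\<forall>e. fH1 I e \<noteq> 0 \<longrightarrow> H' e \<noteq> 0 \<or> (\<exists>w\<in>insert v S. w \<notin> e \<and> H (insert w e) \<noteq> 0)"
          using step by blast
        show "insert v S \<subseteq> I \<inter> A" using SA True vA by blast
        show "fA1 I \<subseteq> A" "I \<inter> A \<subseteq> fA1 I \<union> insert v S" using S1(2,3) by blast+
      qed (fact S1(4) S1(5) S1(7) tot)+
      moreover have "\<forall>J. insert v S \<subseteq> J \<and> J \<subseteq> I \<longrightarrow> fA J = fA I \<and> fH J = fH I"
      proof (intro allI impI)
        fix J assume J: "insert v S \<subseteq> J \<and> J \<subseteq> I"
        then have "v \<in> J" "fA1 J = fA1 I \<and> fH1 J = fH1 I" using S(2) by blast+
        then show "fA J = fA I \<and> fH J = fH I" using True unfolding fA_def fH_def by simp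
      qed
      moreover have "fA I = fA1 I" "fH I = fH1 I" using True by (simp_all add: fA_def fH_def)
      ultimately show ?thesis by (intro exI[of _ "insert v S"] conjI) simp_all
    next
      case False
      obtain S where S: "link_outcome V s thr \<Delta> H \<theta> ?A H' I S (fA2 I) (fH2 I)"
        "\<forall>J. S \<subseteq> J \<and> J \<subseteq> I \<longrightarrow> fA2 J = fA2 I \<and> fH2 J = fH2 I"
        using 2 IV by blast
      note S1 = link_outcomeD[OF S(1)]
      have "link_outcome V s thr \<Delta> H \<theta> A H' I S (fA2 I) (fH2 I)"
        unfolding link_outcome_def
      proof (intro conjI)
        show "S \<subseteq> I \<inter> A" using S1(1) by blast
        show "fA2 I \<subseteq> A" "I \<inter> A \<subseteq> fA2 I \<union> S" using S1(2,3) False by blast+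
      qed (fact S1)+
      moreover have "\<forall>J. S \<subseteq> J \<and> J \<subseteq> I \<longrightarrow> fA J = fA I \<and> fH J = fH I"
      proof (intro allI impI)
        fix J assume J: "S \<subseteq> J \<and> J \<subseteq> I"
        then have "v \<notin> J" "fA2 J = fA2 I \<and> fH2 J = fH2 I" using S(2) False by blast+
        then show "fA J = fA I \<and> fH J = fH I" using False unfolding fA_def fH_def by simp
      qed
      moreover have "fA I = fA2 I" "fH I = fH2 I" using False by (simp_all add: fA_def fH_def)
      ultimately show ?thesis by (intro exI[of _ S] conjI) simp_all
    qed
    then show ?thesis by (intro exI[of _ fA] exI[of _ fH] allI impI)
  qed
qed

text \<open>Double counting: each edge contains \<open>s choose j\<close> sets of size \<open>j\<close>.\<close>

lemma sum_wdeg_nsets: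
  assumes fin: "finite V"
  shows "(\<Sum>T\<in>[V]\<^bsup>j\<^esup>. wdeg V s H T) = (s choose j) * wdeg V s H {}"
proof -
  have "(\<Sum>T\<in>[V]\<^bsup>j\<^esup>. wdeg V s H T) = (\<Sum>T\<in>[V]\<^bsup>j\<^esup>. \<Sum>e | e \<in> [V]\<^bsup>s\<^esup> \<and> T \<subseteq> e. H e)"
    unfolding wdeg_def ..
  also have "\<dots> = (\<Sum>e\<in>[V]\<^bsup>s\<^esup>. \<Sum>T | T \<in> [V]\<^bsup>j\<^esup> \<and> T \<subseteq> e. H e)"
    by (rule sum.swap_restrict) (use fin finite_imp_finite_nsets in auto)
  also have "\<dots> = (\<Sum>e\<in>[V]\<^bsup>s\<^esup>. (s choose j) * H e)"
  proof (rule sum.cong[OF refl])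
    fix e assume e: "e \<in> [V]\<^bsup>s\<^esup>"
    then have "{T. T \<in> [V]\<^bsup>j\<^esup> \<and> T \<subseteq> e} = {T. T \<subseteq> e \<and> card T = j}"
      using finite_subset[of _ e] by (auto simp: nsets_def)
    then show "(\<Sum>T | T \<in> [V]\<^bsup>j\<^esup> \<and> T \<subseteq> e. H e) = (s choose j) * H e"
      using e n_subsets[of e j] by (simp add: nsets_def)
  qed
  finally show ?thesis unfolding wdeg_def by (simp add: sum_distrib_left)
qed

lemma sum_UN_le:
  fixes f :: "'b \<Rightarrow> real"
  assumes "finite I" "\<And>i. i \<in> I \<Longrightarrow> finite (A i)" "\<And>x. f x \<ge> 0"
  shows "sum f (\<Union>i\<in>I. A i) \<le> (\<Sum>i\<in>I. sum f (A i))"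
  using assms(1,2)
proof (induction I rule: finite_induct)
  case (insert i I)
  have "sum f (A i \<union> (\<Union>i\<in>I. A i)) \<le> sum f (A i) + sum f (\<Union>i\<in>I. A i)"
    using insert.prems insert.hyps assms(3) sum.union_inter[of "A i" "\<Union>i\<in>I. A i" f]
      sum_nonneg[of "A i \<inter> (\<Union>i\<in>I. A i)" f] by force
  with insert show ?case by fastforce
qed simp

text \<open>\<open>f\<close> assigns to each independent \<open>I\<close> a container that misses a \<open>\<delta>\<close>-fraction of \<open>V\<close> and covers \<open>I\<close> up to
a fingerprint \<open>S\<close> of size at most \<open>c\<close>. The last condition says that the fingerprint determines the
container; taking \<open>J = S\<close> gives \<open>f S = f I\<close>, so the number of containers is at most the number of
fingerprints.\<close>

definition container_map where
  "container_map V ind \<delta> c f \<longleftrightarrow>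
    (\<forall>I\<subseteq>V. ind I \<longrightarrow> (\<exists>S\<subseteq>I. real (card S) \<le> c \<and> I \<subseteq> f I \<union> S \<and> f I \<subseteq> V \<and>
       real (card (f I)) \<le> (1 - \<delta>) * real (card V) \<and> (\<forall>J. S \<subseteq> J \<and> J \<subseteq> I \<longrightarrow> f J = f I)))"

text \<open>If the process has stopped, then every edge of \<open>H\<close> is residual, or meets the removed vertices
\<open>V - A\<close>, or contains a saturated set. The first kind weighs at most \<open>\<theta> * card A\<close>, the second at most
\<open>D * card (V - A)\<close>. For the third kind, a saturated set has in \<open>H\<^sub>1\<close> at least \<open>\<tau>\<close> times its
maximal degree in \<open>H\<close>, and the degrees of all sets in \<open>H\<^sub>1\<close> sum up to \<open>2 ^ s\<close> times its weight.\<close>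

lemma link_weight_lower:
  fixes H H\<^sub>1 :: "'a set \<Rightarrow> real"
  assumes fin: "finite V" and H0: "\<And>e. H e \<ge> 0" and H10: "\<And>e. H\<^sub>1 e \<ge> 0" and tau: "\<tau> > 0"
    and degH: "degs_le V (Suc s) H (\<lambda>j. D * \<tau> ^ (j - 1))"
    and A: "A \<subseteq> V"
    and stuck: "\<forall>v\<in>A. (\<Sum>e | e \<in> residual V s (\<lambda>j. D * \<tau> ^ j) H\<^sub>1 A \<and> v \<in> e. H e) < \<theta>"
  shows "wdeg V (Suc s) H {} \<le> \<theta> * card A + D * card (V - A) + 2 ^ s / \<tau> * wdeg V s H\<^sub>1 {}"
proof -
  let ?R = "residual V s (\<lambda>j. D * \<tau> ^ j) H\<^sub>1 A"
  let ?Sat = "{T. saturated V s (\<lambda>j. D * \<tau> ^ j) H\<^sub>1 T}"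
  let ?X = "\<Union>v\<in>V - A. {e. e \<in> [V]\<^bsup>Suc s\<^esup> \<and> {v} \<subseteq> e}"
  let ?Y = "\<Union>T\<in>?Sat. {e. e \<in> [V]\<^bsup>Suc s\<^esup> \<and> T \<subseteq> e}"
  have finA: "finite A" using A fin finite_subset by blast
  have Sat: "?Sat \<subseteq> Pow V" unfolding saturated_def by auto
  have finSat: "finite ?Sat" using Sat fin by (meson finite_Pow_iff finite_subset)
  have finN: "finite ([V]\<^bsup>Suc s\<^esup>)" using fin finite_imp_finite_nsets by blast
  have RV: "?R \<subseteq> [V]\<^bsup>Suc s\<^esup>" using residual_subset[OF A] .
  then have finR: "finite ?R" using finN finite_subset by blast
  have cover: "[V]\<^bsup>Suc s\<^esup> \<subseteq> ?R \<union> (?X \<union> ?Y)"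
  proof
    fix e assume e: "e \<in> [V]\<^bsup>Suc s\<^esup>"
    show "e \<in> ?R \<union> (?X \<union> ?Y)"
    proof (cases "e \<subseteq> A")
      case True
      then show ?thesis using e unfolding residual_def by (auto simp: nsets_def)
    next
      case False
      then show ?thesis using e by (auto simp: nsets_def)
    qed
  qed
  have finXY: "finite ?X" "finite ?Y" using fin finSat finN by auto
  have "wdeg V (Suc s) H {} \<le> sum H (?R \<union> (?X \<union> ?Y))"
    unfolding wdeg_def using cover finR finXY H0 by (intro sum_mono2) auto
  also have "\<dots> \<le> sum H ?R + (sum H ?X + sum H ?Y)"
    using finR finXY H0 sum.union_inter[of ?R "?X \<union> ?Y" H] sum.union_inter[of ?X ?Y H]
      sum_nonneg[of "?R \<inter> (?X \<union> ?Y)" H] sum_nonneg[of "?X \<inter> ?Y" H] by auto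
  also have "sum H ?R \<le> (\<Sum>v\<in>A. \<Sum>e | e \<in> ?R \<and> v \<in> e. H e)"
  proof -
    have "sum H ?R \<le> sum H (\<Union>v\<in>A. {e. e \<in> ?R \<and> v \<in> e})"
    proof (rule sum_mono2)
      show "?R \<subseteq> (\<Union>v\<in>A. {e. e \<in> ?R \<and> v \<in> e})"
      proof
        fix e assume e: "e \<in> ?R"
        then have "e \<subseteq> A" "e \<noteq> {}" unfolding residual_def nsets_def by auto
        then show "e \<in> (\<Union>v\<in>A. {e. e \<in> ?R \<and> v \<in> e})" using e by blast
      qed
    qed (use finA finR H0 in auto)
    also have "\<dots> \<le> (\<Sum>v\<in>A. \<Sum>e | e \<in> ?R \<and> v \<in> e. H e)"
      by (rule sum_UN_le) (use finA finR H0 in auto)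
    finally show ?thesis .
  qed
  also have "\<dots> \<le> (\<Sum>v\<in>A. \<theta>)" by (rule sum_mono) (use stuck in force)
  also have "sum H ?X \<le> (\<Sum>v\<in>V - A. wdeg V (Suc s) H {v})"
    unfolding wdeg_def by (rule sum_UN_le) (use fin H0 finN in auto)
  also have "\<dots> \<le> (\<Sum>v\<in>V - A. D)"
    by (rule sum_mono) (use degH[unfolded degs_le_def, rule_format, of "{_}"] in auto)
  also have "sum H ?Y \<le> (\<Sum>T\<in>?Sat. wdeg V (Suc s) H T)"
    unfolding wdeg_def by (rule sum_UN_le) (use finSat H0 finN in auto)
  also have "\<dots> \<le> (\<Sum>T\<in>?Sat. wdeg V s H\<^sub>1 T / \<tau>)"
  proof (rule sum_mono)
    fix T assume "T \<in> ?Sat"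
    then have T: "T \<subseteq> V" "T \<noteq> {}" "card T \<le> s" and big: "D * \<tau> ^ card T \<le> wdeg V s H\<^sub>1 T"
      unfolding saturated_def by auto
    have "card T > 0" using T fin finite_subset card_gt_0_iff by blast
    then obtain j where j: "card T = Suc j" by (cases "card T") auto
    have "wdeg V (Suc s) H T \<le> D * \<tau> ^ j"
      using degH[unfolded degs_le_def, rule_format, of T] T j by auto
    also have "\<dots> = (D * \<tau> ^ card T) / \<tau>" using tau j by simp
    also have "\<dots> \<le> wdeg V s H\<^sub>1 T / \<tau>" using big tau by (intro divide_right_mono) auto
    finally show "wdeg V (Suc s) H T \<le> wdeg V s H\<^sub>1 T / \<tau>" .
  qed
  also have "\<dots> = (\<Sum>T\<in>?Sat. wdeg V s H\<^sub>1 T) / \<tau>" by (rule sum_divide_distrib[symmetric])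
  also have "(\<Sum>T\<in>?Sat. wdeg V s H\<^sub>1 T) \<le> (\<Sum>T\<in>(\<Union>j\<in>{..s}. [V]\<^bsup>j\<^esup>). wdeg V s H\<^sub>1 T)"
  proof (rule sum_mono2)
    show "?Sat \<subseteq> (\<Union>j\<in>{..s}. [V]\<^bsup>j\<^esup>)"
      using fin finite_subset unfolding saturated_def nsets_def by auto
  qed (use fin finite_imp_finite_nsets wdeg_nonneg[of H\<^sub>1, OF H10] in auto)
  also have "\<dots> \<le> (\<Sum>j\<le>s. \<Sum>T\<in>[V]\<^bsup>j\<^esup>. wdeg V s H\<^sub>1 T)"
    by (rule sum_UN_le) (use fin finite_imp_finite_nsets wdeg_nonneg[of H\<^sub>1, OF H10] in auto)
  also have "\<dots> = (\<Sum>j\<le>s. real (s choose j)) * wdeg V s H\<^sub>1 {}"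
    using sum_wdeg_nsets[OF fin, of s H\<^sub>1] by (simp add: sum_distrib_right)
  also have "(\<Sum>j\<le>s. real (s choose j)) = 2 ^ s"
    using choose_row_sum[of s] by (metis of_nat_sum of_nat_power of_nat_numeral)
  finally show ?thesis using tau by (simp add: divide_right_mono algebra_simps)
qed

text \<open>Balanced hypergraphs have containers. The induction is on the uniformity. A run of the process
with \<open>\<theta> = E / (4 N)\<close>, where \<open>E\<close> is the weight of \<open>H\<close> and \<open>N = card V\<close>, has a fingerprint of size
\<open>O(\<tau> N)\<close>, since each of its members adds weight \<open>\<theta>\<close> to a hypergraph of weight \<open>O(\<tau> E)\<close>. If it
removed at least \<open>N / (4 K)\<close> vertices, the remaining active set is the container. Otherwise the
preceding lemma shows that the collected hypergraph \<open>H\<^sub>1\<close> has weight at least of order \<open>\<tau> E\<close>; it is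
then balanced again, with a larger constant, and \<open>I\<close> is independent in it because an edge of \<open>H\<^sub>1\<close>
inside \<open>I\<close> extends by a member of the fingerprint to an edge of \<open>H\<close> inside \<open>I\<close>.\<close>

theorem hypergraph_containers:
  fixes K :: real
  assumes "s \<ge> 1" and "K > 0"
  shows "\<exists>\<delta>>0. \<exists>C>0. \<delta> < 1 \<and> (\<forall>(V :: 'a set) H \<tau>. finite V \<longrightarrow> V \<noteq> {} \<longrightarrow> \<tau> > 0 \<longrightarrow> (\<forall>e. H e \<ge> 0) \<longrightarrow>
     wdeg V s H {} > 0 \<longrightarrow> degs_le V s H (\<lambda>j. K * wdeg V s H {} / card V * \<tau> ^ (j - 1)) \<longrightarrow>
     (\<exists>f. container_map V (windep s H) \<delta> (C * \<tau> * card V) f))"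
  using assms
proof (induction s arbitrary: K rule: nat_induct_at_least)
  case base
  define \<delta> where "\<delta> = min (1 / K) (1/2)"
  have \<delta>: "0 < \<delta>" "\<delta> < 1" using base by (auto simp: \<delta>_def)
  show ?case
  proof (rule exI[of _ \<delta>], rule conjI[OF \<delta>(1)], rule exI[of _ 1], intro conjI allI impI)
    fix V :: "'a set" and H :: "'a set \<Rightarrow> real" and \<tau> :: real
    assume V: "finite V" "V \<noteq> {}" "\<tau> > 0" and H0: "\<forall>e. H e \<ge> 0" and E: "wdeg V 1 H {} > 0"
      and deg: "degs_le V 1 H (\<lambda>j. K * wdeg V 1 H {} / card V * \<tau> ^ (j - 1))"
    let ?E = "wdeg V 1 H {}" and ?N = "real (card V)"
    let ?U = "{v \<in> V. H {v} \<noteq> 0}"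
    have N: "?N > 0" using V by (simp add: card_gt_0_iff)
    have one: "[V]\<^bsup>1\<^esup> = (\<lambda>v. {v}) ` V" by (auto simp: nsets_def card_1_singleton_iff)
    have E1: "?E = (\<Sum>v\<in>V. H {v})"
      unfolding wdeg_def using one by (simp add: sum.reindex)
    have Hv: "H {v} \<le> K * ?E / ?N" if "v \<in> V" for v
    proof -
      have "{e. e \<in> [V]\<^bsup>1\<^esup> \<and> {v} \<subseteq> e} = {{v}}" using that one by auto
      then have "wdeg V 1 H {v} = H {v}" unfolding wdeg_def by simp
      then show ?thesis using deg[unfolded degs_le_def, rule_format, of "{v}"] that by auto
    qed
    have "?E = (\<Sum>v\<in>?U. H {v})" unfolding E1 by (rule sum.mono_neutral_right) (use V in auto)
    also have "\<dots> \<le> (\<Sum>v\<in>?U. K * ?E / ?N)" by (rule sum_mono) (use Hv in auto)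
    finally have "?E \<le> card ?U * (K * ?E / ?N)" by simp
    then have "?E * 1 \<le> ?E * (card ?U * K / ?N)" by (simp add: mult_ac)
    then have "1 \<le> card ?U * K / ?N" using E mult_le_cancel_left_pos by blast
    then have U: "?N / K \<le> card ?U" using N base by (simp add: field_simps)
    have c: "real (card (V - ?U)) = ?N - card ?U"
      using V by (subst card_Diff_subset) (auto intro: card_mono of_nat_diff)
    have "\<delta> * ?N \<le> 1 / K * ?N" using N by (intro mult_right_mono) (auto simp: \<delta>_def)
    then have small: "real (card (V - ?U)) \<le> (1 - \<delta>) * ?N" unfolding c using U by (simp add: algebra_simps)
    have "I \<subseteq> V - ?U" if "windep 1 H I" "I \<subseteq> V" for I
    proof -
      have "H {v} = 0" if "v \<in> I" for v
        using that \<open>windep 1 H I\<close> unfolding windep_def nsets_def by auto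
      then show ?thesis using that by auto
    qed
    then have "container_map V (windep 1 H) \<delta> (1 * \<tau> * ?N) (\<lambda>_. V - ?U)"
      unfolding container_map_def using small V by (intro allI impI exI[of _ "{}"]) auto
    then show "\<exists>f. container_map V (windep 1 H) \<delta> (1 * \<tau> * ?N) f" by blast
  qed (use \<delta> in auto)
next
  case (Suc s)
  define K' where "K' = 2 ^ (s + 2) * K"
  have K: "K > 0" and K': "K' > 0" using Suc.prems by (auto simp: K'_def)
  obtain \<delta>' C' where \<delta>': "\<delta>' > 0" "C' > 0" "\<delta>' < 1" and
    IH: "\<forall>(V :: 'a set) H \<tau>. finite V \<longrightarrow> V \<noteq> {} \<longrightarrow> \<tau> > 0 \<longrightarrow> (\<forall>e. H e \<ge> 0) \<longrightarrow>
     wdeg V s H {} > 0 \<longrightarrow> degs_le V s H (\<lambda>j. K' * wdeg V s H {} / card V * \<tau> ^ (j - 1)) \<longrightarrow>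
     (\<exists>f. container_map V (windep s H) \<delta>' (C' * \<tau> * card V) f)"
    using Suc.IH[OF K'] by (elim exE conjE) (rule that; assumption)
  define \<delta> where "\<delta> = min \<delta>' (1 / (4 * K))"
  define C where "C = 8 * K + C'"
  have \<delta>: "\<delta> > 0" "\<delta> < 1" "\<delta> \<le> \<delta>'" "\<delta> \<le> 1 / (4 * K)" and C: "C > 0"
    using \<delta>' K by (auto simp: \<delta>_def C_def)
  show ?case
  proof (rule exI[of _ \<delta>], rule conjI[OF \<delta>(1)], rule exI[of _ C], intro conjI allI impI)
    fix V :: "'a set" and H :: "'a set \<Rightarrow> real" and \<tau> :: real
    assume V: "finite V" "V \<noteq> {}" and tau: "\<tau> > 0" and H0: "\<forall>e. H e \<ge> 0"
      and E0: "wdeg V (Suc s) H {} > 0"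
      and deg: "degs_le V (Suc s) H (\<lambda>j. K * wdeg V (Suc s) H {} / card V * \<tau> ^ (j - 1))"
    define E where "E = wdeg V (Suc s) H {}"
    define N where "N = real (card V)"
    define D where "D = K * E / N"
    define \<theta> where "\<theta> = E / (4 * N)"
    have N: "N > 0" using V by (simp add: card_gt_0_iff N_def)
    have E: "E > 0" using E0 by (simp add: E_def)
    have D: "D > 0" and theta: "\<theta> > 0" using K E N by (auto simp: D_def \<theta>_def)
    let ?thr = "\<lambda>j. D * \<tau> ^ j" and ?\<Delta> = "\<lambda>j. D * \<tau> ^ (j - 1)"
    have deg: "degs_le V (Suc s) H ?\<Delta>" using deg by (simp add: D_def E_def N_def)
    have deg0: "degs_le V s (\<lambda>_. 0) (\<lambda>j. ?thr j + ?\<Delta> (Suc j))"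
      unfolding degs_le_def wdeg_def using D tau by simp
    have z: "\<forall>e::'a set. 0 \<le> (0::real)" by simp
    have D0: "?\<Delta> j \<ge> 0" for j using D tau by simp
    obtain fA fH where proc: "\<forall>I\<subseteq>V. \<exists>S. link_outcome V s ?thr ?\<Delta> H \<theta> V (\<lambda>_. 0) I S (fA I) (fH I) \<and>
      (\<forall>J. S \<subseteq> J \<and> J \<subseteq> I \<longrightarrow> fA J = fA I \<and> fH J = fH I)"
      using link_process[OF V(1) H0[rule_format] D0 deg subset_refl z deg0, of \<theta>]
      by (elim exE) (rule that)
    \<comment> \<open>A fixed choice of container map for each hypergraph makes the second stage a function of \<open>fH J\<close>
      alone.\<close>
    define g where "g H\<^sub>1 = (SOME f. container_map V (windep s H\<^sub>1) \<delta>' (C' * \<tau> * N) f)" for H\<^sub>1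
    define f where "f J = (if real (card (V - fA J)) \<ge> N / (4 * K) then fA J else g (fH J) J)" for J
    have "\<exists>S\<subseteq>I. real (card S) \<le> C * \<tau> * N \<and> I \<subseteq> f I \<union> S \<and> f I \<subseteq> V \<and>
       real (card (f I)) \<le> (1 - \<delta>) * N \<and> (\<forall>J. S \<subseteq> J \<and> J \<subseteq> I \<longrightarrow> f J = f I)"
      if IV: "I \<subseteq> V" and ind: "windep (Suc s) H I" for I
    proof -
      obtain S where out: "link_outcome V s ?thr ?\<Delta> H \<theta> V (\<lambda>_. 0) I S (fA I) (fH I)"
        and stable: "\<forall>J. S \<subseteq> J \<and> J \<subseteq> I \<longrightarrow> fA J = fA I \<and> fH J = fH I"
        using proc IV by blast
      note o = link_outcomeD[OF out]
      define E\<^sub>1 where "E\<^sub>1 = wdeg V s (fH I) {}"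
      have SI: "S \<subseteq> I" using o(1) by blast
      have A: "fA I \<subseteq> V" using o(2) .
      have "E\<^sub>1 \<le> s * E\<^sub>1"
        using Suc.hyps wdeg_nonneg[of "fH I" V s "{}"] o(4) by (simp add: E\<^sub>1_def mult_le_cancel_right1)
      also have "\<dots> = (\<Sum>T\<in>[V]\<^bsup>1\<^esup>. wdeg V s (fH I) T)" using sum_wdeg_nsets[OF V(1), of s "fH I" 1] by (simp add: E\<^sub>1_def)
      also have "\<dots> \<le> (\<Sum>T\<in>[V]\<^bsup>1\<^esup>. 2 * D * \<tau>)"
      proof (rule sum_mono)
        fix T assume "T \<in> [V]\<^bsup>1\<^esup>"
        then have "T \<subseteq> V" "T \<noteq> {}" "card T = 1" by (auto simp: nsets_def)
        then show "wdeg V s (fH I) T \<le> 2 * D * \<tau>"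
          using o(5)[unfolded degs_le_def, rule_format, of T] Suc.hyps by simp
      qed
      also have "\<dots> = 2 * D * \<tau> * N"
        using card_nsets[of V 1] by (simp add: N_def)
      finally have E1le: "E\<^sub>1 \<le> 2 * K * \<tau> * E" using N by (simp add: D_def mult_ac)
      have "\<theta> * card S \<le> E\<^sub>1" using o(6) unfolding E\<^sub>1_def by (simp add: wdeg_def)
      then have "E * card S \<le> E\<^sub>1 * (4 * N)" using N by (simp add: \<theta>_def field_simps)
      also have "\<dots> \<le> 2 * K * \<tau> * E * (4 * N)" using E1le N by (intro mult_right_mono) auto
      also have "\<dots> = E * (8 * K * \<tau> * N)" by simp
      finally have "E * card S \<le> E * (8 * K * \<tau> * N)" .
      then have cS: "card S \<le> 8 * K * \<tau> * N" using E by simp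
      show ?thesis
      proof (cases "real (card (V - fA I)) \<ge> N / (4 * K)")
        case True
        have "real (card (V - fA I)) = N - card (fA I)"
          using V A finite_subset[OF A] card_mono[OF V(1) A] by (simp add: card_Diff_subset N_def of_nat_diff)
        moreover have "\<delta> * N \<le> 1 / (4 * K) * N" using \<delta> N by (intro mult_right_mono) auto
        ultimately have "real (card (fA I)) \<le> (1 - \<delta>) * N" using True by (simp add: algebra_simps)
        moreover have "card S \<le> C * \<tau> * N"
        proof -
          have "8 * K * \<tau> * N \<le> C * \<tau> * N" using \<delta>' tau N by (auto simp: C_def intro!: mult_right_mono)
          then show ?thesis using cS by linarith
        qed
        moreover have "\<forall>J. S \<subseteq> J \<and> J \<subseteq> I \<longrightarrow> f J = f I"
        proof (intro allI impI)
          fix J assume "S \<subseteq> J \<and> J \<subseteq> I"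
          then have "fA J = fA I" "fH J = fH I" using stable by blast+
          then show "f J = f I" using True unfolding f_def by simp
        qed
        moreover have "f I = fA I" using True by (simp add: f_def)
        moreover have "I \<subseteq> fA I \<union> S" using o(3) IV by blast
        ultimately show ?thesis using A SI by (intro exI[of _ S] conjI) simp_all
      next
        case False
        have "E \<le> \<theta> * card (fA I) + D * card (V - fA I) + 2 ^ s / \<tau> * E\<^sub>1"
          unfolding E_def E\<^sub>1_def
          by (rule link_weight_lower) (use V H0 o(4) tau deg A o(7) in auto)
        also have "\<theta> * card (fA I) \<le> \<theta> * N"
          using theta card_mono[OF V(1) A] by (simp add: N_def)
        also have "\<theta> * N = E / 4" using N by (simp add: \<theta>_def)
        also have "D * card (V - fA I) \<le> D * (N / (4 * K))"
          using False D by (intro mult_left_mono) auto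
        also have "\<dots> = E / 4" using N K by (simp add: D_def)
        finally have "E / 2 \<le> 2 ^ s / \<tau> * E\<^sub>1" by linarith
        then have "E / 2 \<le> 2 ^ s * E\<^sub>1 / \<tau>" by simp
        then have "E / 2 * \<tau> \<le> 2 ^ s * E\<^sub>1" using tau by (simp add: pos_le_divide_eq)
        then have E1ge: "\<tau> * E \<le> 2 ^ (s + 1) * E\<^sub>1" by (simp add: mult_ac)
        have E1: "E\<^sub>1 > 0"
        proof -
          have "0 < \<tau> * E" using tau E by simp
          then have "0 < 2 ^ (s + 1) * E\<^sub>1" using E1ge by linarith
          then show ?thesis by (simp add: zero_less_mult_iff)
        qed
        have "degs_le V s (fH I) (\<lambda>j. K' * E\<^sub>1 / N * \<tau> ^ (j - 1))"
          unfolding degs_le_def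
        proof (intro allI impI)
          fix T assume T: "T \<subseteq> V" "T \<noteq> {}" "card T \<le> s"
          have "card T > 0" using T V finite_subset card_gt_0_iff by blast
          then obtain j where j: "card T = Suc j" by (cases "card T") auto
          have "wdeg V s (fH I) T \<le> 2 * D * \<tau> ^ Suc j"
            using o(5)[unfolded degs_le_def, rule_format, OF T] j by simp
          also have "\<dots> = 2 * K / N * \<tau> ^ j * (\<tau> * E)" by (simp add: D_def)
          also have "\<dots> \<le> 2 * K / N * \<tau> ^ j * (2 ^ (s + 1) * E\<^sub>1)"
            using E1ge K N tau by (intro mult_left_mono) auto
          also have "\<dots> = K' * E\<^sub>1 / N * \<tau> ^ (card T - 1)" using j by (simp add: K'_def)
          finally show "wdeg V s (fH I) T \<le> K' * E\<^sub>1 / N * \<tau> ^ (card T - 1)" .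
        qed
        then have "\<exists>f. container_map V (windep s (fH I)) \<delta>' (C' * \<tau> * N) f"
          using IH[rule_format, OF V tau o(4)[rule_format]] E1 by (simp add: E\<^sub>1_def N_def)
        then have g: "container_map V (windep s (fH I)) \<delta>' (C' * \<tau> * N) (g (fH I))"
          unfolding g_def by (rule someI_ex)
        have wi: "windep s (fH I) I"
          unfolding windep_def
        proof (rule ballI, rule ccontr)
          fix e assume e: "e \<in> [I]\<^bsup>s\<^esup>" and "fH I e \<noteq> 0"
          then obtain v where "v \<in> S" "v \<notin> e" "H (insert v e) \<noteq> 0" using o(8)[rule_format, of e] by auto
          moreover have "insert v e \<in> [I]\<^bsup>Suc s\<^esup>" using e calculation SI by (auto simp: nsets_def)
          ultimately show False using ind unfolding windep_def by blast
        qed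
        obtain S' where S': "S' \<subseteq> I" "real (card S') \<le> C' * \<tau> * N" "I \<subseteq> g (fH I) I \<union> S'"
          "g (fH I) I \<subseteq> V" "real (card (g (fH I) I)) \<le> (1 - \<delta>') * N"
          "\<forall>J. S' \<subseteq> J \<and> J \<subseteq> I \<longrightarrow> g (fH I) J = g (fH I) I"
          using g[unfolded container_map_def, rule_format, OF IV wi, folded N_def]
          by (elim exE conjE) (rule that)
        have fI: "f I = g (fH I) I" using False by (simp add: f_def)
        show ?thesis
        proof (intro exI[of _ "S \<union> S'"] conjI)
          show "real (card (S \<union> S')) \<le> C * \<tau> * N"
            using card_Un_le[of S S'] cS S'(2) by (simp add: C_def algebra_simps)
          show "real (card (f I)) \<le> (1 - \<delta>) * N"
          proof -
            have "(1 - \<delta>') * N \<le> (1 - \<delta>) * N" using \<delta> N by (intro mult_right_mono) auto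
            then show ?thesis using S'(5) fI by simp
          qed
          show "\<forall>J. S \<union> S' \<subseteq> J \<and> J \<subseteq> I \<longrightarrow> f J = f I"
          proof (intro allI impI)
            fix J assume J: "S \<union> S' \<subseteq> J \<and> J \<subseteq> I"
            then have "S \<subseteq> J \<and> J \<subseteq> I" "S' \<subseteq> J \<and> J \<subseteq> I" by blast+
            then have "fA J = fA I" "fH J = fH I" "g (fH I) J = g (fH I) I" using stable S'(6) by blast+
            then show "f J = f I" using False unfolding f_def by simp
          qed
          show "S \<union> S' \<subseteq> I" using SI S'(1) by blast
          show "I \<subseteq> f I \<union> (S \<union> S')" using S'(3) fI by blast
          show "f I \<subseteq> V" using S'(4) fI by simp
        qed
      qed
    qed
    then have "container_map V (windep (Suc s) H) \<delta> (C * \<tau> * real (card V)) f"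
      unfolding container_map_def N_def by blast
    then show "\<exists>f. container_map V (windep (Suc s) H) \<delta> (C * \<tau> * real (card V)) f" by blast
  qed (use \<delta> C in auto)
qed

section \<open>An upper tail bound from containers\<close>

lemma sum_Pow_power_card:
  fixes x :: real
  assumes "finite W"
  shows "(\<Sum>S\<in>Pow W. x ^ card S) = (1 + x) ^ card W"
  using assms
proof (induction W rule: finite_induct)
  case (insert a W)
  have disj: "Pow W \<inter> insert a ` Pow W = {}" using insert.hyps by auto
  have inj: "inj_on (insert a) (Pow W)" using insert.hyps by (auto intro!: inj_onI)
  have "(\<Sum>S\<in>insert a ` Pow W. x ^ card S) = (\<Sum>S\<in>Pow W. x * x ^ card S)"
    unfolding sum.reindex[OF inj] o_def
  proof (rule sum.cong[OF refl])
    fix S assume "S \<in> Pow W"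
    then have "finite S" "a \<notin> S" using insert.hyps finite_subset by auto
    then show "x ^ card (insert a S) = x * x ^ card S" by simp
  qed
  then have "(\<Sum>S\<in>Pow (insert a W). x ^ card S) = (1 + x) ^ card W + x * (1 + x) ^ card W"
    unfolding Pow_insert using insert disj
    by (subst sum.union_disjoint) (auto simp: sum_distrib_left[symmetric])
  then show ?case using insert.hyps by (simp add: algebra_simps)
qed simp

text \<open>Exponential Markov bound: multiply each term by \<open>l powr (s - card S) \<ge> 1\<close> and sum over all subsets.
The parameter \<open>l\<close> is free; the optimum would be \<open>p * card W / s\<close>.\<close>

lemma sum_small_subsets_le:
  fixes p l s :: real
  assumes "finite W" "p \<ge> 0" "l \<ge> 1"
  shows "(\<Sum>S | S \<subseteq> W \<and> real (card S) \<le> s. p ^ card S) \<le> exp (s * ln l + p * card W / l)"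
proof -
  have "(\<Sum>S | S \<subseteq> W \<and> real (card S) \<le> s. p ^ card S)
      \<le> (\<Sum>S | S \<subseteq> W \<and> real (card S) \<le> s. l powr s * (p / l) ^ card S)"
  proof (rule sum_mono)
    fix S assume "S \<in> {S. S \<subseteq> W \<and> real (card S) \<le> s}"
    then have "l powr real (card S) \<le> l powr s" using assms by (intro powr_mono) auto
    then have "l ^ card S \<le> l powr s" using assms by (simp add: powr_realpow)
    then have "l ^ card S * (p / l) ^ card S \<le> l powr s * (p / l) ^ card S"
      using assms by (intro mult_right_mono) auto
    moreover have "l ^ card S * (p / l) ^ card S = p ^ card S"
      using assms by (simp flip: power_mult_distrib)
    ultimately show "p ^ card S \<le> l powr s * (p / l) ^ card S" by simp
  qed
  also have "\<dots> \<le> (\<Sum>S\<in>Pow W. l powr s * (p / l) ^ card S)"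
    by (rule sum_mono2) (use assms in auto)
  also have "\<dots> = l powr s * (1 + p / l) ^ card W"
    using sum_Pow_power_card[OF assms(1), of "p / l"] by (simp add: sum_distrib_left[symmetric])
  also have "\<dots> \<le> l powr s * exp (p / l) ^ card W"
    using assms by (intro mult_left_mono power_mono) auto
  also have "\<dots> = exp (s * ln l + p * card W / l)"
    using assms by (simp add: powr_def exp_add exp_of_nat_mult[symmetric] mult_ac)
  finally show ?thesis .
qed

text \<open>The same with the factor \<open>exp 2 powr (card S - m) \<ge> 1\<close> on large sets, and \<open>exp 2 \<le> 8\<close>.\<close>

lemma sum_large_subsets_le:
  fixes p m :: real
  assumes "finite W" "p \<ge> 0"
  shows "(\<Sum>S | S \<subseteq> W \<and> m \<le> real (card S). p ^ card S) \<le> exp (8 * (p * card W) - 2 * m)"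
proof -
  have e2: "exp (2::real) \<le> 8"
  proof -
    have "exp (1::real) ^ 2 \<le> 2.75 ^ 2" using e_less_272 by (intro power_mono) auto
    then show ?thesis by (simp add: exp_of_nat_mult[symmetric] power2_eq_square flip: exp_add)
  qed
  have "(\<Sum>S | S \<subseteq> W \<and> m \<le> real (card S). p ^ card S)
      \<le> (\<Sum>S | S \<subseteq> W \<and> m \<le> real (card S). exp (- 2 * m) * (exp 2 * p) ^ card S)"
  proof (rule sum_mono)
    fix S assume "S \<in> {S. S \<subseteq> W \<and> m \<le> real (card S)}"
    then have "1 \<le> exp (- 2 * m) * exp (2 * real (card S))" by (simp flip: exp_add)
    then have "1 * p ^ card S \<le> (exp (- 2 * m) * exp (2 * real (card S))) * p ^ card S"
      using assms by (intro mult_right_mono) auto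
    also have "exp (2 * real (card S)) = exp 2 ^ card S" by (simp add: exp_of_nat_mult mult.commute)
    finally show "p ^ card S \<le> exp (- 2 * m) * (exp 2 * p) ^ card S"
      by (simp add: power_mult_distrib mult_ac)
  qed
  also have "\<dots> \<le> (\<Sum>S\<in>Pow W. exp (- 2 * m) * (exp 2 * p) ^ card S)"
    by (rule sum_mono2) (use assms in auto)
  also have "\<dots> = exp (- 2 * m) * (1 + exp 2 * p) ^ card W"
    using sum_Pow_power_card[OF assms(1), of "exp 2 * p"] by (simp add: sum_distrib_left[symmetric])
  also have "\<dots> \<le> exp (- 2 * m) * exp (8 * p) ^ card W"
  proof (intro mult_left_mono power_mono)
    have "1 + exp 2 * p \<le> 1 + 8 * p" using e2 assms by (simp add: mult_right_mono)
    also have "\<dots> \<le> exp (8 * p)" by (rule exp_ge_add_one_self)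
    finally show "1 + exp 2 * p \<le> exp (8 * p)" .
  qed (use assms in auto)
  also have "\<dots> = exp (8 * (p * card W) - 2 * m)"
    by (simp add: exp_add[symmetric] exp_of_nat_mult[symmetric] mult_ac)
  finally show ?thesis .
qed

text \<open>A family of pairs (fingerprint, container) that covers all independent subsets of \<open>W\<close>, with
containers so small that a \<open>p\<close>-random subset of one has at most \<open>M\<close> elements in expectation. The
fingerprints are not counted but weighted with the probability \<open>p ^ card S\<close> that a random set contains
them, so that the union bound over the family costs a factor \<open>exp \<Phi>\<close> only. The number of
fingerprints itself would cost an additional logarithm.\<close>

definition fingerprint_cover where
  "fingerprint_cover W ind p M \<Phi> P \<longleftrightarrow> finite P \<and>
     (\<forall>(S, C)\<in>P. S \<subseteq> W \<and> C \<subseteq> W \<and> S \<inter> C = {} \<and> p * real (card C) \<le> M \<and> real (card S) \<le> \<Phi>) \<and>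
     (\<Sum>(S, C)\<in>P. p ^ card S) \<le> exp \<Phi> \<and>
     (\<forall>I\<subseteq>W. ind I \<longrightarrow> (\<exists>(S, C)\<in>P. S \<subseteq> I \<and> I \<subseteq> S \<union> C))"

lemma fingerprint_coverD:
  assumes "fingerprint_cover W ind p M \<Phi> P"
  shows "finite P"
    "\<forall>(S, C)\<in>P. S \<subseteq> W \<and> C \<subseteq> W \<and> S \<inter> C = {} \<and> p * real (card C) \<le> M \<and> real (card S) \<le> \<Phi>"
    "(\<Sum>(S, C)\<in>P. p ^ card S) \<le> exp \<Phi>"
    "I \<subseteq> W \<Longrightarrow> ind I \<Longrightarrow> \<exists>(S, C)\<in>P. S \<subseteq> I \<and> I \<subseteq> S \<union> C"
  using assms[unfolded fingerprint_cover_def] by simp_all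

text \<open>One application of a container map, followed by covers of the containers that it yields. Weights
multiply because the fingerprint \<open>S'\<close> of the second stage is disjoint from that of the first stage:
the set covered in the second stage is \<open>I - S\<close> inside \<open>f S - S\<close>.\<close>

lemma fingerprint_cover_step:
  fixes p \<kappa> \<Phi> \<Phi>' M :: real and W :: "'a set"
  assumes fin: "finite W" and p: "0 \<le> p"
    and down: "\<And>I J. ind I \<Longrightarrow> J \<subseteq> I \<Longrightarrow> ind J"
    and f: "container_map W ind \<delta> s f"
    and sk: "s \<le> \<kappa>" and small: "(\<Sum>S | S \<subseteq> W \<and> real (card S) \<le> s. p ^ card S) \<le> exp \<kappa>"
    and rec: "\<And>W'. W' \<subseteq> W \<Longrightarrow> real (card W') \<le> (1 - \<delta>) * real (card W) \<Longrightarrow>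
                \<exists>P. fingerprint_cover W' ind p M \<Phi>' P"
    and Phi: "\<kappa> + \<Phi>' \<le> \<Phi>"
  shows "\<exists>P. fingerprint_cover W ind p M \<Phi> P"
proof -
  define \<S> where "\<S> = {S. S \<subseteq> W \<and> real (card S) \<le> s \<and> f S \<subseteq> W \<and> real (card (f S)) \<le> (1 - \<delta>) * card W}"
  have finS: "finite \<S>" using fin unfolding \<S>_def by auto
  have "\<exists>P. fingerprint_cover (f S - S) ind p M \<Phi>' P" if "S \<in> \<S>" for S
  proof (rule rec)
    have "finite (f S)" using that fin finite_subset unfolding \<S>_def by blast
    then have "card (f S - S) \<le> card (f S)" by (intro card_mono) auto
    then show "real (card (f S - S)) \<le> (1 - \<delta>) * real (card W)" using that unfolding \<S>_def by auto
  qed (use that in \<open>auto simp: \<S>_def\<close>)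
  then obtain Q where Q: "\<And>S. S \<in> \<S> \<Longrightarrow> fingerprint_cover (f S - S) ind p M \<Phi>' (Q S)" by metis
  define g where "g = (\<lambda>(S :: 'a set, S', C :: 'a set). (S \<union> S', C))"
  define P where "P = g ` (SIGMA S:\<S>. Q S)"
  have finQ: "finite (Q S)" if "S \<in> \<S>" for S using Q[OF that] unfolding fingerprint_cover_def by blast
  have finP: "finite P" unfolding P_def using finS finQ by (intro finite_imageI finite_SigmaI) auto
  have Qprop: "S' \<subseteq> f S - S" "C \<subseteq> f S - S" "S' \<inter> C = {}" "p * real (card C) \<le> M" "real (card S') \<le> \<Phi>'"
    if "S \<in> \<S>" "(S', C) \<in> Q S" for S S' C
    using Q[OF that(1)] that(2) unfolding fingerprint_cover_def by auto
  have cardU: "card (S \<union> S') = card S + card S'" if "S \<in> \<S>" "(S', C) \<in> Q S" for S S' C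
  proof (rule card_Un_disjoint)
    have SW: "S \<subseteq> W" "f S \<subseteq> W" using that(1) unfolding \<S>_def by auto
    show "finite S" by (rule finite_subset[OF SW(1) fin])
    have "S' \<subseteq> W" using Qprop(1)[OF that] SW by blast
    then show "finite S'" by (rule finite_subset[OF _ fin])
    show "S \<inter> S' = {}" using Qprop(1)[OF that] by blast
  qed
  have weight: "(\<Sum>(S, C)\<in>P. p ^ card S) \<le> exp \<Phi>"
  proof -
    have "(\<Sum>(S, C)\<in>P. p ^ card S) \<le> sum ((\<lambda>(S, C). p ^ card S) \<circ> g) (SIGMA S:\<S>. Q S)"
      unfolding P_def using finS finQ p
      by (intro sum_image_le finite_SigmaI) (auto simp: split_beta)
    also have "\<dots> = (\<Sum>S\<in>\<S>. \<Sum>y\<in>Q S. ((\<lambda>(S, C). p ^ card S) \<circ> g) (S, y))"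
      using finS finQ by (subst sum.Sigma) (auto simp: split_beta)
    also have "\<dots> = (\<Sum>S\<in>\<S>. p ^ card S * (\<Sum>(S', C)\<in>Q S. p ^ card S'))"
      unfolding sum_distrib_left
      by (intro sum.cong refl) (auto simp: g_def cardU power_add)
    also have "\<dots> \<le> (\<Sum>S\<in>\<S>. p ^ card S * exp \<Phi>')"
    proof (intro sum_mono mult_left_mono)
      fix S assume "S \<in> \<S>"
      then show "(\<Sum>(S', C)\<in>Q S. p ^ card S') \<le> exp \<Phi>'" using Q unfolding fingerprint_cover_def by blast
    qed (use p in auto)
    also have "\<dots> = (\<Sum>S\<in>\<S>. p ^ card S) * exp \<Phi>'" by (simp add: sum_distrib_right)
    also have "(\<Sum>S\<in>\<S>. p ^ card S) \<le> (\<Sum>S | S \<subseteq> W \<and> real (card S) \<le> s. p ^ card S)"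
      by (rule sum_mono2) (use fin p in \<open>auto simp: \<S>_def\<close>)
    also have "\<dots> \<le> exp \<kappa>" by (rule small)
    also have "exp \<kappa> * exp \<Phi>' \<le> exp \<Phi>" using Phi by (simp flip: exp_add)
    finally show ?thesis by (simp add: mult_right_mono)
  qed
  have cover: "\<exists>(S, C)\<in>P. S \<subseteq> I \<and> I \<subseteq> S \<union> C" if I: "I \<subseteq> W" "ind I" for I
  proof -
    from f[unfolded container_map_def, rule_format, OF I]
    obtain S where S: "S \<subseteq> I" "real (card S) \<le> s" "I \<subseteq> f I \<union> S" "f I \<subseteq> W"
      "real (card (f I)) \<le> (1 - \<delta>) * card W" "\<forall>J. S \<subseteq> J \<and> J \<subseteq> I \<longrightarrow> f J = f I"
      by (elim exE conjE) (rule that)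
    have fS: "f S = f I" using S(6) S(1) by blast
    have SS: "S \<in> \<S>" using S(1,2,4,5) I(1) unfolding \<S>_def mem_Collect_eq fS by blast
    have sub: "I - S \<subseteq> f S - S" using S(3) unfolding fS by blast
    have "ind (I - S)" by (rule down[OF I(2)]) blast
    then have "\<exists>(S', C)\<in>Q S. S' \<subseteq> I - S \<and> I - S \<subseteq> S' \<union> C"
      using Q[OF SS] sub unfolding fingerprint_cover_def by simp
    then obtain S' C where SC: "(S', C) \<in> Q S" "S' \<subseteq> I - S" "I - S \<subseteq> S' \<union> C"
      by blast
    have "(S \<union> S', C) \<in> P" unfolding P_def g_def using SS SC(1) by force
    moreover have "S \<union> S' \<subseteq> I" "I \<subseteq> (S \<union> S') \<union> C" using S(1) SC by auto
    ultimately show ?thesis by blast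
  qed
  have "S \<subseteq> W \<and> C \<subseteq> W \<and> S \<inter> C = {} \<and> p * real (card C) \<le> M \<and> real (card S) \<le> \<Phi>"
    if SCP: "(S, C) \<in> P" for S C
  proof -
    obtain S1 S' where 1: "S1 \<in> \<S>" "(S', C) \<in> Q S1" "S = S1 \<union> S'"
      using SCP unfolding P_def g_def by auto
    have "real (card S) \<le> \<Phi>" using cardU[OF 1(1,2)] Qprop(5)[OF 1(1,2)] 1 sk Phi unfolding \<S>_def by auto
    then show ?thesis using Qprop[OF 1(1,2)] 1 unfolding \<S>_def by auto
  qed
  then have "\<forall>(S, C)\<in>P. S \<subseteq> W \<and> C \<subseteq> W \<and> S \<inter> C = {} \<and> p * real (card C) \<le> M \<and> real (card S) \<le> \<Phi>"
    by blast
  then show ?thesis unfolding fingerprint_cover_def using finP weight cover by blast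
qed

text \<open>Container steps are repeated until \<open>p * card W \<le> M\<close>. A step on a set of size \<open>w\<close> costs \<open>\<kappa> w\<close> in the
exponent and shrinks the set by a factor \<open>1 - \<delta>\<close>; any potential \<open>\<Phi>\<close> that pays for each step bounds
the total cost.\<close>

lemma fingerprint_cover_iterate:
  fixes p M :: real and \<Phi> :: "nat \<Rightarrow> real" and V :: "'a set"
  assumes p: "0 \<le> p"
    and down: "\<And>I J. ind I \<Longrightarrow> J \<subseteq> I \<Longrightarrow> ind J"
    and delta: "0 < \<delta>" "\<delta> < 1"
    and Phi0: "\<And>w. \<Phi> w \<ge> 0" and M: "M > 0"
    and cont: "\<And>W. W \<subseteq> V \<Longrightarrow> p * card W > M \<Longrightarrow> \<exists>f. container_map W ind \<delta> (s (card W)) f"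
    and sk: "\<And>w. w \<le> card V \<Longrightarrow> p * real w > M \<Longrightarrow> s w \<le> \<kappa> w"
    and small: "\<And>W. W \<subseteq> V \<Longrightarrow> p * card W > M \<Longrightarrow>
       (\<Sum>S | S \<subseteq> W \<and> real (card S) \<le> s (card W). p ^ card S) \<le> exp (\<kappa> (card W))"
    and Phi: "\<And>w w'. w \<le> card V \<Longrightarrow> p * real w > M \<Longrightarrow> real w' \<le> (1 - \<delta>) * real w \<Longrightarrow> \<kappa> w + \<Phi> w' \<le> \<Phi> w"
    and mono: "\<And>w w'. w \<le> w' \<Longrightarrow> \<Phi> w \<le> \<Phi> w'"
    and fin: "finite V"
  shows "W \<subseteq> V \<Longrightarrow> \<exists>P. fingerprint_cover W ind p M (\<Phi> (card W)) P"
proof (induction "card W" arbitrary: W rule: less_induct)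
  case less
  have finW: "finite W" using less.prems fin finite_subset by blast
  have cW: "card W \<le> card V" using less.prems fin card_mono by blast
  show ?case
  proof (cases "p * card W > M")
    case False
    then have "fingerprint_cover W ind p M (\<Phi> (card W)) {({}, W)}"
      using Phi0 unfolding fingerprint_cover_def by auto
    then show ?thesis by blast
  next
    case True
    obtain f where f: "container_map W ind \<delta> (s (card W)) f" using cont[OF less.prems True] by blast
    define \<Phi>' where "\<Phi>' = \<Phi> (nat \<lfloor>(1 - \<delta>) * card W\<rfloor>)"
    have W0: "card W > 0" using True M p by (cases "card W") auto
    show ?thesis
    proof (rule fingerprint_cover_step[OF finW p down f])
      show "s (card W) \<le> \<kappa> (card W)" using sk[OF cW True] .
      show "(\<Sum>S | S \<subseteq> W \<and> real (card S) \<le> s (card W). p ^ card S) \<le> exp (\<kappa> (card W))"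
        using small[OF less.prems True] .
      show "\<exists>P. fingerprint_cover W' ind p M \<Phi>' P"
        if W': "W' \<subseteq> W" "real (card W') \<le> (1 - \<delta>) * real (card W)" for W'
      proof -
        have "(1 - \<delta>) * real (card W) < real (card W)" using delta W0 by (simp add: algebra_simps)
        then have "card W' < card W" using W'(2) by linarith
        then obtain P where P: "fingerprint_cover W' ind p M (\<Phi> (card W')) P"
          using less.hyps[of W'] W' less.prems by blast
        have "card W' \<le> nat \<lfloor>(1 - \<delta>) * card W\<rfloor>" using W'(2) by linarith
        then have "\<Phi> (card W') \<le> \<Phi>'" unfolding \<Phi>'_def by (rule mono)
        then have "fingerprint_cover W' ind p M \<Phi>' P"
          using P unfolding fingerprint_cover_def by (auto intro: order_trans)
        then show ?thesis by blast
      qed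
      show "\<kappa> (card W) + \<Phi>' \<le> \<Phi> (card W)"
      proof -
        have "(1 - \<delta>) * card W \<ge> 0" using delta by simp
        then have "real (nat \<lfloor>(1 - \<delta>) * card W\<rfloor>) \<le> (1 - \<delta>) * card W" by linarith
        then show ?thesis unfolding \<Phi>'_def by (rule Phi[OF cW True])
      qed
    qed
  qed
qed

text \<open>The only property of the random set \<open>R\<close> that the upper tail bound needs.\<close>

definition inclusion_bound where
  "inclusion_bound D R V p \<longleftrightarrow> (\<forall>T\<subseteq>V. measure_pmf.prob D {x. T \<subseteq> R x} \<le> p ^ card T)"

text \<open>A large independent subset of the random set contains a fingerprint \<open>S\<close> and has at least \<open>m - \<Phi>\<close>
further elements in the container \<open>C\<close>. The union bound over \<open>(S, C)\<close> and over these further elements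
factorises because \<open>S\<close> and \<open>C\<close> are disjoint.\<close>

lemma prob_large_member_le:
  fixes p M \<Phi> m :: real and R :: "'x \<Rightarrow> 'a set"
  assumes fin: "finite V" and p: "0 \<le> p"
    and R: "inclusion_bound D R V p"
    and P: "fingerprint_cover V ind p M \<Phi> P"
  shows "measure_pmf.prob D {x. \<exists>I\<subseteq>V. I \<subseteq> R x \<and> ind I \<and> real (card I) \<ge> m}
    \<le> exp (8 * M - 2 * m + 3 * \<Phi>)"
proof -
  define Z where "Z = (\<lambda>(S :: 'a set, C :: 'a set). {Q. Q \<subseteq> C \<and> m - \<Phi> \<le> real (card Q)})"
  have finP: "finite P" using P unfolding fingerprint_cover_def by blast
  have Pp: "S \<subseteq> V" "C \<subseteq> V" "S \<inter> C = {}" "p * real (card C) \<le> M" "real (card S) \<le> \<Phi>" "finite C" "finite S"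
    if "(S, C) \<in> P" for S C
  proof -
    note fingerprint_coverD(2)[OF P]
    then show *: "S \<subseteq> V" "C \<subseteq> V" "S \<inter> C = {}" "p * real (card C) \<le> M" "real (card S) \<le> \<Phi>"
      using that by auto
    show "finite C" "finite S" using * fin by (simp_all add: finite_subset)
  qed
  have finZ: "finite (Z y)" if "y \<in> P" for y
    using that Pp(6)[of "fst y" "snd y"] unfolding Z_def by (auto simp: split_beta)
  let ?E = "\<Union>y\<in>(SIGMA y:P. Z y). {x. fst (fst y) \<union> snd y \<subseteq> R x}"
  have sub: "{x. \<exists>I\<subseteq>V. I \<subseteq> R x \<and> ind I \<and> real (card I) \<ge> m} \<subseteq> ?E"
  proof
    fix x assume "x \<in> {x. \<exists>I\<subseteq>V. I \<subseteq> R x \<and> ind I \<and> real (card I) \<ge> m}"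
    then obtain I where I: "I \<subseteq> V" "I \<subseteq> R x" "ind I" "real (card I) \<ge> m" by blast
    have "\<exists>(S, C)\<in>P. S \<subseteq> I \<and> I \<subseteq> S \<union> C"
      by (rule fingerprint_coverD(4)[OF P I(1,3)])
    then obtain S C where SC: "(S, C) \<in> P" "S \<subseteq> I" "I \<subseteq> S \<union> C" by blast
    have "card (I - S) = card I - card S" using Pp(7)[OF SC(1)] SC(2) by (rule card_Diff_subset)
    then have "m - \<Phi> \<le> real (card (I - S))" using I(4) Pp(5)[OF SC(1)] by linarith
    then have "I - S \<in> Z (S, C)" unfolding Z_def using SC by auto
    then have "((S, C), I - S) \<in> (SIGMA y:P. Z y)" using SC(1) by (rule SigmaI[rotated])
    moreover have "x \<in> {x. fst (fst ((S, C), I - S)) \<union> snd ((S, C), I - S) \<subseteq> R x}"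
      using SC(2) I(2) by auto
    ultimately show "x \<in> ?E" by (rule UN_I)
  qed
  have finSig: "finite (SIGMA y:P. Z y)" using finP finZ by (intro finite_SigmaI) auto
  have "measure_pmf.prob D {x. \<exists>I\<subseteq>V. I \<subseteq> R x \<and> ind I \<and> real (card I) \<ge> m} \<le> measure_pmf.prob D ?E"
    by (rule measure_pmf.finite_measure_mono) (use sub in auto)
  also have "\<dots> \<le> (\<Sum>y\<in>(SIGMA y:P. Z y). measure_pmf.prob D {x. fst (fst y) \<union> snd y \<subseteq> R x})"
    by (rule measure_pmf.finite_measure_subadditive_finite) (use finSig in auto)
  also have "\<dots> \<le> (\<Sum>y\<in>(SIGMA y:P. Z y). p ^ card (fst (fst y)) * p ^ card (snd y))"
  proof (rule sum_mono)
    fix y assume "y \<in> (SIGMA y:P. Z y)"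
    then obtain S C Q where y: "y = ((S, C), Q)" "(S, C) \<in> P" "Q \<subseteq> C" unfolding Z_def by auto
    have "S \<inter> Q = {}" "finite Q" using Pp[OF y(2)] y(3) finite_subset by blast+
    then have c: "card (S \<union> Q) = card S + card Q" using Pp(7)[OF y(2)] by (intro card_Un_disjoint) auto
    have "S \<union> Q \<subseteq> V" using Pp[OF y(2)] y(3) by blast
    then have "measure_pmf.prob D {x. S \<union> Q \<subseteq> R x} \<le> p ^ card (S \<union> Q)"
      using R unfolding inclusion_bound_def by blast
    then show "measure_pmf.prob D {x. fst (fst y) \<union> snd y \<subseteq> R x} \<le> p ^ card (fst (fst y)) * p ^ card (snd y)"
      using y c by (simp add: power_add)
  qed
  also have "\<dots> = (\<Sum>y\<in>P. p ^ card (fst y) * (\<Sum>Q\<in>Z y. p ^ card Q))"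
    unfolding sum_distrib_left using finP finZ by (subst sum.Sigma) (auto simp: split_beta)
  also have "\<dots> \<le> (\<Sum>y\<in>P. p ^ card (fst y) * exp (8 * M - 2 * (m - \<Phi>)))"
  proof (intro sum_mono mult_left_mono)
    fix y assume y: "y \<in> P"
    obtain S C where yy: "y = (S, C)" by (cases y)
    have "(\<Sum>Q\<in>Z y. p ^ card Q) \<le> exp (8 * (p * card C) - 2 * (m - \<Phi>))"
      unfolding Z_def yy using sum_large_subsets_le[of C p "m - \<Phi>"] Pp(6)[of S C] y p yy by simp
    also have "\<dots> \<le> exp (8 * M - 2 * (m - \<Phi>))" using Pp(4)[of S C] y yy by simp
    finally show "(\<Sum>Q\<in>Z y. p ^ card Q) \<le> exp (8 * M - 2 * (m - \<Phi>))" .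
  qed (use p in auto)
  also have "\<dots> = (\<Sum>(S, C)\<in>P. p ^ card S) * exp (8 * M - 2 * (m - \<Phi>))"
    by (simp add: sum_distrib_right split_beta)
  also have "\<dots> \<le> exp \<Phi> * exp (8 * M - 2 * (m - \<Phi>))"
    using P unfolding fingerprint_cover_def by (intro mult_right_mono) auto
  also have "\<dots> = exp (8 * M - 2 * m + 3 * \<Phi>)" by (simp flip: exp_add add: algebra_simps)
  finally show ?thesis .
qed

text \<open>The fingerprint size \<open>\<sigma> * (m\<^sub>0\<^sup>2 / (p w) + s\<^sub>0)\<close> is the one that balanced supersaturation will give:
the first part halves when \<open>w\<close> doubles, the second one is fixed. With \<open>y = p w / m\<^sub>0\<close> the first part is
\<open>\<sigma> m\<^sub>0 / y\<close>, so its cost \<open>m\<^sub>0 (ln y) / y\<close> decays geometrically along the iteration and the total is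
\<open>O(m\<^sub>0)\<close> without any logarithmic loss. The second part is paid \<open>O(L)\<close> times at a price of \<open>O(L)\<close> per
element, whence the hypothesis \<open>s\<^sub>0 * L\<^sup>2 \<le> m\<^sub>0\<close>. The potential
\<open>\<Phi> = A m\<^sub>0 (2 - y powr (-1/2)) + A s\<^sub>0 L (1 + ln y)\<close> realises both estimates; the exponent \<open>-1/2\<close>
leaves room for absorbing \<open>ln y\<close>.\<close>

theorem sparse_random_upper_tail:
  fixes \<delta> \<sigma> K\<^sub>0 :: real
  assumes delta: "0 < \<delta>" "\<delta> < 1" and sigma: "\<sigma> > 0" and K0: "K\<^sub>0 \<ge> 3"
  shows "\<exists>K>0. \<forall>(V :: 'a set) ind p m\<^sub>0 s\<^sub>0 L (D :: 'x pmf) R. finite V \<longrightarrow>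
    (\<forall>I J. ind I \<longrightarrow> J \<subseteq> I \<longrightarrow> ind J) \<longrightarrow> 0 < p \<longrightarrow> 0 < m\<^sub>0 \<longrightarrow> 0 \<le> s\<^sub>0 \<longrightarrow> 1 \<le> L \<longrightarrow>
    p * real (card V) \<le> m\<^sub>0 * exp (2 * L) \<longrightarrow> s\<^sub>0 * L\<^sup>2 \<le> m\<^sub>0 \<longrightarrow> inclusion_bound D R V p \<longrightarrow>
    (\<forall>W\<subseteq>V. K\<^sub>0 * m\<^sub>0 < p * real (card W) \<longrightarrow>
       (\<exists>f. container_map W ind \<delta> (\<sigma> * (m\<^sub>0\<^sup>2 / (p * real (card W)) + s\<^sub>0)) f)) \<longrightarrow>
    measure_pmf.prob D {x. \<exists>I\<subseteq>V. I \<subseteq> R x \<and> ind I \<and> real (card I) \<ge> K * m\<^sub>0} \<le> exp (- m\<^sub>0)"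
proof -
  define B where "B = 4 * \<sigma> + 1"
  \<comment> \<open>Lower bound on the relative increase of \<open>y powr (-1/2)\<close>, and on the decrease of \<open>ln y\<close>, in a step
    that replaces \<open>y\<close> by at most \<open>(1 - \<delta>) y\<close>.\<close>
  define a where "a = min ((1 - \<delta>) powr (-1/2) - 1) (min (- ln (1 - \<delta>)) 1)"
  define A where "A = B / a"
  have a: "0 < a" "a \<le> 1" "a \<le> (1 - \<delta>) powr (-1/2) - 1" "a \<le> - ln (1 - \<delta>)"
  proof -
    have "(1 - \<delta>) powr (1/2) < 1" using delta powr_less_mono2[of "1/2" "1 - \<delta>" 1] by simp
    then have "1 < (1 - \<delta>) powr (-1/2)"
      using delta by (simp add: powr_minus_divide)
    moreover have "ln (1 - \<delta>) < 0" using delta by simp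
    ultimately show "0 < a" unfolding a_def by auto
  qed (auto simp: a_def)
  have B: "B > 0" using sigma by (simp add: B_def)
  have A: "A \<ge> B" "A > 0" "A * a = B" using a B by (auto simp: A_def field_simps)
  define K where "K = 4 * K\<^sub>0 + 9 * A + 1"
  show ?thesis
  proof (intro exI[of _ K] conjI allI impI)
    show "K > 0" using K0 A B by (simp add: K_def)
    fix V :: "'a set" and ind and p m\<^sub>0 s\<^sub>0 L :: real and D :: "'x pmf" and R
    assume fin: "finite V" and down: "\<forall>I J. ind I \<longrightarrow> J \<subseteq> I \<longrightarrow> ind J" and p: "0 < p" and m0: "0 < m\<^sub>0"
      and s0: "0 \<le> s\<^sub>0" and L: "1 \<le> L" and VL: "p * real (card V) \<le> m\<^sub>0 * exp (2 * L)"
      and sL: "s\<^sub>0 * L\<^sup>2 \<le> m\<^sub>0" and R: "inclusion_bound D R V p"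
      and cont: "\<forall>W\<subseteq>V. K\<^sub>0 * m\<^sub>0 < p * real (card W) \<longrightarrow>
       (\<exists>f. container_map W ind \<delta> (\<sigma> * (m\<^sub>0\<^sup>2 / (p * real (card W)) + s\<^sub>0)) f)"
    define y where "y w = p * real w / m\<^sub>0" for w :: nat
    define s where "s w = \<sigma> * (m\<^sub>0\<^sup>2 / (p * real w) + s\<^sub>0)" for w :: nat
    define \<kappa> where "\<kappa> w = B * m\<^sub>0 * y w powr (-1/2) + B * s\<^sub>0 * L" for w
    define \<Phi> where "\<Phi> w = (if p * real w \<le> K\<^sub>0 * m\<^sub>0 then 0
        else A * m\<^sub>0 * (2 - y w powr (-1/2)) + A * s\<^sub>0 * L * (1 + ln (y w)))" for w
    have big: "p * real w > K\<^sub>0 * m\<^sub>0 \<longleftrightarrow> y w > K\<^sub>0" for w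
      using m0 by (simp add: y_def pos_less_divide_eq)
    have ybig: "y w \<ge> 3 \<and> ln (y w) \<ge> 1 \<and> y w powr (-1/2) \<le> 1" if "p * real w > K\<^sub>0 * m\<^sub>0" for w
    proof -
      have y3: "y w \<ge> 3" using that big K0 by fastforce
      have "exp 1 \<le> y w" using y3 e_less_272 by linarith
      then have "ln (y w) \<ge> 1" using y3 by (simp add: ln_ge_iff)
      moreover have "y w powr (-1/2) \<le> y w powr 0" using y3 by (intro powr_mono) auto
      ultimately show ?thesis using y3 by simp
    qed
    have ymono: "y w \<le> y w'" if "w \<le> w'" for w w' using that p m0 by (simp add: y_def divide_right_mono)
    have Phi0: "\<Phi> w \<ge> 0" for w
    proof (cases "p * real w > K\<^sub>0 * m\<^sub>0")
      case True
      then show ?thesis using ybig[OF True] A m0 s0 L unfolding \<Phi>_def by (auto intro!: add_nonneg_nonneg mult_nonneg_nonneg)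
    qed (simp add: \<Phi>_def)
    have mono: "\<Phi> w \<le> \<Phi> w'" if "w \<le> w'" for w w'
    proof (cases "p * real w > K\<^sub>0 * m\<^sub>0")
      case True
      have "p * real w \<le> p * real w'" using that p by simp
      then have T': "p * real w' > K\<^sub>0 * m\<^sub>0" using True by linarith
      have "y w' powr (-1/2) \<le> y w powr (-1/2)"
        using ymono[OF that] ybig[OF True] by (intro powr_mono2') auto
      moreover have "ln (y w) \<le> ln (y w')" using ymono[OF that] ybig[OF True] by simp
      ultimately show ?thesis using True T' A m0 s0 L unfolding \<Phi>_def
        by (auto intro!: add_mono mult_left_mono)
    next
      case False
      then show ?thesis using Phi0[of w'] by (simp add: \<Phi>_def)
    qed
    have lnb: "ln (y w) \<le> 2 * L" if "w \<le> card V" "p * real w > K\<^sub>0 * m\<^sub>0" for w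
    proof -
      have "y w \<le> y (card V)" using ymono that by blast
      also have "\<dots> \<le> exp (2 * L)" using VL m0 by (simp add: y_def divide_le_eq mult.commute)
      finally have "y w \<le> exp (2 * L)" .
      then have "ln (y w) \<le> ln (exp (2 * L))" using ybig[OF that(2)] by (subst ln_le_cancel_iff) auto
      then show ?thesis by simp
    qed
    have s_eq: "s w = \<sigma> * (m\<^sub>0 / y w + s\<^sub>0)" for w
      unfolding s_def y_def using m0 by (simp add: power2_eq_square)
    have cost: "s w * (2 * ln (y w)) + m\<^sub>0 / y w \<le> \<kappa> w" if w: "w \<le> card V" "p * real w > K\<^sub>0 * m\<^sub>0" for w
    proof -
      have y: "y w \<ge> 3" using ybig w by blast
      define r where "r = y w powr (1/2)"
      have r: "r > 0" "y w = r * r" using y unfolding r_def by (auto simp flip: powr_add)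
      have r1: "r \<ge> 1" unfolding r_def using y by (intro ge_one_powr_ge_zero) auto
      have rm: "y w powr (-1/2) = 1 / r" unfolding r_def using y by (simp add: powr_minus_divide)
      have "ln (y w) = 2 * ln r" using r by (simp add: ln_mult)
      also have "\<dots> \<le> 2 * (r - 1)" using ln_le_minus_one[OF r(1)] by simp
      finally have l: "ln (y w) \<le> 2 * r" by simp
      have "s w * (2 * ln (y w)) = \<sigma> * m\<^sub>0 / y w * (2 * ln (y w)) + \<sigma> * s\<^sub>0 * (2 * ln (y w))"
        unfolding s_eq by (simp add: algebra_simps)
      also have "\<dots> \<le> \<sigma> * m\<^sub>0 / y w * (4 * r) + \<sigma> * s\<^sub>0 * (4 * L)"
        using l lnb[OF w] sigma m0 s0 y by (intro add_mono mult_left_mono) auto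
      also have "\<sigma> * m\<^sub>0 / y w * (4 * r) = 4 * \<sigma> * m\<^sub>0 * (1 / r)" using r by (simp add: field_simps)
      finally have 1: "s w * (2 * ln (y w)) \<le> 4 * \<sigma> * m\<^sub>0 * (1 / r) + 4 * \<sigma> * s\<^sub>0 * L" by simp
      have "m\<^sub>0 / y w = m\<^sub>0 * (1 / r) * (1 / r)" using r by simp
      also have "\<dots> \<le> m\<^sub>0 * (1 / r) * 1" using r r1 m0 by (intro mult_left_mono) auto
      finally have 2: "m\<^sub>0 / y w \<le> m\<^sub>0 * (1 / r)" by simp
      have "0 \<le> s\<^sub>0 * L" using s0 L by simp
      then show ?thesis unfolding \<kappa>_def B_def rm using 1 2 by (simp add: algebra_simps)
    qed
    have sk: "s w \<le> \<kappa> w" if w: "w \<le> card V" "p * real w > K\<^sub>0 * m\<^sub>0" for w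
    proof -
      have s0': "s w \<ge> 0" unfolding s_def using sigma p m0 s0 by auto
      have "s w * 1 \<le> s w * (2 * ln (y w))" using ybig[OF w(2)] s0' by (intro mult_left_mono) auto
      moreover have "0 \<le> m\<^sub>0 / y w" using ybig[OF w(2)] m0 by simp
      ultimately show ?thesis using cost[OF w] by linarith
    qed
    \<comment> \<open>The free parameter of the bound on small subsets is \<open>y\<^sup>2\<close>: large enough to make the second term
      \<open>m\<^sub>0 / y\<close>, and of logarithm \<open>O(ln y)\<close>.\<close>
    have small: "(\<Sum>S | S \<subseteq> W \<and> real (card S) \<le> s (card W). p ^ card S) \<le> exp (\<kappa> (card W))"
      if W: "W \<subseteq> V" "p * real (card W) > K\<^sub>0 * m\<^sub>0" for W
    proof -
      have finW: "finite W" using W fin finite_subset by blast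
      have y: "y (card W) \<ge> 3" using ybig W by blast
      have "(\<Sum>S | S \<subseteq> W \<and> real (card S) \<le> s (card W). p ^ card S)
         \<le> exp (s (card W) * ln ((y (card W))\<^sup>2) + p * card W / (y (card W))\<^sup>2)"
        by (rule sum_small_subsets_le) (use finW p y one_le_power[of "y (card W)" 2] in auto)
      also have "s (card W) * ln ((y (card W))\<^sup>2) + p * card W / (y (card W))\<^sup>2
         = s (card W) * (2 * ln (y (card W))) + m\<^sub>0 / y (card W)"
      proof -
        have "p * card W = y (card W) * m\<^sub>0" using m0 by (simp add: y_def)
        then show ?thesis using y by (simp add: ln_mult power2_eq_square)
      qed
      also have "\<dots> \<le> \<kappa> (card W)" using cost W fin card_mono by blast
      finally show ?thesis by simp
    qed
    have Phi: "\<kappa> w + \<Phi> w' \<le> \<Phi> w"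
      if w: "w \<le> card V" "p * real w > K\<^sub>0 * m\<^sub>0" and w': "real w' \<le> (1 - \<delta>) * real w" for w w'
    proof -
      note yb = ybig[OF w(2)]
      have Pw: "\<Phi> w = A * m\<^sub>0 * (2 - y w powr (-1/2)) + A * s\<^sub>0 * L * (1 + ln (y w))"
        using w(2) by (simp add: \<Phi>_def)
      show ?thesis
      proof (cases "p * real w' > K\<^sub>0 * m\<^sub>0")
        case False
        then have "\<Phi> w' = 0" by (simp add: \<Phi>_def)
        moreover have "B * m\<^sub>0 * y w powr (-1/2) \<le> A * m\<^sub>0 * (2 - y w powr (-1/2))"
          using yb A B m0 by (intro mult_mono) auto
        moreover have "B * s\<^sub>0 * L * 1 \<le> A * s\<^sub>0 * L * (1 + ln (y w))"
          using yb A B s0 L by (intro mult_mono) auto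
        ultimately show ?thesis unfolding Pw \<kappa>_def by simp
      next
        case True
        note yb' = ybig[OF True]
        have yy: "y w' \<le> (1 - \<delta>) * y w"
        proof -
          have "p * real w' / m\<^sub>0 \<le> p * ((1 - \<delta>) * real w) / m\<^sub>0"
            using w' p m0 by (intro divide_right_mono mult_left_mono) auto
          then show ?thesis by (simp add: y_def algebra_simps)
        qed
        have "((1 - \<delta>) * y w) powr (-1/2) \<le> y w' powr (-1/2)"
          using yy yb' by (intro powr_mono2') auto
        then have "(1 - \<delta>) powr (-1/2) * y w powr (-1/2) \<le> y w' powr (-1/2)"
          using yb delta by (simp add: powr_mult)
        moreover have "(1 + a) * y w powr (-1/2) \<le> (1 - \<delta>) powr (-1/2) * y w powr (-1/2)"
          using a by (intro mult_right_mono) auto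
        ultimately have "a * y w powr (-1/2) \<le> y w' powr (-1/2) - y w powr (-1/2)" by (simp add: algebra_simps)
        then have f1: "A * m\<^sub>0 * (a * y w powr (-1/2)) \<le> A * m\<^sub>0 * (y w' powr (-1/2) - y w powr (-1/2))"
          using A m0 by (intro mult_left_mono) auto
        have "A * m\<^sub>0 * (a * y w powr (-1/2)) = (A * a) * m\<^sub>0 * y w powr (-1/2)" by (simp only: mult_ac)
        then have f2: "A * m\<^sub>0 * (a * y w powr (-1/2)) = B * m\<^sub>0 * y w powr (-1/2)" unfolding A(3) .
        have f3: "A * s\<^sub>0 * L * a \<le> A * s\<^sub>0 * L * (ln (y w) - ln (y w'))"
        proof (intro mult_left_mono)
          have "ln (y w') \<le> ln ((1 - \<delta>) * y w)" using yy yb' by (simp add: ln_mono)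
          also have "\<dots> = ln (1 - \<delta>) + ln (y w)" using delta yb by (simp add: ln_mult)
          finally show "a \<le> ln (y w) - ln (y w')" using a by linarith
        qed (use A s0 L in auto)
        have "A * s\<^sub>0 * L * a = (A * a) * s\<^sub>0 * L" by (simp only: mult_ac)
        then have f4: "A * s\<^sub>0 * L * a = B * s\<^sub>0 * L" unfolding A(3) .
        have f5: "\<Phi> w' = A * m\<^sub>0 * (2 - y w' powr (-1/2)) + A * s\<^sub>0 * L * (1 + ln (y w'))"
          using True by (simp add: \<Phi>_def)
        have f6: "A * m\<^sub>0 * (2 - y w powr (-1/2)) - A * m\<^sub>0 * (2 - y w' powr (-1/2))
            = A * m\<^sub>0 * (y w' powr (-1/2) - y w powr (-1/2))" by (simp add: right_diff_distrib)
        have f7: "A * s\<^sub>0 * L * (1 + ln (y w)) - A * s\<^sub>0 * L * (1 + ln (y w'))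
            = A * s\<^sub>0 * L * (ln (y w) - ln (y w'))" by (simp add: algebra_simps)
        show ?thesis using f1 f2 f3 f4 f5 f6 f7 unfolding Pw \<kappa>_def by linarith
      qed
    qed
    have "\<exists>P. fingerprint_cover V ind p (K\<^sub>0 * m\<^sub>0) (\<Phi> (card V)) P"
    proof (rule fingerprint_cover_iterate[where \<kappa> = \<kappa> and s = s and V = V and \<delta> = \<delta>])
      show "\<And>W. W \<subseteq> V \<Longrightarrow> p * real (card W) > K\<^sub>0 * m\<^sub>0 \<Longrightarrow> \<exists>f. container_map W ind \<delta> (s (card W)) f"
        using cont unfolding s_def by blast
    qed (use p down delta Phi0 m0 K0 sk small Phi mono fin in auto)
    then obtain P where P: "fingerprint_cover V ind p (K\<^sub>0 * m\<^sub>0) (\<Phi> (card V)) P" by blast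
    have PhiV: "\<Phi> (card V) \<le> 5 * A * m\<^sub>0"
    proof (cases "p * real (card V) > K\<^sub>0 * m\<^sub>0")
      case True
      have "A * m\<^sub>0 * (2 - y (card V) powr (-1/2)) \<le> A * m\<^sub>0 * 2"
        using A m0 by (intro mult_left_mono) auto
      moreover have "A * s\<^sub>0 * L * (1 + ln (y (card V))) \<le> A * s\<^sub>0 * L * (3 * L)"
        using lnb[OF _ True] L A s0 by (intro mult_left_mono) auto
      moreover have "A * (s\<^sub>0 * L\<^sup>2) \<le> A * m\<^sub>0" using sL A by (intro mult_left_mono) auto
      ultimately show ?thesis using True unfolding \<Phi>_def by (simp add: power2_eq_square algebra_simps)
    next
      case False
      then show ?thesis using A m0 by (simp add: \<Phi>_def)
    qed
    have "measure_pmf.prob D {x. \<exists>I\<subseteq>V. I \<subseteq> R x \<and> ind I \<and> real (card I) \<ge> K * m\<^sub>0}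
       \<le> exp (8 * (K\<^sub>0 * m\<^sub>0) - 2 * (K * m\<^sub>0) + 3 * \<Phi> (card V))"
      by (rule prob_large_member_le[OF fin _ R P]) (use p in auto)
    also have "\<dots> \<le> exp (- m\<^sub>0)"
    proof -
      have "0 \<le> A * m\<^sub>0" using A m0 by simp
      then show ?thesis using PhiV m0 by (simp add: K_def algebra_simps)
    qed
    finally show "measure_pmf.prob D {x. \<exists>I\<subseteq>V. I \<subseteq> R x \<and> ind I \<and> real (card I) \<ge> K * m\<^sub>0} \<le> exp (- m\<^sub>0)" .
  qed
qed

section \<open>Counting homomorphisms with prescribed edges\<close>

text \<open>The host graph is given as a bipartite graph \<open>\<Gamma>\<close> between two sets \<open>A\<close> and \<open>B\<close> of clones of its
vertices; \<open>\<alpha>\<close> and \<open>\<beta>\<close> map a clone to its vertex. Each edge of the host graph appears once as an arc of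
\<open>\<Gamma>\<close>, and each clone has at most \<open>t\<close> arcs. Splitting vertices into clones reduces a host graph with
arbitrary degrees to one with maximum degree of the order of its average degree. The multigraph has
vertex set \<open>V\<close> and edge set \<open>E\<close>; the apex and the subdivision vertices of its graph are sought in
\<open>A\<close>, the branch vertices in \<open>B\<close>. The number \<open>h\<close> is a lower bound for useful codegrees; it is at least
twice the number of vertices to be embedded.\<close>

locale arc_system =
  fixes A :: "'x set" and B :: "'y set" and \<Gamma> :: "('x \<times> 'y) set"
    and \<alpha> :: "'x \<Rightarrow> 'v" and \<beta> :: "'y \<Rightarrow> 'v" and t :: nat
    and V :: "'i set" and E :: "'e set" and ends :: "'e \<Rightarrow> 'i set" and h :: real
  assumes finA: "finite A" and finB: "finite B" and Gam: "\<Gamma> \<subseteq> A \<times> B"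
    and degA: "\<And>x. card {u. (x, u) \<in> \<Gamma>} \<le> t"
    and degB: "\<And>u. card {x. (x, u) \<in> \<Gamma>} \<le> t"
    and inj: "inj_on (\<lambda>(x, u). {\<alpha> x, \<beta> u}) \<Gamma>"
    and loopfree: "\<And>x u. (x, u) \<in> \<Gamma> \<Longrightarrow> \<alpha> x \<noteq> \<beta> u"
    and finV: "finite V" and finE: "finite E"
    and ends: "\<And>e. e \<in> E \<Longrightarrow> ends e \<subseteq> V \<and> card (ends e) = 2"
    and h: "h \<ge> 2 * (1 + real (card V) + real (card E))"
begin

definition nb :: "'x \<Rightarrow> 'y set" where "nb x = {u. (x, u) \<in> \<Gamma>}"
definition cn :: "'y set \<Rightarrow> 'x set" where "cn U = {a \<in> A. \<forall>u\<in>U. (a, u) \<in> \<Gamma>}"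
definition cd :: "'y set \<Rightarrow> real" where "cd U = real (card (cn U))"
text \<open>Branch vertices are to form good pairs: then the weight of a copy is under control, and a subdivision
vertex can be chosen outside the rest of the copy.\<close>

definition good :: "'y \<Rightarrow> 'y \<Rightarrow> bool" where "good b b' \<longleftrightarrow> b \<noteq> b' \<and> cd {b, b'} \<ge> h"

text \<open>A homomorphism consists of the apex \<open>x\<close>, the branch vertices \<open>u\<close> in the neighbourhood of \<open>x\<close>, and a
subdivision vertex \<open>s e\<close> in the common neighbourhood of the two ends of \<open>e\<close>. It is a copy if distinct
vertices are mapped to clones of distinct vertices.\<close>

definition bases :: "('x \<times> ('i \<Rightarrow> 'y)) set" where
  "bases = {(x, u). x \<in> A \<and> u \<in> V \<rightarrow>\<^sub>E nb x \<and> (\<forall>i\<in>V. \<forall>j\<in>V. i \<noteq> j \<longrightarrow> good (u i) (u j))}"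

definition homs :: "('x \<times> ('i \<Rightarrow> 'y) \<times> ('e \<Rightarrow> 'x)) set" where
  "homs = {(x, u, s). (x, u) \<in> bases \<and> s \<in> (\<Pi>\<^sub>E e\<in>E. cn (u ` ends e))}"

definition copies :: "('x \<times> ('i \<Rightarrow> 'y) \<times> ('e \<Rightarrow> 'x)) set" where
  "copies = {(x, u, s) \<in> homs. inj_on (\<alpha> \<circ> s) E \<and> (\<forall>e\<in>E. s e \<noteq> x) \<and>
     (\<forall>e\<in>E. \<forall>j\<in>V. \<alpha> (s e) \<noteq> \<beta> (u j))}"

text \<open>With this weight the homomorphisms over a fixed base have total weight one, so that bases with very
large codegrees, which carry many homomorphisms, are not preferred.\<close>

fun wt :: "'x \<times> ('i \<Rightarrow> 'y) \<times> ('e \<Rightarrow> 'x) \<Rightarrow> real" where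
  "wt (x, u, s) = (\<Prod>e\<in>E. 1 / cd (u ` ends e))"

lemma hpos: "h > 0"
proof -
  have "0 < 2 * (1 + real (card V) + real (card E))" by (simp add: add_pos_nonneg)
  then show ?thesis using h by linarith
qed

lemma nb_sub: "nb x \<subseteq> B" using Gam by (auto simp: nb_def)
lemma fin_nb [simp]: "finite (nb x)" using nb_sub finB finite_subset by blast
lemma card_nb: "card (nb x) \<le> t" using degA by (simp add: nb_def)
lemma fin_ends [simp]: "e \<in> E \<Longrightarrow> finite (ends e)" using ends finV finite_subset by blast
lemma cn_sub: "cn U \<subseteq> A" by (auto simp: cn_def)
lemma fin_cn [simp]: "finite (cn U)" using cn_sub finA finite_subset by blast
lemma cd_nonneg [simp]: "cd U \<ge> 0" by (simp add: cd_def)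

lemma basesD:
  assumes "(x, u) \<in> bases"
  shows "x \<in> A" "u \<in> V \<rightarrow>\<^sub>E nb x" "\<And>i. i \<in> V \<Longrightarrow> (x, u i) \<in> \<Gamma>"
    "\<And>i j. i \<in> V \<Longrightarrow> j \<in> V \<Longrightarrow> i \<noteq> j \<Longrightarrow> good (u i) (u j)"
  using assms unfolding bases_def nb_def by auto

lemma ends_pair:
  assumes "e \<in> E" obtains i j where "ends e = {i, j}" "i \<noteq> j" "i \<in> V" "j \<in> V"
  using ends[OF assms] by (auto simp: card_2_iff)

lemma cd_ends:
  assumes "(x, u) \<in> bases" "e \<in> E"
  shows "cd (u ` ends e) \<ge> h"
proof -
  obtain i j where "ends e = {i, j}" "i \<noteq> j" "i \<in> V" "j \<in> V" using ends_pair[OF assms(2)] .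
  then show ?thesis using basesD(4)[OF assms(1)] unfolding good_def by auto
qed

lemma finite_bases: "finite bases"
proof (rule finite_subset)
  show "bases \<subseteq> A \<times> (V \<rightarrow>\<^sub>E B)"
  proof
    fix y assume "y \<in> bases"
    moreover obtain x u where "y = (x, u)" by (cases y)
    ultimately have y: "y = (x, u)" "x \<in> A" "u \<in> V \<rightarrow>\<^sub>E nb x" using basesD(1,2) by auto
    have "u \<in> V \<rightarrow>\<^sub>E B" using y(3) nb_sub by (auto simp: PiE_iff)
    then show "y \<in> A \<times> (V \<rightarrow>\<^sub>E B)" using y by simp
  qed
  show "finite (A \<times> (V \<rightarrow>\<^sub>E B))" using finA finB finV by (intro finite_cartesian_product finite_PiE) auto
qed

lemma finite_homs: "finite homs"
proof (rule finite_subset)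
  show "homs \<subseteq> (\<lambda>((x, u), s). (x, u, s)) ` (bases \<times> (E \<rightarrow>\<^sub>E A))"
  proof
    fix y assume "y \<in> homs"
    then obtain x u s where y: "y = (x, u, s)" "(x, u) \<in> bases" "s \<in> (\<Pi>\<^sub>E e\<in>E. cn (u ` ends e))"
      unfolding homs_def by auto
    have "s \<in> E \<rightarrow>\<^sub>E A" using y(3) cn_sub by (auto simp: PiE_iff)
    then show "y \<in> (\<lambda>((x, u), s). (x, u, s)) ` (bases \<times> (E \<rightarrow>\<^sub>E A))" using y by force
  qed
  show "finite ((\<lambda>((x, u), s). (x, u, s)) ` (bases \<times> (E \<rightarrow>\<^sub>E A)))"
    using finite_bases finA finE by (intro finite_imageI finite_cartesian_product finite_PiE) auto
qed

lemma wt_nonneg: "wt y \<ge> 0" by (cases y) (auto intro!: prod_nonneg)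

text \<open>Homomorphisms with prescribed branch vertices on \<open>\<mu>\<close> and prescribed subdivision vertices on \<open>\<Sigma>\<close>.
The degree of a set of host edges is a sum of weights of such families, and the next lemmas bound
them. Prescribing a branch vertex saves a factor \<open>t\<close>, prescribing a subdivision vertex saves a
codegree, that is at least \<open>h\<close>.\<close>

definition agree :: "'i set \<Rightarrow> ('i \<Rightarrow> 'y) \<Rightarrow> 'e set \<Rightarrow> ('e \<Rightarrow> 'x) \<Rightarrow> ('x \<times> ('i \<Rightarrow> 'y) \<times> ('e \<Rightarrow> 'x)) set" where
  "agree \<mu> u\<^sub>0 \<Sigma> s\<^sub>0 = {(x, u, s) \<in> homs. (\<forall>i\<in>\<mu>. u i = u\<^sub>0 i) \<and> (\<forall>e\<in>\<Sigma>. s e = s\<^sub>0 e)}"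

lemma finite_agree [simp]: "finite {y \<in> agree \<mu> u\<^sub>0 \<Sigma> s\<^sub>0. P y}" "finite (agree \<mu> u\<^sub>0 \<Sigma> s\<^sub>0)"
  using finite_homs unfolding agree_def by (auto intro: finite_subset[OF _ finite_homs])

lemma agree_fixed_apex:
  assumes mu: "\<mu> \<subseteq> V" and Sig: "\<Sigma> \<subseteq> E" and c0: "c \<ge> 0"
    and c: "\<And>u. (x\<^sub>0, u) \<in> bases \<Longrightarrow> \<forall>i\<in>\<mu>. u i = u\<^sub>0 i \<Longrightarrow> (\<Prod>e\<in>\<Sigma>. 1 / cd (u ` ends e)) \<le> c"
  shows "(\<Sum>y | y \<in> agree \<mu> u\<^sub>0 \<Sigma> s\<^sub>0 \<and> fst y = x\<^sub>0. wt y) \<le> real t ^ (card V - card \<mu>) * c"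
proof -
  define U where "U = {u. (x\<^sub>0, u) \<in> bases \<and> (\<forall>i\<in>\<mu>. u i = u\<^sub>0 i)}"
  define S where "S u = {s \<in> (\<Pi>\<^sub>E e\<in>E. cn (u ` ends e)). \<forall>e\<in>\<Sigma>. s e = s\<^sub>0 e}" for u
  have finS: "finite (S u)" for u
    unfolding S_def using finE by (auto intro!: finite_subset[OF _ finite_PiE[of E "\<lambda>e. cn (u ` ends e)"]])
  have UP: "U \<subseteq> (\<Pi>\<^sub>E i\<in>V. if i \<in> \<mu> then {u\<^sub>0 i} else nb x\<^sub>0)"
  proof
    fix u assume u: "u \<in> U"
    then have "u \<in> V \<rightarrow>\<^sub>E nb x\<^sub>0" unfolding U_def using basesD(2) by blast
    then show "u \<in> (\<Pi>\<^sub>E i\<in>V. if i \<in> \<mu> then {u\<^sub>0 i} else nb x\<^sub>0)"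
      using u unfolding U_def by (auto simp: PiE_iff)
  qed
  have finP: "finite (\<Pi>\<^sub>E i\<in>V. if i \<in> \<mu> then {u\<^sub>0 i} else nb x\<^sub>0)"
    using finV by (intro finite_PiE) auto
  have finU: "finite U" using UP finP finite_subset by blast
  have cardU: "real (card U) \<le> real t ^ (card V - card \<mu>)"
  proof -
    have "card U \<le> card (\<Pi>\<^sub>E i\<in>V. if i \<in> \<mu> then {u\<^sub>0 i} else nb x\<^sub>0)" using UP finP card_mono by blast
    also have "\<dots> = (\<Prod>i\<in>V. card (if i \<in> \<mu> then {u\<^sub>0 i} else nb x\<^sub>0))" using finV by (rule card_PiE)
    also have "\<dots> \<le> (\<Prod>i\<in>V. if i \<in> \<mu> then 1 else t)" by (rule prod_mono) (auto simp: card_nb)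
    also have "\<dots> = t ^ card (V - \<mu>)"
      using finV mu by (simp add: prod.If_cases Diff_eq)
    also have "card (V - \<mu>) = card V - card \<mu>" using mu finV by (simp add: card_Diff_subset finite_subset)
    finally show ?thesis by (metis of_nat_le_iff of_nat_power)
  qed
  have inner: "(\<Sum>s\<in>S u. wt (x\<^sub>0, u, s)) \<le> c" if u: "u \<in> U" for u
  proof -
    have ub: "(x\<^sub>0, u) \<in> bases" "\<forall>i\<in>\<mu>. u i = u\<^sub>0 i" using u by (auto simp: U_def)
    have cdp: "cd (u ` ends e) > 0" if "e \<in> E" for e using cd_ends[OF ub(1) that] hpos by linarith
    have SP: "S u \<subseteq> (\<Pi>\<^sub>E e\<in>E. if e \<in> \<Sigma> then {s\<^sub>0 e} else cn (u ` ends e))"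
    proof
      fix s assume "s \<in> S u"
      then have s: "s \<in> (\<Pi>\<^sub>E e\<in>E. cn (u ` ends e))" "\<forall>e\<in>\<Sigma>. s e = s\<^sub>0 e" unfolding S_def by blast+
      show "s \<in> (\<Pi>\<^sub>E e\<in>E. if e \<in> \<Sigma> then {s\<^sub>0 e} else cn (u ` ends e))"
        by (rule PiE_I) (use s(2) PiE_mem[OF s(1)] PiE_arb[OF s(1)] in auto)
    qed
    have finP': "finite (\<Pi>\<^sub>E e\<in>E. if e \<in> \<Sigma> then {s\<^sub>0 e} else cn (u ` ends e))"
      using finE by (intro finite_PiE) auto
    have "card (S u) \<le> card (\<Pi>\<^sub>E e\<in>E. if e \<in> \<Sigma> then {s\<^sub>0 e} else cn (u ` ends e))"
      using SP finP' card_mono by blast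
    also have "\<dots> = (\<Prod>e\<in>E. card (if e \<in> \<Sigma> then {s\<^sub>0 e} else cn (u ` ends e)))"
      using finE by (rule card_PiE)
    finally have "real (card (S u)) \<le> (\<Prod>e\<in>E. real (card (if e \<in> \<Sigma> then {s\<^sub>0 e} else cn (u ` ends e))))"
      by (simp only: of_nat_prod[symmetric] of_nat_le_iff)
    then have "(\<Sum>s\<in>S u. wt (x\<^sub>0, u, s)) \<le>
        (\<Prod>e\<in>E. real (card (if e \<in> \<Sigma> then {s\<^sub>0 e} else cn (u ` ends e)))) * (\<Prod>e\<in>E. 1 / cd (u ` ends e))"
      by (simp del: prod_dividef) (intro mult_right_mono prod_nonneg; simp)
    also have "\<dots> = (\<Prod>e\<in>E. real (card (if e \<in> \<Sigma> then {s\<^sub>0 e} else cn (u ` ends e))) * (1 / cd (u ` ends e)))"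
      by (rule prod.distrib[symmetric])
    also have "\<dots> = (\<Prod>e\<in>E. if e \<in> \<Sigma> then 1 / cd (u ` ends e) else 1)"
    proof (rule prod.cong[OF refl])
      fix e assume "e \<in> E"
      from cdp[OF this] show "real (card (if e \<in> \<Sigma> then {s\<^sub>0 e} else cn (u ` ends e))) * (1 / cd (u ` ends e))
         = (if e \<in> \<Sigma> then 1 / cd (u ` ends e) else 1)" by (auto simp: cd_def)
    qed
    also have "\<dots> = (\<Prod>e\<in>\<Sigma>. 1 / cd (u ` ends e))"
      using finE Sig by (simp add: prod.If_cases Int_absorb1 del: prod_dividef)
    also have "\<dots> \<le> c" using c[OF ub] .
    finally show ?thesis .
  qed
  have eq: "{y. y \<in> agree \<mu> u\<^sub>0 \<Sigma> s\<^sub>0 \<and> fst y = x\<^sub>0} = (\<lambda>(u, s). (x\<^sub>0, u, s)) ` (SIGMA u:U. S u)"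
    unfolding agree_def homs_def U_def S_def by auto
  have injp: "inj_on (\<lambda>(u, s). (x\<^sub>0, u, s)) (SIGMA u:U. S u)" by (auto simp: inj_on_def)
  have "(\<Sum>y | y \<in> agree \<mu> u\<^sub>0 \<Sigma> s\<^sub>0 \<and> fst y = x\<^sub>0. wt y) = (\<Sum>(u, s)\<in>(SIGMA u:U. S u). wt (x\<^sub>0, u, s))"
    unfolding eq sum.reindex[OF injp] by (intro sum.cong) auto
  also have "\<dots> = (\<Sum>u\<in>U. \<Sum>s\<in>S u. wt (x\<^sub>0, u, s))"
    using finU finS by (subst sum.Sigma) auto
  also have "\<dots> \<le> (\<Sum>u\<in>U. c)" by (rule sum_mono) (rule inner)
  also have "\<dots> \<le> real t ^ (card V - card \<mu>) * c" using cardU c0 by (simp add: mult_right_mono)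
  finally show ?thesis .
qed

lemma prod_inverse_cd_le:
  assumes "(x, u) \<in> bases" "\<Sigma> \<subseteq> E"
  shows "(\<Prod>e\<in>\<Sigma>. 1 / cd (u ` ends e)) \<le> (1 / h) ^ card \<Sigma>"
proof -
  have "(\<Prod>e\<in>\<Sigma>. 1 / cd (u ` ends e)) \<le> (\<Prod>e\<in>\<Sigma>. 1 / h)"
  proof (rule prod_mono)
    fix e assume "e \<in> \<Sigma>"
    then have "cd (u ` ends e) \<ge> h" using cd_ends assms by blast
    then show "0 \<le> 1 / cd (u ` ends e) \<and> 1 / cd (u ` ends e) \<le> 1 / h"
      using hpos by (auto intro!: divide_left_mono)
  qed
  then show ?thesis by simp
qed

lemma agree_apex_bound:
  assumes "\<mu> \<subseteq> V" and "\<Sigma> \<subseteq> E"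
  shows "(\<Sum>y | y \<in> agree \<mu> u\<^sub>0 \<Sigma> s\<^sub>0 \<and> fst y = x\<^sub>0. wt y) \<le> real t ^ (card V - card \<mu>) * (1 / h) ^ card \<Sigma>"
  using assms hpos prod_inverse_cd_le by (intro agree_fixed_apex) auto

text \<open>The apex is not prescribed. But if both ends of some \<open>e\<^sub>0 \<in> \<Sigma>\<close> are prescribed, then the apex lies in
their common neighbourhood, and the number of choices for it cancels against the weight of the
prescribed vertex \<open>s e\<^sub>0\<close>. Only the saving of \<open>e\<^sub>0\<close> is lost.\<close>

lemma agree_inner_bound:
  assumes mu: "\<mu> \<subseteq> V" and Sig: "\<Sigma> \<subseteq> E" and e0: "e\<^sub>0 \<in> \<Sigma>" "ends e\<^sub>0 \<subseteq> \<mu>"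
  shows "(\<Sum>y\<in>agree \<mu> u\<^sub>0 \<Sigma> s\<^sub>0. wt y) \<le> real t ^ (card V - card \<mu>) * (1 / h) ^ (card \<Sigma> - 1)"
proof -
  let ?N = "cn (u\<^sub>0 ` ends e\<^sub>0)"
  let ?b = "real t ^ (card V - card \<mu>) * ((1 / h) ^ (card \<Sigma> - 1) / cd (u\<^sub>0 ` ends e\<^sub>0))"
  have finSig: "finite \<Sigma>" using Sig finE finite_subset by blast
  have e0E: "e\<^sub>0 \<in> E" using e0 Sig by blast
  have sub: "agree \<mu> u\<^sub>0 \<Sigma> s\<^sub>0 \<subseteq> (\<Union>x\<in>?N. {y. y \<in> agree \<mu> u\<^sub>0 \<Sigma> s\<^sub>0 \<and> fst y = x})"
  proof
    fix y assume y: "y \<in> agree \<mu> u\<^sub>0 \<Sigma> s\<^sub>0"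
    obtain x u s where yy: "y = (x, u, s)" by (cases y)
    have b: "(x, u) \<in> bases" and ag: "\<forall>i\<in>\<mu>. u i = u\<^sub>0 i" using y unfolding agree_def homs_def yy by auto
    have "(x, u\<^sub>0 i) \<in> \<Gamma>" if "i \<in> ends e\<^sub>0" for i
    proof -
      have "i \<in> \<mu>" "i \<in> V" using that e0(2) mu by blast+
      then show ?thesis using basesD(3)[OF b, of i] ag by simp
    qed
    then have "x \<in> ?N" using basesD(1)[OF b] unfolding cn_def by auto
    then show "y \<in> (\<Union>x\<in>?N. {y. y \<in> agree \<mu> u\<^sub>0 \<Sigma> s\<^sub>0 \<and> fst y = x})" using y yy by auto
  qed
  have "(\<Sum>y\<in>agree \<mu> u\<^sub>0 \<Sigma> s\<^sub>0. wt y) \<le> sum wt (\<Union>x\<in>?N. {y. y \<in> agree \<mu> u\<^sub>0 \<Sigma> s\<^sub>0 \<and> fst y = x})"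
    by (rule sum_mono2) (use sub wt_nonneg in auto)
  also have "\<dots> \<le> (\<Sum>x\<in>?N. \<Sum>y | y \<in> agree \<mu> u\<^sub>0 \<Sigma> s\<^sub>0 \<and> fst y = x. wt y)"
    by (rule sum_UN_le) (use wt_nonneg in auto)
  also have "\<dots> \<le> (\<Sum>x\<in>?N. ?b)"
  proof (rule sum_mono, rule agree_fixed_apex[OF mu Sig])
    fix x u assume b: "(x, u) \<in> bases" and ag: "\<forall>i\<in>\<mu>. u i = u\<^sub>0 i"
    have im: "u ` ends e\<^sub>0 = u\<^sub>0 ` ends e\<^sub>0" using ag e0(2) by (auto intro!: image_cong)
    have "(\<Prod>e\<in>\<Sigma>. 1 / cd (u ` ends e)) = 1 / cd (u ` ends e\<^sub>0) * (\<Prod>e\<in>\<Sigma> - {e\<^sub>0}. 1 / cd (u ` ends e))"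
      using finSig e0(1) by (rule prod.remove)
    also have "\<dots> \<le> 1 / cd (u ` ends e\<^sub>0) * (1 / h) ^ card (\<Sigma> - {e\<^sub>0})"
      by (intro mult_left_mono prod_inverse_cd_le[OF b]) (use Sig in auto)
    also have "card (\<Sigma> - {e\<^sub>0}) = card \<Sigma> - 1" using finSig e0(1) by simp
    finally show "(\<Prod>e\<in>\<Sigma>. 1 / cd (u ` ends e)) \<le> (1 / h) ^ (card \<Sigma> - 1) / cd (u\<^sub>0 ` ends e\<^sub>0)"
      unfolding im by (simp del: prod_dividef)
  qed (use hpos in auto)
  also have "\<dots> = cd (u\<^sub>0 ` ends e\<^sub>0) * ?b" by (simp add: cd_def)
  also have "\<dots> \<le> real t ^ (card V - card \<mu>) * (1 / h) ^ (card \<Sigma> - 1)"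
    using hpos by (cases "cd (u\<^sub>0 ` ends e\<^sub>0) = 0") auto
  finally show ?thesis .
qed

text \<open>If only one end of \<open>e\<^sub>0\<close> is prescribed, the other one is a neighbour of \<open>s\<^sub>0 e\<^sub>0\<close>; summing over its at
most \<open>t\<close> values reduces to the preceding lemma.\<close>

lemma agree_outer_bound:
  assumes mu: "\<mu> \<subseteq> V" and Sig: "\<Sigma> \<subseteq> E" and e0: "e\<^sub>0 \<in> \<Sigma>" "ends e\<^sub>0 \<inter> \<mu> \<noteq> {}"
  shows "(\<Sum>y\<in>agree \<mu> u\<^sub>0 \<Sigma> s\<^sub>0. wt y) \<le> real t ^ (card V - card \<mu>) * (1 / h) ^ (card \<Sigma> - 1)"
proof (cases "ends e\<^sub>0 \<subseteq> \<mu>")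
  case True
  then show ?thesis using agree_inner_bound assms by blast
next
  case False
  have e0E: "e\<^sub>0 \<in> E" using e0 Sig by blast
  obtain i j where ij: "ends e\<^sub>0 = {i, j}" "i \<in> \<mu>" "j \<notin> \<mu>" "j \<in> V"
  proof -
    obtain a b where "ends e\<^sub>0 = {a, b}" "a \<noteq> b" "a \<in> V" "b \<in> V" using ends_pair[OF e0E] .
    then show thesis using that[of a b] that[of b a] False e0(2) by auto
  qed
  let ?b = "real t ^ (card V - card (insert j \<mu>)) * (1 / h) ^ (card \<Sigma> - 1)"
  have finmu: "finite \<mu>" using mu finV finite_subset by blast
  have sub: "agree \<mu> u\<^sub>0 \<Sigma> s\<^sub>0 \<subseteq> (\<Union>b\<in>nb (s\<^sub>0 e\<^sub>0). agree (insert j \<mu>) (u\<^sub>0(j := b)) \<Sigma> s\<^sub>0)"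
  proof
    fix y assume y: "y \<in> agree \<mu> u\<^sub>0 \<Sigma> s\<^sub>0"
    obtain x u s where yy: "y = (x, u, s)" by (cases y)
    have "s \<in> (\<Pi>\<^sub>E e\<in>E. cn (u ` ends e))" "\<forall>e\<in>\<Sigma>. s e = s\<^sub>0 e"
      using y unfolding agree_def homs_def yy by blast+
    then have s: "s e\<^sub>0 \<in> cn (u ` ends e\<^sub>0)" "s e\<^sub>0 = s\<^sub>0 e\<^sub>0"
      using e0(1) PiE_mem[OF _ e0E, of s] by blast+
    then have "u j \<in> nb (s\<^sub>0 e\<^sub>0)" unfolding cn_def nb_def ij by auto
    moreover have "y \<in> agree (insert j \<mu>) (u\<^sub>0(j := u j)) \<Sigma> s\<^sub>0"
      using y ij(3) unfolding agree_def yy by auto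
    ultimately show "y \<in> (\<Union>b\<in>nb (s\<^sub>0 e\<^sub>0). agree (insert j \<mu>) (u\<^sub>0(j := b)) \<Sigma> s\<^sub>0)" by blast
  qed
  have "(\<Sum>y\<in>agree \<mu> u\<^sub>0 \<Sigma> s\<^sub>0. wt y) \<le> sum wt (\<Union>b\<in>nb (s\<^sub>0 e\<^sub>0). agree (insert j \<mu>) (u\<^sub>0(j := b)) \<Sigma> s\<^sub>0)"
    by (rule sum_mono2) (use sub wt_nonneg in auto)
  also have "\<dots> \<le> (\<Sum>b\<in>nb (s\<^sub>0 e\<^sub>0). \<Sum>y\<in>agree (insert j \<mu>) (u\<^sub>0(j := b)) \<Sigma> s\<^sub>0. wt y)"
    by (rule sum_UN_le) (use wt_nonneg in auto)
  also have "\<dots> \<le> (\<Sum>b\<in>nb (s\<^sub>0 e\<^sub>0). ?b)"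
    by (rule sum_mono, rule agree_inner_bound[OF _ Sig e0(1)]) (use mu ij in auto)
  also have "\<dots> \<le> real t * ?b"
    using card_nb[of "s\<^sub>0 e\<^sub>0"] hpos by (simp add: mult_right_mono)
  also have "\<dots> = real t ^ (card V - card \<mu>) * (1 / h) ^ (card \<Sigma> - 1)"
  proof -
    have "card (insert j \<mu>) \<le> card V" using mu ij finV by (intro card_mono) auto
    then have "card V - card \<mu> = Suc (card V - card (insert j \<mu>))" using ij finmu by simp
    then show ?thesis by simp
  qed
  finally show ?thesis .
qed

text \<open>The edges of the graph of the multigraph: \<open>(None, i)\<close> joins the apex to the branch vertex \<open>i\<close>, and
\<open>(Some e, i)\<close> joins the subdivision vertex of \<open>e\<close> to its end \<open>i\<close>.\<close>

definition slots :: "('e option \<times> 'i) set" where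
  "slots = Pair None ` V \<union> (SIGMA a:Some ` E. ends (the a))"

fun arc :: "'x \<times> ('i \<Rightarrow> 'y) \<times> ('e \<Rightarrow> 'x) \<Rightarrow> 'e option \<times> 'i \<Rightarrow> 'x \<times> 'y" where
  "arc (x, u, s) (None, i) = (x, u i)"
| "arc (x, u, s) (Some e, i) = (s e, u i)"

lemma finite_slots: "finite slots"
  unfolding slots_def using finV finE by (auto intro!: finite_SigmaI)

lemma card_slots: "card slots = card V + 2 * card E"
proof -
  have "card slots = card (Pair (None :: 'e option) ` V) + card (SIGMA a:Some ` E. ends (the a))"
    unfolding slots_def using finV finE
    by (intro card_Un_disjoint) (auto intro!: finite_SigmaI)
  also have "card (Pair (None :: 'e option) ` V) = card V" by (intro card_image) (auto simp: inj_on_def)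
  also have "card (SIGMA a:Some ` E. ends (the a)) = (\<Sum>a\<in>Some ` E. card (ends (the a)))"
    using finE by (intro card_SigmaI) auto
  also have "\<dots> = (\<Sum>e\<in>E. 2)" by (subst sum.reindex) (auto simp: ends)
  finally show ?thesis by simp
qed

end

text \<open>\<open>n\<close> is the number of host vertices, \<open>t\<close> has the order of the average degree, \<open>h\<close> is a small
multiple of the average codegree \<open>t\<^sup>2 / n\<close>, and \<open>\<tau>\<close> the ratio by which degrees of edge sets must drop for every additional
edge. The two lower bounds on \<open>\<tau>\<close> are what two edges at one branch vertex, one of them to the apex,
and the set of all edges require.\<close>

locale density_parameters =
  fixes n t \<tau> c\<^sub>0 h :: real and v e :: nat
  assumes n: "n \<ge> 1" and t: "t \<ge> 1" and nt: "n \<le> t\<^sup>2" and c0: "0 < c\<^sub>0" "c\<^sub>0 \<le> 1"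
    and h_def: "h = c\<^sub>0 * t\<^sup>2 / n" and tau: "0 < \<tau>" "\<tau> \<le> 1" and htau: "1 / h \<le> \<tau>"
    and nu: "n powr (real e / (real v - 1 + 2 * real e)) \<le> \<tau> * t"
    and v2: "v \<ge> 2" and e1: "e \<ge> 1"
begin

lemma nu_power:
  assumes "real k * real e \<ge> x * (real v - 1 + 2 * real e)"
  shows "n powr x \<le> (\<tau> * t) ^ k"
proof -
  have D: "real v - 1 + 2 * real e > 0" using v2 e1 by simp
  have "n powr x \<le> n powr (real e / (real v - 1 + 2 * real e) * real k)"
    using assms n D by (intro powr_mono) (auto simp: field_simps)
  also have "\<dots> = (n powr (real e / (real v - 1 + 2 * real e))) ^ k"
    using n by (simp only: powr_powr[symmetric]) (simp add: powr_realpow)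
  also have "\<dots> \<le> (\<tau> * t) ^ k" using nu by (intro power_mono) auto
  finally show ?thesis .
qed

lemma h_pos: "h > 0" using n t c0 by (simp add: h_def)

lemma inverse_h_power: "f \<le> e \<Longrightarrow> (1 / h) ^ f \<le> (1 / c\<^sub>0) ^ e * (n ^ f / t ^ (2 * f))"
proof -
  assume f: "f \<le> e"
  have "1 / h = (1 / c\<^sub>0) * (n / t\<^sup>2)" by (simp add: h_def)
  then have "(1 / h) ^ f = (1 / c\<^sub>0) ^ f * (n ^ f / t ^ (2 * f))"
    by (simp only: power_mult_distrib power_divide power_mult[symmetric])
  also have "\<dots> \<le> (1 / c\<^sub>0) ^ e * (n ^ f / t ^ (2 * f))"
    using f c0 n t by (intro mult_right_mono power_increasing) auto
  finally show ?thesis .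
qed

text \<open>This is where balancedness enters: if \<open>m\<close> branch vertices and \<open>f\<close> edges between them are prescribed,
then \<open>f / (m - 1) \<le> e / (v - 1)\<close>, and therefore \<open>n ^ f \<le> (\<tau> t) ^ (m - 1 + 2 f)\<close>. This is just what is
needed for the \<open>m + 2 f\<close> host edges that these vertices span together with the apex. Each of the \<open>q\<close>
further subdivision vertices contributes one edge and one factor \<open>1 / h \<le> \<tau>\<close>.\<close>

lemma apex_numbers:
  assumes m: "1 \<le> m" "m \<le> v" and f: "f \<le> e" "f * (v - 1) \<le> e * (m - 1)" and k: "k \<le> m + 2 * f + q"
  shows "t ^ (v - m) * (1 / h) ^ (f + q) \<le> (1 / c\<^sub>0) ^ e * \<tau> ^ (k - 1) * t ^ (v - 1)"
proof -
  have rf: "real f * (real v - 1) \<le> real e * (real m - 1)"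
  proof -
    have "real (f * (v - 1)) \<le> real (e * (m - 1))" using f(2) of_nat_le_iff by blast
    then show ?thesis using m v2 by (simp add: of_nat_diff)
  qed
  have "n ^ f = n powr real f" using n by (simp add: powr_realpow)
  also have "\<dots> \<le> (\<tau> * t) ^ (m - 1 + 2 * f)"
    by (rule nu_power) (use rf m in \<open>simp add: of_nat_diff algebra_simps\<close>)
  finally have nf: "n ^ f \<le> (\<tau> * t) ^ (m - 1 + 2 * f)" .
  have "(1 / h) ^ f \<le> (1 / c\<^sub>0) ^ e * (n ^ f / t ^ (2 * f))" by (rule inverse_h_power[OF f(1)])
  also have "\<dots> \<le> (1 / c\<^sub>0) ^ e * ((\<tau> * t) ^ (m - 1 + 2 * f) / t ^ (2 * f))"
    using nf c0 t by (intro mult_left_mono divide_right_mono) auto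
  also have "(\<tau> * t) ^ (m - 1 + 2 * f) / t ^ (2 * f) = \<tau> ^ (m - 1 + 2 * f) * t ^ (m - 1)"
    using t by (simp add: power_mult_distrib power_add)
  finally have hf: "(1 / h) ^ f \<le> (1 / c\<^sub>0) ^ e * (\<tau> ^ (m - 1 + 2 * f) * t ^ (m - 1))" .
  have hq: "(1 / h) ^ q \<le> \<tau> ^ q" using htau h_pos by (intro power_mono) auto
  have "t ^ (v - m) * (1 / h) ^ (f + q) = t ^ (v - m) * ((1 / h) ^ f * (1 / h) ^ q)" by (simp add: power_add)
  also have "\<dots> \<le> t ^ (v - m) * ((1 / c\<^sub>0) ^ e * (\<tau> ^ (m - 1 + 2 * f) * t ^ (m - 1)) * \<tau> ^ q)"
    using hf hq t h_pos c0 tau by (intro mult_left_mono mult_mono) auto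
  also have "\<dots> = (1 / c\<^sub>0) ^ e * \<tau> ^ (m - 1 + 2 * f + q) * (t ^ (v - m) * t ^ (m - 1))"
    by (simp add: power_add mult_ac)
  also have "t ^ (v - m) * t ^ (m - 1) = t ^ (v - 1)"
    using m by (simp flip: power_add)
  also have "(1 / c\<^sub>0) ^ e * \<tau> ^ (m - 1 + 2 * f + q) * t ^ (v - 1) \<le> (1 / c\<^sub>0) ^ e * \<tau> ^ (k - 1) * t ^ (v - 1)"
    using k m tau c0 t by (intro mult_right_mono mult_left_mono power_decreasing) auto
  finally show ?thesis .
qed

text \<open>Without the apex there are \<open>m\<close> edges less, but also one factor \<open>1 / h\<close> less. Besides balancedness the
bound uses \<open>n \<le> t\<^sup>2\<close>: the power of \<open>n\<close> is split into a part controlled by \<open>\<tau> t\<close> and the part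
\<open>n powr ((m - 2) / 2) \<le> t ^ (m - 2)\<close>.\<close>

lemma no_apex_numbers:
  assumes m: "1 \<le> m" "m \<le> v" and f: "f \<le> e" "f * (v - 1) \<le> e * (m - 1)" and fq: "f + q \<ge> 1"
    and k: "k \<le> 2 * f + q"
  shows "t ^ (v - m) * (1 / h) ^ (f + q - 1) \<le> (1 / c\<^sub>0) ^ e * \<tau> ^ (k - 1) * t ^ (v - 1)"
proof (cases "f = 0")
  case True
  have "t ^ (v - m) * (1 / h) ^ (q - 1) \<le> t ^ (v - 1) * \<tau> ^ (k - 1)"
  proof (intro mult_mono)
    show "t ^ (v - m) \<le> t ^ (v - 1)" using t m by (intro power_increasing) auto
    have "(1 / h) ^ (q - 1) \<le> \<tau> ^ (q - 1)" using htau h_pos by (intro power_mono) auto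
    also have "\<dots> \<le> \<tau> ^ (k - 1)" using k True tau by (intro power_decreasing) auto
    finally show "(1 / h) ^ (q - 1) \<le> \<tau> ^ (k - 1)" .
  qed (use t h_pos in auto)
  also have "\<dots> = 1 * (t ^ (v - 1) * \<tau> ^ (k - 1))" by simp
  also have "\<dots> \<le> (1 / c\<^sub>0) ^ e * (t ^ (v - 1) * \<tau> ^ (k - 1))"
    using c0 t tau by (intro mult_right_mono one_le_power) auto
  finally show ?thesis using True by (simp add: mult_ac)
next
  case False
  then obtain g where g: "f = Suc g" by (cases f) auto
  have "e * (m - 1) \<ge> 1"
    using f(2) False v2 by (metis One_nat_def Suc_leI diff_is_0_eq le_trans mult_pos_pos neq0_conv not_less_eq_eq numeral_2_eq_2)
  then have m2: "m \<ge> 2" by (cases "m - 1") auto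
  have rf: "real f * (real v - 1) \<le> real e * (real m - 1)"
  proof -
    have "real (f * (v - 1)) \<le> real (e * (m - 1))" using f(2) of_nat_le_iff by blast
    then show ?thesis using m v2 by (simp add: of_nat_diff)
  qed
  have expo: "(2 * real f - real m) * (real v - 1 + 2 * real e) \<le> 2 * real e * (2 * real f - 1)"
  proof (cases "2 * real f \<le> real m")
    case True
    have "(2 * real f - real m) * (real v - 1 + 2 * real e) \<le> 0"
      using True v2 by (intro mult_nonpos_nonneg) auto
    also have "0 \<le> 2 * real e * (2 * real f - 1)" using g by simp
    finally show ?thesis .
  next
    case F: False
    have "(2 * real f - real m) * (real f * (real v - 1)) \<le> (2 * real f - real m) * (real e * (real m - 1))"
      using rf F by (intro mult_left_mono) auto
    also have "\<dots> \<le> (2 * real f) * (real e * (real m - 1))" using m2 by (intro mult_right_mono) auto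
    finally have "real f * ((2 * real f - real m) * (real v - 1)) \<le> real f * (2 * real e * (real m - 1))"
      by (simp add: algebra_simps)
    then have "(2 * real f - real m) * (real v - 1) \<le> 2 * real e * (real m - 1)" using False by simp
    then show ?thesis by (simp add: algebra_simps)
  qed
  have "n powr (real f - 1 - (real m - 2) / 2) \<le> (\<tau> * t) ^ (2 * f - 1)"
  proof (rule nu_power)
    have "real f - 1 - (real m - 2) / 2 = (2 * real f - real m) / 2" by (simp add: field_simps)
    then have "(real f - 1 - (real m - 2) / 2) * (real v - 1 + 2 * real e)
        = (2 * real f - real m) * (real v - 1 + 2 * real e) / 2" by simp
    also have "\<dots> \<le> 2 * real e * (2 * real f - 1) / 2" using expo by (rule divide_right_mono) simp
    also have "\<dots> = real (2 * f - 1) * real e" using g by (simp add: of_nat_diff)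
    finally show "(real f - 1 - (real m - 2) / 2) * (real v - 1 + 2 * real e) \<le> real (2 * f - 1) * real e" .
  qed
  moreover have "n powr ((real m - 2) / 2) \<le> t ^ (m - 2)"
  proof -
    have "n powr ((real m - 2) / 2) \<le> (t\<^sup>2) powr ((real m - 2) / 2)"
      using nt n m2 by (intro powr_mono2) auto
    also have "t\<^sup>2 = t powr 2" using t by simp
    also have "(t powr 2) powr ((real m - 2) / 2) = t powr real (m - 2)"
    proof -
      have "2 * ((real m - 2) / 2) = real (m - 2)" using m2 by (simp add: of_nat_diff)
      then show ?thesis unfolding powr_powr by (rule arg_cong)
    qed
    also have "\<dots> = t ^ (m - 2)" using t by (simp add: powr_realpow)
    finally show ?thesis .
  qed
  ultimately have "n powr (real f - 1 - (real m - 2) / 2) * n powr ((real m - 2) / 2)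
      \<le> (\<tau> * t) ^ (2 * f - 1) * t ^ (m - 2)"
    using t tau by (intro mult_mono) auto
  then have ng: "n ^ g \<le> (\<tau> * t) ^ (2 * f - 1) * t ^ (m - 2)"
    using n g by (simp add: powr_add[symmetric] powr_realpow)
  have "(1 / h) ^ g \<le> (1 / c\<^sub>0) ^ e * (n ^ g / t ^ (2 * g))" by (rule inverse_h_power) (use f g in simp)
  also have "\<dots> \<le> (1 / c\<^sub>0) ^ e * ((\<tau> * t) ^ (2 * f - 1) * t ^ (m - 2) / t ^ (2 * g))"
    using ng c0 t by (intro mult_left_mono divide_right_mono) auto
  also have "(\<tau> * t) ^ (2 * f - 1) * t ^ (m - 2) / t ^ (2 * g) = \<tau> ^ (2 * f - 1) * t ^ (m - 1)"
  proof -
    have "2 * f - 1 = 2 * g + 1" "m - 1 = Suc (m - 2)" using g m2 by auto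
    then show ?thesis using t by (simp add: power_mult_distrib power_add)
  qed
  finally have hf: "(1 / h) ^ g \<le> (1 / c\<^sub>0) ^ e * (\<tau> ^ (2 * f - 1) * t ^ (m - 1))" .
  have hq: "(1 / h) ^ q \<le> \<tau> ^ q" using htau h_pos by (intro power_mono) auto
  have "t ^ (v - m) * (1 / h) ^ (f + q - 1) = t ^ (v - m) * ((1 / h) ^ g * (1 / h) ^ q)"
    using g by (simp add: power_add)
  also have "\<dots> \<le> t ^ (v - m) * ((1 / c\<^sub>0) ^ e * (\<tau> ^ (2 * f - 1) * t ^ (m - 1)) * \<tau> ^ q)"
    using hf hq t h_pos c0 tau by (intro mult_left_mono mult_mono) auto
  also have "\<dots> = (1 / c\<^sub>0) ^ e * \<tau> ^ (2 * f - 1 + q) * (t ^ (v - m) * t ^ (m - 1))"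
    by (simp add: power_add mult_ac)
  also have "t ^ (v - m) * t ^ (m - 1) = t ^ (v - 1)"
    using m by (simp flip: power_add)
  also have "(1 / c\<^sub>0) ^ e * \<tau> ^ (2 * f - 1 + q) * t ^ (v - 1) \<le> (1 / c\<^sub>0) ^ e * \<tau> ^ (k - 1) * t ^ (v - 1)"
    using k g tau c0 t by (intro mult_right_mono mult_left_mono power_decreasing) auto
  finally show ?thesis .
qed

end

locale dense_arc_system = arc_system A B \<Gamma> \<alpha> \<beta> t V E ends h +
  density_parameters n "real t" \<tau> c\<^sub>0 h "card V" "card E"
  for A :: "'x set" and B :: "'y set" and \<Gamma> and \<alpha> :: "'x \<Rightarrow> 'v" and \<beta> and t :: nat
    and V :: "'i set" and E :: "'e set" and ends h and n \<tau> c\<^sub>0 :: real +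
  assumes balanced: "\<And>\<mu>. \<mu> \<subseteq> V \<Longrightarrow> card \<mu> \<ge> 2 \<Longrightarrow>
     card {e \<in> E. ends e \<subseteq> \<mu>} * (card V - 1) \<le> card E * (card \<mu> - 1)"
begin

text \<open>Prescribing the host edges at a nonempty set \<open>Q\<close> of slots prescribes the branch vertices
\<open>\<mu> = snd ` Q\<close>, the subdivision vertices of the edges in \<open>\<Sigma>\<close>, and the apex if one of its slots
occurs. With \<open>f\<close> and \<open>q\<close> the numbers of edges in \<open>\<Sigma>\<close> with both and with one end in \<open>\<mu>\<close>, there are at
most \<open>2 f + q\<close> slots at subdivision vertices and at most \<open>card \<mu>\<close> at the apex.\<close>

lemma agree_on_slots:
  assumes Q: "Q \<subseteq> slots" "Q \<noteq> {}" and y0: "y\<^sub>0 \<in> homs"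
  shows "(\<Sum>y | y \<in> homs \<and> (\<forall>\<sigma>\<in>Q. arc y \<sigma> = arc y\<^sub>0 \<sigma>). wt y)
    \<le> (1 / c\<^sub>0) ^ card E * \<tau> ^ (card Q - 1) * real t ^ (card V - 1)"
proof -
  obtain x\<^sub>0 u\<^sub>0 s\<^sub>0 where y0e: "y\<^sub>0 = (x\<^sub>0, u\<^sub>0, s\<^sub>0)" by (cases y\<^sub>0)
  define \<mu> where "\<mu> = snd ` Q"
  define \<Sigma> where "\<Sigma> = {e \<in> E. \<exists>i. (Some e, i) \<in> Q}"
  define f where "f = card {e \<in> \<Sigma>. ends e \<subseteq> \<mu>}"
  define q where "q = card {e \<in> \<Sigma>. \<not> ends e \<subseteq> \<mu>}"
  let ?S = "{y. y \<in> homs \<and> (\<forall>\<sigma>\<in>Q. arc y \<sigma> = arc y\<^sub>0 \<sigma>)}"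
  have finQ: "finite Q" using Q finite_slots finite_subset by blast
  have Some_slot: "e \<in> E \<and> i \<in> ends e" if "(Some e, i) \<in> Q" for e i
    using that Q(1) unfolding slots_def by auto
  have muV: "\<mu> \<subseteq> V"
    using Q(1) ends unfolding \<mu>_def slots_def by fastforce
  have SigE: "\<Sigma> \<subseteq> E" by (auto simp: \<Sigma>_def)
  have finSig: "finite \<Sigma>" using SigE finE finite_subset by blast
  have finmu: "finite \<mu>" using muV finV finite_subset by blast
  have mu1: "1 \<le> card \<mu>" using Q(2) finmu by (simp add: \<mu>_def Suc_le_eq card_gt_0_iff)
  have muv: "card \<mu> \<le> card V" using muV finV card_mono by blast
  have cSig: "card \<Sigma> = f + q"
  proof -
    have "\<Sigma> = {e \<in> \<Sigma>. ends e \<subseteq> \<mu>} \<union> {e \<in> \<Sigma>. \<not> ends e \<subseteq> \<mu>}" by blast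
    then show ?thesis unfolding f_def q_def using finSig
      by (metis (no_types, lifting) card_Un_disjoint disjoint_iff finite_Un mem_Collect_eq)
  qed
  have f_le: "f \<le> card {e \<in> E. ends e \<subseteq> \<mu>}"
    unfolding f_def using SigE finE by (intro card_mono) auto
  have fE: "f \<le> card E" using f_le card_mono[of E "{e \<in> E. ends e \<subseteq> \<mu>}"] finE by auto
  have fbal: "f * (card V - 1) \<le> card E * (card \<mu> - 1)"
  proof (cases "card \<mu> \<ge> 2")
    case True
    show ?thesis using f_le balanced[OF muV True] by (meson le_trans mult_le_mono1)
  next
    case False
    have "\<not> ends e \<subseteq> \<mu>" if "e \<in> E" for e
      using card_mono[OF finmu, of "ends e"] ends[OF that] False by linarith
    then have "{e \<in> E. ends e \<subseteq> \<mu>} = {}" by blast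
    then have "f = 0" using f_le by (metis card.empty le_zero_eq)
    then show ?thesis by simp
  qed
  have agr: "u i = u\<^sub>0 i" if yS: "(x, u, s) \<in> ?S" and imu: "i \<in> \<mu>" for x u s i
  proof -
    obtain a where a: "(a, i) \<in> Q" using imu unfolding \<mu>_def by auto
    then have "arc (x, u, s) (a, i) = arc (x\<^sub>0, u\<^sub>0, s\<^sub>0) (a, i)" using yS y0e by auto
    then show ?thesis by (cases a) auto
  qed
  have agrs: "s e = s\<^sub>0 e" if yS: "(x, u, s) \<in> ?S" and eS: "e \<in> \<Sigma>" for x u s e
  proof -
    obtain i where a: "(Some e, i) \<in> Q" using eS unfolding \<Sigma>_def by auto
    then have "arc (x, u, s) (Some e, i) = arc (x\<^sub>0, u\<^sub>0, s\<^sub>0) (Some e, i)" using yS y0e by auto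
    then show ?thesis by auto
  qed
  have Ssub: "?S \<subseteq> agree \<mu> u\<^sub>0 \<Sigma> s\<^sub>0"
  proof
    fix y assume y: "y \<in> ?S"
    obtain x u s where yy: "y = (x, u, s)" by (cases y)
    show "y \<in> agree \<mu> u\<^sub>0 \<Sigma> s\<^sub>0"
      using y agr[of x u s] agrs[of x u s] unfolding agree_def yy by auto
  qed
  have Qsome: "card {\<sigma> \<in> Q. fst \<sigma> \<noteq> None} \<le> 2 * f + q"
  proof -
    have "{\<sigma> \<in> Q. fst \<sigma> \<noteq> None} \<subseteq> (\<lambda>(e, i). (Some e, i)) ` (SIGMA e:\<Sigma>. ends e \<inter> \<mu>)"
    proof
      fix \<sigma> assume \<sigma>: "\<sigma> \<in> {\<sigma> \<in> Q. fst \<sigma> \<noteq> None}"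
      then obtain e i where ei: "\<sigma> = (Some e, i)" by (cases \<sigma>) auto
      then have "e \<in> \<Sigma>" "i \<in> ends e" "i \<in> \<mu>" using \<sigma> Some_slot[of e i] unfolding \<Sigma>_def \<mu>_def by force+
      then show "\<sigma> \<in> (\<lambda>(e, i). (Some e, i)) ` (SIGMA e:\<Sigma>. ends e \<inter> \<mu>)" using ei by force
    qed
    then have "card {\<sigma> \<in> Q. fst \<sigma> \<noteq> None} \<le> card (SIGMA e:\<Sigma>. ends e \<inter> \<mu>)"
      using finSig finmu by (meson card_image_le card_mono finite_Int finite_SigmaI finite_imageI le_trans)
    also have "\<dots> = (\<Sum>e\<in>\<Sigma>. card (ends e \<inter> \<mu>))" using finSig finmu by (intro card_SigmaI) auto
    also have "\<dots> \<le> (\<Sum>e\<in>\<Sigma>. if ends e \<subseteq> \<mu> then 2 else 1)"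
    proof (rule sum_mono)
      fix e assume e: "e \<in> \<Sigma>"
      then have eE: "e \<in> E" using SigE by blast
      show "card (ends e \<inter> \<mu>) \<le> (if ends e \<subseteq> \<mu> then 2 else 1)"
      proof (cases "ends e \<subseteq> \<mu>")
        case True
        then show ?thesis using ends[OF eE] by (simp add: Int_absorb2)
      next
        case False
        then have "ends e \<inter> \<mu> \<subset> ends e" by blast
        then have "card (ends e \<inter> \<mu>) < card (ends e)" using eE by (intro psubset_card_mono) auto
        then show ?thesis using False ends[OF eE] by simp
      qed
    qed
    also have "\<dots> = 2 * f + q"
      unfolding f_def q_def using finSig by (simp add: sum.If_cases Int_def)
    finally show ?thesis .
  qed
  show ?thesis
  proof (cases "\<exists>i. (None, i) \<in> Q")
    case True
    then obtain i where i: "(None, i) \<in> Q" by blast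
    have Sx: "?S \<subseteq> {y. y \<in> agree \<mu> u\<^sub>0 \<Sigma> s\<^sub>0 \<and> fst y = x\<^sub>0}"
    proof
      fix y assume y: "y \<in> ?S"
      obtain x u s where yy: "y = (x, u, s)" by (cases y)
      have "arc (x, u, s) (None, i) = arc (x\<^sub>0, u\<^sub>0, s\<^sub>0) (None, i)" using y yy y0e i by auto
      then show "y \<in> {y. y \<in> agree \<mu> u\<^sub>0 \<Sigma> s\<^sub>0 \<and> fst y = x\<^sub>0}" using Ssub y yy by auto
    qed
    have cQ: "card Q \<le> card \<mu> + 2 * f + q"
    proof -
      have "Q = {\<sigma> \<in> Q. fst \<sigma> = None} \<union> {\<sigma> \<in> Q. fst \<sigma> \<noteq> None}" by blast
      then have "card Q \<le> card {\<sigma> \<in> Q. fst \<sigma> = None} + card {\<sigma> \<in> Q. fst \<sigma> \<noteq> None}"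
        by (metis (no_types, lifting) card_Un_le)
      moreover have "card {\<sigma> \<in> Q. fst \<sigma> = None} \<le> card \<mu>"
      proof (rule card_inj_on_le[of snd])
        show "inj_on snd {\<sigma> \<in> Q. fst \<sigma> = None}" by (auto simp: inj_on_def)
      qed (auto simp: \<mu>_def finQ)
      ultimately show ?thesis using Qsome by linarith
    qed
    have "(\<Sum>y\<in>?S. wt y) \<le> (\<Sum>y | y \<in> agree \<mu> u\<^sub>0 \<Sigma> s\<^sub>0 \<and> fst y = x\<^sub>0. wt y)"
      by (rule sum_mono2) (use Sx wt_nonneg in auto)
    also have "\<dots> \<le> real t ^ (card V - card \<mu>) * (1 / h) ^ (f + q)"
      using agree_apex_bound[OF muV SigE] unfolding cSig .
    also have "\<dots> \<le> (1 / c\<^sub>0) ^ card E * \<tau> ^ (card Q - 1) * real t ^ (card V - 1)"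
      by (rule apex_numbers[OF mu1 muv fE fbal cQ])
    finally show ?thesis .
  next
    case False
    then have "fst \<sigma> \<noteq> None" if "\<sigma> \<in> Q" for \<sigma>
      using that by (metis prod.collapse)
    then have "{\<sigma> \<in> Q. fst \<sigma> \<noteq> None} = Q" by blast
    then have cQ: "card Q \<le> 2 * f + q" using Qsome by simp
    obtain a i where ai: "(a, i) \<in> Q" using Q(2) by auto
    with False obtain e where e: "(Some e, i) \<in> Q" by (cases a) auto
    have eS: "e \<in> \<Sigma>" "ends e \<inter> \<mu> \<noteq> {}" using e Some_slot[OF e] unfolding \<Sigma>_def \<mu>_def by force+
    have fq: "f + q \<ge> 1" using eS(1) finSig cSig card_gt_0_iff[of \<Sigma>] by auto
    have "(\<Sum>y\<in>?S. wt y) \<le> (\<Sum>y\<in>agree \<mu> u\<^sub>0 \<Sigma> s\<^sub>0. wt y)"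
      by (rule sum_mono2) (use Ssub wt_nonneg in auto)
    also have "\<dots> \<le> real t ^ (card V - card \<mu>) * (1 / h) ^ (f + q - 1)"
      using agree_outer_bound[OF muV SigE eS] unfolding cSig .
    also have "\<dots> \<le> (1 / c\<^sub>0) ^ card E * \<tau> ^ (card Q - 1) * real t ^ (card V - 1)"
      by (rule no_apex_numbers[OF mu1 muv fE fbal fq cQ])
    finally show ?thesis .
  qed
qed

text \<open>A set \<open>T\<close> of arcs lies in the image of a homomorphism if it is the image of some injective choice of
slots; the number of such choices is bounded in terms of the multigraph.\<close>

lemma homs_degree_bound:
  assumes T: "T \<noteq> {}" "finite T"
  shows "(\<Sum>y | y \<in> homs \<and> T \<subseteq> arc y ` slots. wt y)
    \<le> real (card slots) ^ card slots * (1 / c\<^sub>0) ^ card E * \<tau> ^ (card T - 1) * real t ^ (card V - 1)"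
proof (cases "card T \<le> card slots")
  case False
  have none: "{y. y \<in> homs \<and> T \<subseteq> arc y ` slots} = {}"
    using False finite_slots surj_card_le by blast
  show ?thesis unfolding none sum.empty using c0 tau by auto
next
  case True
  let ?b = "(1 / c\<^sub>0) ^ card E * \<tau> ^ (card T - 1) * real t ^ (card V - 1)"
  let ?Q = "{g \<in> T \<rightarrow>\<^sub>E slots. inj_on g T}"
  let ?Y = "\<lambda>g. {y. y \<in> homs \<and> (\<forall>a\<in>T. arc y (g a) = a)}"
  have b0: "?b \<ge> 0" using c0 tau by auto
  have finPi: "finite (T \<rightarrow>\<^sub>E slots)" using T finite_slots by (intro finite_PiE) auto
  have finQ: "finite ?Q" using finPi by simp
  have finY: "finite (?Y g)" for g using finite_homs by auto
  have sub: "{y. y \<in> homs \<and> T \<subseteq> arc y ` slots} \<subseteq> (\<Union>g\<in>?Q. ?Y g)"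
  proof
    fix y assume "y \<in> {y. y \<in> homs \<and> T \<subseteq> arc y ` slots}"
    then have y: "y \<in> homs" "T \<subseteq> arc y ` slots" by auto
    have "\<forall>a\<in>T. \<exists>\<sigma>. \<sigma> \<in> slots \<and> arc y \<sigma> = a" using y(2) by blast
    then obtain g0 where g0: "\<forall>a\<in>T. g0 a \<in> slots \<and> arc y (g0 a) = a" by metis
    define g where "g = restrict g0 T"
    have "g \<in> T \<rightarrow>\<^sub>E slots" using g0 by (simp add: g_def)
    moreover have ga: "\<forall>a\<in>T. arc y (g a) = a" using g0 by (simp add: g_def)
    moreover have "inj_on g T" using ga by (metis inj_onI)
    ultimately show "y \<in> (\<Union>g\<in>?Q. ?Y g)" using y(1) by blast
  qed
  have each: "(\<Sum>y\<in>?Y g. wt y) \<le> ?b" if g: "g \<in> ?Q" for g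
  proof (cases "?Y g = {}")
    case True
    show ?thesis unfolding True sum.empty by (rule b0)
  next
    case False
    then obtain y0 where y0: "y0 \<in> homs" "\<forall>a\<in>T. arc y0 (g a) = a" by auto
    have gs: "g ` T \<subseteq> slots" "inj_on g T" using g by auto
    have "?Y g = {y. y \<in> homs \<and> (\<forall>\<sigma>\<in>g ` T. arc y \<sigma> = arc y0 \<sigma>)}" using y0 by auto
    then have "(\<Sum>y\<in>?Y g. wt y) \<le> (1 / c\<^sub>0) ^ card E * \<tau> ^ (card (g ` T) - 1) * real t ^ (card V - 1)"
      using agree_on_slots[OF gs(1) _ y0(1)] T(1) by simp
    then show ?thesis using card_image[OF gs(2)] by simp
  qed
  have "(\<Sum>y | y \<in> homs \<and> T \<subseteq> arc y ` slots. wt y) \<le> sum wt (\<Union>g\<in>?Q. ?Y g)"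
    by (rule sum_mono2) (use sub finQ finY wt_nonneg in auto)
  also have "\<dots> \<le> (\<Sum>g\<in>?Q. \<Sum>y\<in>?Y g. wt y)"
    by (rule sum_UN_le) (use finQ finY wt_nonneg in auto)
  also have "\<dots> \<le> (\<Sum>g\<in>?Q. ?b)" by (rule sum_mono) (rule each)
  also have "\<dots> = real (card ?Q) * ?b" by simp
  also have "\<dots> \<le> real (card slots) ^ card slots * ?b"
  proof (rule mult_right_mono[OF _ b0])
    have "card ?Q \<le> card (T \<rightarrow>\<^sub>E slots)" using finPi by (intro card_mono) auto
    also have "\<dots> = card slots ^ card T" using T by (simp add: card_PiE)
    also have "\<dots> \<le> card slots ^ card slots"
      using True T card_gt_0_iff[of T] by (intro power_increasing) auto
    finally have "real (card ?Q) \<le> real (card slots ^ card slots)" by (rule of_nat_mono)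
    then show "real (card ?Q) \<le> real (card slots) ^ card slots" by simp
  qed
  finally show ?thesis by (simp add: mult_ac)
qed

end

section \<open>Many copies in dense arc systems\<close>

context arc_system
begin

text \<open>Choices of the subdivision vertices in \<open>F\<close> over a fixed base that keep the map injective.\<close>

definition extensions :: "'x \<Rightarrow> ('i \<Rightarrow> 'y) \<Rightarrow> 'e set \<Rightarrow> ('e \<Rightarrow> 'x) set" where
  "extensions x u F = {s \<in> (\<Pi>\<^sub>E e\<in>F. cn (u ` ends e)). inj_on (\<alpha> \<circ> s) F \<and> (\<forall>e\<in>F. s e \<noteq> x) \<and>
     (\<forall>e\<in>F. \<forall>j\<in>V. \<alpha> (s e) \<noteq> \<beta> (u j))}"

text \<open>Distinct neighbours of one clone are clones of distinct vertices, as an edge of the host graph is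
represented by one arc only.\<close>

lemma arc_eqD1:
  assumes "(a, b) \<in> \<Gamma>" "(a', b) \<in> \<Gamma>" "\<alpha> a = \<alpha> a'" shows "a = a'"
  using inj_onD[OF inj, of "(a, b)" "(a', b)"] assms by auto

lemma arc_eqD2:
  assumes "(a, b) \<in> \<Gamma>" "(a, b') \<in> \<Gamma>" "\<beta> b = \<beta> b'" shows "b = b'"
  using inj_onD[OF inj, of "(a, b)" "(a, b')"] assms by auto

lemma finite_extensions: "F \<subseteq> E \<Longrightarrow> finite (extensions x u F)"
  unfolding extensions_def using finE finite_subset
  by (intro finite_subset[OF _ finite_PiE[of F "\<lambda>e. cn (u ` ends e)"]]) auto

text \<open>Greedy choice: of the at least \<open>h\<close> common neighbours of the ends of \<open>e\<close> at most half are clones of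
vertices that have been used before.\<close>

lemma card_extensions:
  assumes b: "(x, u) \<in> bases" and F: "finite F" "F \<subseteq> E"
  shows "(\<Prod>e\<in>F. cd (u ` ends e) / 2) \<le> real (card (extensions x u F))"
  using F
proof (induction F rule: finite_induct)
  case empty
  have "extensions x u {} = {\<lambda>_. undefined}" unfolding extensions_def by auto
  then show ?case by simp
next
  case (insert e F)
  have eE: "e \<in> E" and FE: "F \<subseteq> E" using insert.prems by auto
  have IH: "(\<Prod>e\<in>F. cd (u ` ends e) / 2) \<le> real (card (extensions x u F))"
    using insert.IH FE by blast
  define bad where "bad s = {a \<in> cn (u ` ends e). a = x \<or> \<alpha> a \<in> \<beta> ` u ` V \<or> \<alpha> a \<in> \<alpha> ` s ` F}" for s
  obtain i j where ij: "ends e = {i, j}" "i \<noteq> j" "i \<in> V" "j \<in> V" using ends_pair[OF eE] .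
  have many: "cd (u ` ends e) / 2 \<le> real (card (cn (u ` ends e) - bad s))" for s
  proof -
    let ?X = "\<beta> ` u ` V \<union> \<alpha> ` s ` F"
    let ?f = "\<lambda>w. {a \<in> cn (u ` ends e). \<alpha> a = w}"
    have finX: "finite ?X" using finV insert.hyps by auto
    have one: "card (?f w) \<le> 1" for w
    proof -
      have "a = a'" if "a \<in> ?f w" "a' \<in> ?f w" for a a'
        using that arc_eqD1[of a "u i" a'] unfolding cn_def ij by auto
      moreover have "finite (?f w)" by simp
      ultimately have "card (?f w) \<le> Suc 0" by (subst card_le_Suc0_iff_eq) blast+
      then show ?thesis by simp
    qed
    have "bad s \<subseteq> {x} \<union> (\<Union>w\<in>?X. ?f w)" unfolding bad_def by auto
    moreover have "finite ({x} \<union> (\<Union>w\<in>?X. ?f w))" by (intro finite_UnI finite_UN_I[OF finX]) simp_all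
    ultimately have "card (bad s) \<le> card ({x} \<union> (\<Union>w\<in>?X. ?f w))" by (rule card_mono[rotated])
    also have "\<dots> \<le> 1 + card (\<Union>w\<in>?X. ?f w)" using card_Un_le[of "{x}"] by simp
    also have "card (\<Union>w\<in>?X. ?f w) \<le> (\<Sum>w\<in>?X. card (?f w))" using finX by (rule card_UN_le)
    also have "\<dots> \<le> (\<Sum>w\<in>?X. 1)" by (rule sum_mono) (rule one)
    also have "\<dots> = card ?X" by simp
    also have "card ?X \<le> card V + card E"
    proof -
      have "card ?X \<le> card (\<beta> ` u ` V) + card (\<alpha> ` s ` F)" by (rule card_Un_le)
      moreover have "card (\<beta> ` u ` V) \<le> card V" using finV by (metis card_image_le finite_imageI le_trans)
      moreover have "card (\<alpha> ` s ` F) \<le> card F" using insert.hyps by (metis card_image_le finite_imageI le_trans)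
      moreover have "card F \<le> card E" using FE finE card_mono by blast
      ultimately show ?thesis by linarith
    qed
    finally have cb: "real (card (bad s)) \<le> h / 2" using h by simp
    have "card (cn (u ` ends e) - bad s) = card (cn (u ` ends e)) - card (bad s)"
      by (rule card_Diff_subset) (auto simp: bad_def)
    moreover have "card (bad s) \<le> card (cn (u ` ends e))" by (rule card_mono) (auto simp: bad_def)
    ultimately have "real (card (cn (u ` ends e) - bad s)) = cd (u ` ends e) - card (bad s)"
      by (simp add: cd_def of_nat_diff)
    then show ?thesis using cb cd_ends[OF b eE] by linarith
  qed
  let ?P = "SIGMA s:extensions x u F. cn (u ` ends e) - bad s"
  let ?g = "\<lambda>(s, a). s(e := a)"
  have gi: "inj_on ?g ?P"
  proof (rule inj_onI, clarify)
    fix s a s' a' assume s: "s \<in> extensions x u F" "s' \<in> extensions x u F" and eq: "s(e := a) = s'(e := a')"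
    have "s e = undefined" "s' e = undefined"
      using s insert.hyps unfolding extensions_def by (auto intro: PiE_arb)
    moreover have "s k = s' k" if "k \<noteq> e" for k using fun_cong[OF eq, of k] that by simp
    ultimately have "s = s'" by (metis ext)
    moreover have "a = a'" using fun_cong[OF eq, of e] by simp
    ultimately show "s = s' \<and> a = a'" by blast
  qed
  have gs: "?g ` ?P \<subseteq> extensions x u (insert e F)"
  proof clarify
    fix s a assume s: "s \<in> extensions x u F" and a: "a \<in> cn (u ` ends e)" "a \<notin> bad s"
    have sP: "s \<in> (\<Pi>\<^sub>E e\<in>F. cn (u ` ends e))" and sinj: "inj_on (\<alpha> \<circ> s) F"
      and sx: "\<forall>e\<in>F. s e \<noteq> x" and sb: "\<forall>e\<in>F. \<forall>j\<in>V. \<alpha> (s e) \<noteq> \<beta> (u j)"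
      using s unfolding extensions_def by auto
    have ab: "a \<noteq> x" "\<alpha> a \<notin> \<beta> ` u ` V" "\<alpha> a \<notin> \<alpha> ` s ` F" using a unfolding bad_def by auto
    have same: "(s(e := a)) k = s k" if "k \<in> F" for k using that insert.hyps by auto
    have "s(e := a) \<in> (\<Pi>\<^sub>E e\<in>insert e F. cn (u ` ends e))"
      using sP a(1) by (rule fun_upd_in_PiE[rotated, simplified] | auto simp: PiE_iff extensional_def)+
    moreover have "inj_on (\<alpha> \<circ> s(e := a)) (insert e F)"
    proof -
      have "inj_on (\<alpha> \<circ> s(e := a)) F" using sinj same by (auto simp: inj_on_def)
      moreover have "(\<alpha> \<circ> s(e := a)) e \<notin> (\<alpha> \<circ> s(e := a)) ` (F - {e})"
        using ab(3) same by (auto simp: image_iff)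
      ultimately show ?thesis by (simp only: inj_on_insert) auto
    qed
    ultimately show "s(e := a) \<in> extensions x u (insert e F)"
      unfolding extensions_def using sx sb ab same by auto
  qed
  have "(\<Prod>e\<in>insert e F. cd (u ` ends e) / 2) = (\<Prod>e\<in>F. cd (u ` ends e) / 2) * (cd (u ` ends e) / 2)"
    using insert.hyps by (simp add: mult.commute del: prod_dividef)
  also have "\<dots> \<le> real (card (extensions x u F)) * (cd (u ` ends e) / 2)"
    using IH by (intro mult_right_mono) auto
  also have "\<dots> = (\<Sum>s\<in>extensions x u F. cd (u ` ends e) / 2)" by simp
  also have "\<dots> \<le> (\<Sum>s\<in>extensions x u F. real (card (cn (u ` ends e) - bad s)))" by (rule sum_mono) (rule many)
  also have "\<dots> = real (card ?P)"
    using finite_extensions[OF FE] by (subst card_SigmaI) auto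
  also have "\<dots> = real (card (?g ` ?P))" using card_image[OF gi] by simp
  also have "\<dots> \<le> real (card (extensions x u (insert e F)))"
    using gs finite_extensions[OF insert.prems] card_mono by (intro of_nat_mono) blast
  finally show ?case .
qed

lemma copies_weight_lower: "(1 / 2) ^ card E * real (card bases) \<le> (\<Sum>y\<in>copies. wt y)"
proof -
  have eq: "copies = (\<lambda>((x, u), s). (x, u, s)) ` (SIGMA xu:bases. extensions (fst xu) (snd xu) E)"
  proof (intro equalityI subsetI)
    fix y assume y: "y \<in> copies"
    obtain x u s where yy: "y = (x, u, s)" by (cases y)
    have "((x, u), s) \<in> (SIGMA xu:bases. extensions (fst xu) (snd xu) E)"
      using y unfolding yy copies_def homs_def extensions_def by auto
    then show "y \<in> (\<lambda>((x, u), s). (x, u, s)) ` (SIGMA xu:bases. extensions (fst xu) (snd xu) E)"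
      unfolding yy by (rule rev_image_eqI) simp
  qed (auto simp: copies_def homs_def extensions_def)
  have injp: "inj_on (\<lambda>((x, u), s). (x, u, s)) (SIGMA xu:bases. extensions (fst xu) (snd xu) E)"
    by (auto simp: inj_on_def)
  have "(1 / 2) ^ card E * real (card bases) = (\<Sum>xu\<in>bases. (1 / 2) ^ card E)" by simp
  also have "\<dots> \<le> (\<Sum>xu\<in>bases. \<Sum>s\<in>extensions (fst xu) (snd xu) E. wt (fst xu, snd xu, s))"
  proof (rule sum_mono)
    fix xu assume "xu \<in> bases"
    then obtain x u where xu: "xu = (x, u)" "(x, u) \<in> bases" by (cases xu) auto
    have pos: "cd (u ` ends e) > 0" if "e \<in> E" for e using cd_ends[OF xu(2) that] hpos by linarith
    have "(1 / 2) ^ card E = (\<Prod>e\<in>E. (cd (u ` ends e) / 2) * (1 / cd (u ` ends e)))"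
    proof -
      have "(\<Prod>e\<in>E. (cd (u ` ends e) / 2) * (1 / cd (u ` ends e))) = (\<Prod>e\<in>E. 1 / 2)"
        by (rule prod.cong[OF refl]) (use pos in force)
      then show ?thesis by simp
    qed
    also have "\<dots> = (\<Prod>e\<in>E. cd (u ` ends e) / 2) * (\<Prod>e\<in>E. 1 / cd (u ` ends e))"
      by (rule prod.distrib)
    also have "\<dots> \<le> real (card (extensions x u E)) * (\<Prod>e\<in>E. 1 / cd (u ` ends e))"
      using card_extensions[OF xu(2) finE subset_refl] by (intro mult_right_mono prod_nonneg) auto
    also have "\<dots> = (\<Sum>s\<in>extensions x u E. wt (x, u, s))" by simp
    finally show "(1 / 2) ^ card E \<le> (\<Sum>s\<in>extensions (fst xu) (snd xu) E. wt (fst xu, snd xu, s))"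
      using xu by simp
  qed
  also have "\<dots> = (\<Sum>y\<in>copies. wt y)"
    unfolding eq sum.reindex[OF injp] using finite_bases finite_extensions[OF subset_refl]
    by (subst sum.Sigma) (auto simp: split_beta)
  finally show ?thesis .
qed

text \<open>A pair that is not good is either degenerate, which accounts for \<open>card \<Gamma>\<close> triples, or has codegree
less than \<open>h\<close> and thus lies in less than \<open>h\<close> triples.\<close>

lemma card_bad_triples:
  "real (card {(x, b, b'). x \<in> A \<and> b \<in> nb x \<and> b' \<in> nb x \<and> \<not> good b b'})
     \<le> real (card \<Gamma>) + (real (card B))\<^sup>2 * h"
proof -
  let ?Z1 = "(\<lambda>(x, b). (x, b, b)) ` \<Gamma>"
  let ?Y = "{bb \<in> B \<times> B. cd {fst bb, snd bb} < h}"
  let ?Z2 = "\<Union>bb\<in>?Y. (\<lambda>x. (x, fst bb, snd bb)) ` cn {fst bb, snd bb}"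
  have finG: "finite \<Gamma>" using Gam finA finB finite_subset by blast
  have finY: "finite ?Y" using finB by auto
  have "{(x, b, b'). x \<in> A \<and> b \<in> nb x \<and> b' \<in> nb x \<and> \<not> good b b'} \<subseteq> ?Z1 \<union> ?Z2"
  proof clarify
    fix x b b' assume "x \<in> A" "b \<in> nb x" "b' \<in> nb x" "\<not> good b b'" and n2: "(x, b, b') \<notin> ?Z2"
    show "(x, b, b') \<in> ?Z1"
    proof (cases "b = b'")
      case True
      then show ?thesis using \<open>b \<in> nb x\<close> by (force simp: nb_def)
    next
      case False
      then have "cd {b, b'} < h" using \<open>\<not> good b b'\<close> by (auto simp: good_def)
      moreover have "b \<in> B" "b' \<in> B" using nb_sub \<open>b \<in> nb x\<close> \<open>b' \<in> nb x\<close> by blast+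
      moreover have "x \<in> cn {b, b'}" using \<open>x \<in> A\<close> \<open>b \<in> nb x\<close> \<open>b' \<in> nb x\<close> by (auto simp: cn_def nb_def)
      ultimately show ?thesis using n2 by force
    qed
  qed
  then have "card {(x, b, b'). x \<in> A \<and> b \<in> nb x \<and> b' \<in> nb x \<and> \<not> good b b'} \<le> card (?Z1 \<union> ?Z2)"
    using finG finY by (intro card_mono) auto
  also have "\<dots> \<le> card ?Z1 + card ?Z2" by (rule card_Un_le)
  also have "card ?Z1 \<le> card \<Gamma>" using finG by (rule card_image_le)
  also have "card ?Z2 \<le> (\<Sum>bb\<in>?Y. card ((\<lambda>x. (x, fst bb, snd bb)) ` cn {fst bb, snd bb}))"
    using finY by (rule card_UN_le)
  finally have "real (card {(x, b, b'). x \<in> A \<and> b \<in> nb x \<and> b' \<in> nb x \<and> \<not> good b b'})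
     \<le> real (card \<Gamma>) + real (\<Sum>bb\<in>?Y. card ((\<lambda>x. (x, fst bb, snd bb)) ` cn {fst bb, snd bb}))" by linarith
  also have "real (\<Sum>bb\<in>?Y. card ((\<lambda>x. (x, fst bb, snd bb)) ` cn {fst bb, snd bb})) \<le> (\<Sum>bb\<in>?Y. h)"
    unfolding of_nat_sum
  proof (rule sum_mono)
    fix bb assume bb: "bb \<in> ?Y"
    have "card ((\<lambda>x. (x, fst bb, snd bb)) ` cn {fst bb, snd bb}) \<le> card (cn {fst bb, snd bb})"
      by (rule card_image_le) simp
    then show "real (card ((\<lambda>x. (x, fst bb, snd bb)) ` cn {fst bb, snd bb})) \<le> h"
      using bb by (simp add: cd_def)
  qed
  also have "\<dots> \<le> (real (card B))\<^sup>2 * h"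
  proof -
    have "card ?Y \<le> card (B \<times> B)" using finB by (intro card_mono) auto
    then have "real (card ?Y) \<le> (real (card B))\<^sup>2" by (simp add: card_cartesian_product power2_eq_square flip: of_nat_mult)
    then show ?thesis using hpos by (simp add: mult_right_mono)
  qed
  finally show ?thesis by simp
qed

text \<open>All maps of the branch vertices into the neighbourhood of some \<open>x\<close>, except those with a bad pair.\<close>

lemma card_bases_lower:
  assumes v2: "card V \<ge> 2"
  shows "(\<Sum>x\<in>A. real (card (nb x)) ^ card V)
    \<le> real (card bases) + (real (card V))\<^sup>2 * (real t ^ (card V - 2) * (real (card \<Gamma>) + (real (card B))\<^sup>2 * h))"
proof -
  let ?Z = "{(x, b, b'). x \<in> A \<and> b \<in> nb x \<and> b' \<in> nb x \<and> \<not> good b b'}"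
  let ?b = "real t ^ (card V - 2) * (real (card \<Gamma>) + (real (card B))\<^sup>2 * h)"
  let ?All = "SIGMA x:A. V \<rightarrow>\<^sub>E nb x"
  let ?J = "{ij \<in> V \<times> V. fst ij \<noteq> snd ij}"
  let ?Bad = "\<lambda>ij. {(x, u) \<in> ?All. \<not> good (u (fst ij)) (u (snd ij))}"
  have finAll: "finite ?All" using finA finV by (intro finite_SigmaI finite_PiE) auto
  have finZ: "finite ?Z"
  proof (rule finite_subset)
    show "?Z \<subseteq> A \<times> B \<times> B" using nb_sub by auto
  qed (use finA finB in auto)
  have finJ: "finite ?J" using finV by auto
  have finBad: "finite (?Bad ij)" for ij using finAll by (rule finite_subset[rotated]) auto
  have bad: "real (card (?Bad ij)) \<le> ?b" if ij: "ij \<in> ?J" for ij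
  proof -
    obtain i j where e: "ij = (i, j)" "i \<in> V" "j \<in> V" "i \<noteq> j" using ij by (cases ij) auto
    let ?g = "\<lambda>(x, u). ((x, u i, u j), restrict u (V - {i, j}))"
    let ?T = "SIGMA z:?Z. (V - {i, j}) \<rightarrow>\<^sub>E nb (fst z)"
    have gi: "inj_on ?g (?Bad ij)"
    proof (rule inj_onI)
      fix p p' assume p: "p \<in> ?Bad ij" "p' \<in> ?Bad ij" and eq: "?g p = ?g p'"
      obtain x u x' u' where pp: "p = (x, u)" "p' = (x', u')" by (cases p; cases p')
      have u: "u \<in> V \<rightarrow>\<^sub>E nb x" "u' \<in> V \<rightarrow>\<^sub>E nb x'" using p unfolding pp by auto
      have e4: "x = x'" "u i = u' i" "u j = u' j" "restrict u (V - {i, j}) = restrict u' (V - {i, j})"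
        using eq unfolding pp by auto
      have "u k = u' k" for k
        using fun_cong[OF e4(4), of k] e4(2,3) PiE_arb[OF u(1), of k] PiE_arb[OF u(2), of k]
        by (cases "k \<in> V"; cases "k \<in> {i, j}") auto
      then show "p = p'" using e4(1) unfolding pp by auto
    qed
    have gs: "?g ` (?Bad ij) \<subseteq> ?T"
    proof
      fix z assume "z \<in> ?g ` (?Bad ij)"
      then obtain x u where z: "z = ((x, u i, u j), restrict u (V - {i, j}))"
        and x: "x \<in> A" and u: "u \<in> V \<rightarrow>\<^sub>E nb x" and ng: "\<not> good (u i) (u j)"
        using e(1) by auto
      have "u i \<in> nb x" "u j \<in> nb x" using u e by auto
      moreover have "restrict u (V - {i, j}) \<in> (V - {i, j}) \<rightarrow>\<^sub>E nb x" using u by auto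
      ultimately show "z \<in> ?T" unfolding z using x ng by auto
    qed
    have finT: "finite ?T" using finZ finV by (intro finite_SigmaI finite_PiE) auto
    have "card (?Bad ij) = card (?g ` (?Bad ij))" using card_image[OF gi] by simp
    also have "\<dots> \<le> card ?T" using gs finT by (rule card_mono[rotated])
    also have "\<dots> = (\<Sum>z\<in>?Z. card ((V - {i, j}) \<rightarrow>\<^sub>E nb (fst z)))"
      using finZ finV by (intro card_SigmaI ballI finite_PiE) auto
    also have "\<dots> \<le> (\<Sum>z\<in>?Z. t ^ (card V - 2))"
    proof (rule sum_mono)
      fix z
      have "card ((V - {i, j}) \<rightarrow>\<^sub>E nb (fst z)) = card (nb (fst z)) ^ card (V - {i, j})"
        using finV by (simp add: card_PiE)
      also have "card (V - {i, j}) = card V - 2" using e finV by (simp add: card_Diff_subset)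
      also have "card (nb (fst z)) ^ (card V - 2) \<le> t ^ (card V - 2)" using card_nb by (rule power_mono) simp
      finally show "card ((V - {i, j}) \<rightarrow>\<^sub>E nb (fst z)) \<le> t ^ (card V - 2)" .
    qed
    also have "\<dots> = card ?Z * t ^ (card V - 2)" by simp
    finally have "real (card (?Bad ij)) \<le> real (card ?Z * t ^ (card V - 2))" by (rule of_nat_mono)
    also have "\<dots> = real t ^ (card V - 2) * real (card ?Z)" by simp
    also have "\<dots> \<le> ?b" using card_bad_triples by (intro mult_left_mono) auto
    finally show ?thesis .
  qed
  have cover: "?All \<subseteq> bases \<union> (\<Union>ij\<in>?J. ?Bad ij)"
  proof clarify
    fix x u assume x: "x \<in> A" "u \<in> V \<rightarrow>\<^sub>E nb x" and nb: "(x, u) \<notin> (\<Union>ij\<in>?J. ?Bad ij)"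
    have "good (u i) (u j)" if "i \<in> V" "j \<in> V" "i \<noteq> j" for i j
    proof (rule ccontr)
      assume "\<not> good (u i) (u j)"
      then have "(x, u) \<in> ?Bad (i, j)" using x by auto
      moreover have "(i, j) \<in> ?J" using that by auto
      ultimately show False using nb by blast
    qed
    then show "(x, u) \<in> bases" unfolding bases_def using x by auto
  qed
  have "(\<Sum>x\<in>A. real (card (nb x)) ^ card V) = real (card ?All)"
    using finA finV by (subst card_SigmaI) (auto intro!: finite_PiE simp: card_PiE)
  also have "\<dots> \<le> real (card (bases \<union> (\<Union>ij\<in>?J. ?Bad ij)))"
    using cover finite_bases finJ finBad by (intro of_nat_mono card_mono) auto
  also have "\<dots> \<le> real (card bases + (\<Sum>ij\<in>?J. card (?Bad ij)))"
    using card_Un_le[of bases "\<Union>ij\<in>?J. ?Bad ij"] card_UN_le[OF finJ, of ?Bad] by linarith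
  also have "\<dots> = real (card bases) + (\<Sum>ij\<in>?J. real (card (?Bad ij)))" by simp
  also have "(\<Sum>ij\<in>?J. real (card (?Bad ij))) \<le> (\<Sum>ij\<in>?J. ?b)" by (rule sum_mono) (rule bad)
  also have "\<dots> = real (card ?J) * ?b" by simp
  also have "\<dots> \<le> (real (card V))\<^sup>2 * ?b"
  proof (rule mult_right_mono)
    have "card ?J \<le> card (V \<times> V)" using finV by (intro card_mono) auto
    then show "real (card ?J) \<le> (real (card V))\<^sup>2"
      by (simp add: card_cartesian_product power2_eq_square flip: of_nat_mult)
  qed (use hpos in auto)
  finally show ?thesis by simp
qed

end

context dense_arc_system
begin

text \<open>Convexity of \<open>d \<mapsto> d ^ v\<close> in linear form: \<open>d ^ v \<ge> (t / 8) ^ (v - 1) * (d - t / 8)\<close>. Summed over the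
at most \<open>2 n\<close> clones, the subtracted terms amount to at most half of \<open>card \<Gamma> \<ge> n t / 2\<close>. The bad pairs
are negligible if \<open>c\<^sub>0\<close> is small and \<open>t\<close> is large.\<close>

lemma card_bases_dense:
  assumes A: "real (card A) \<le> 2 * n" and B: "real (card B) \<le> 2 * n"
    and w: "n * real t \<le> 2 * real (card \<Gamma>)"
    and c0small: "8 * c\<^sub>0 * (real (card V))\<^sup>2 \<le> (1 / 8) ^ (card V - 1) / 8"
    and tbig: "(real (card V))\<^sup>2 \<le> real t * ((1 / 8) ^ (card V - 1) / 8)"
  shows "(1 / 8) ^ (card V - 1) / 4 * real t ^ (card V - 1) * real (card \<Gamma>) \<le> real (card bases)"
proof -
  define v where "v = card V"
  define g where "g = (1 / 8 :: real) ^ (v - 1)"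
  define w where "w = real (card \<Gamma>)"
  have v: "v \<ge> 2" using v2 by (simp add: v_def)
  have g: "g > 0" by (simp add: g_def)
  have w0: "w \<ge> 0" by (simp add: w_def)
  have finG: "finite \<Gamma>" using Gam finA finB finite_subset by blast
  have sumnb: "(\<Sum>x\<in>A. real (card (nb x))) = w"
  proof -
    have "\<Gamma> = (SIGMA x:A. nb x)" using Gam by (auto simp: nb_def)
    then have "card \<Gamma> = (\<Sum>x\<in>A. card (nb x))" using card_SigmaI[OF finA, of nb] by simp
    then show ?thesis unfolding w_def by simp
  qed
  have pow: "(real t / 8) ^ (v - 1) = real t ^ (v - 1) * g" by (simp add: g_def power_divide)
  have "real t ^ (v - 1) * g * (w / 2) \<le> real t ^ (v - 1) * g * (w - real (card A) * (real t / 8))"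
  proof (intro mult_left_mono)
    have "real (card A) * (real t / 8) \<le> 2 * n * (real t / 8)" using A by (intro mult_right_mono) auto
    also have "\<dots> \<le> w / 2" using w unfolding w_def by simp
    finally show "w / 2 \<le> w - real (card A) * (real t / 8)" by simp
  qed (use g in auto)
  also have "\<dots> = (\<Sum>x\<in>A. (real t / 8) ^ (v - 1) * (real (card (nb x)) - real t / 8))"
    unfolding pow sum_distrib_left[symmetric] sum_subtractf sumnb by simp
  also have "\<dots> \<le> (\<Sum>x\<in>A. real (card (nb x)) ^ v)"
  proof (rule sum_mono)
    fix x
    let ?d = "real (card (nb x))"
    have vv: "v = Suc (v - 1)" using v by simp
    show "(real t / 8) ^ (v - 1) * (?d - real t / 8) \<le> ?d ^ v"
    proof (cases "?d \<ge> real t / 8")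
      case True
      have "(real t / 8) ^ (v - 1) * (?d - real t / 8) \<le> ?d ^ (v - 1) * ?d"
        using True by (intro mult_mono power_mono) auto
      also have "\<dots> = ?d ^ v" by (subst (2) vv) simp
      finally show ?thesis .
    next
      case False
      have "(real t / 8) ^ (v - 1) * (?d - real t / 8) \<le> 0" using False by (intro mult_nonneg_nonpos) auto
      also have "0 \<le> ?d ^ v" by simp
      finally show ?thesis .
    qed
  qed
  also have "\<dots> \<le> real (card bases) + (real v)\<^sup>2 * (real t ^ (v - 2) * (w + (real (card B))\<^sup>2 * h))"
    using card_bases_lower[OF v2] unfolding v_def w_def .
  also have "(real v)\<^sup>2 * (real t ^ (v - 2) * (w + (real (card B))\<^sup>2 * h)) \<le> real t ^ (v - 1) * g * (w / 4)"
  proof -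
    have tv: "real t ^ (v - 1) = real t ^ (v - 2) * real t"
    proof -
      have "v - 1 = Suc (v - 2)" using v by simp
      then show ?thesis by simp
    qed
    have "(real (card B))\<^sup>2 \<le> (2 * n)\<^sup>2" using B by (intro power_mono) auto
    then have "(real (card B))\<^sup>2 * h \<le> (2 * n)\<^sup>2 * h" using hpos by (intro mult_right_mono) auto
    also have "\<dots> = 4 * c\<^sub>0 * real t * (n * real t)" using n by (simp add: h_def power2_eq_square)
    also have "\<dots> \<le> 4 * c\<^sub>0 * real t * (2 * w)" using w c0 unfolding w_def by (intro mult_left_mono) auto
    finally have "(real v)\<^sup>2 * ((real (card B))\<^sup>2 * h) \<le> (real v)\<^sup>2 * (4 * c\<^sub>0 * real t * (2 * w))"
      by (rule mult_left_mono) simp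
    also have "\<dots> = (8 * c\<^sub>0 * (real v)\<^sup>2) * (real t * w)" by simp
    also have "\<dots> \<le> (g / 8) * (real t * w)" using c0small w0 unfolding v_def g_def by (intro mult_right_mono) auto
    finally have 1: "(real v)\<^sup>2 * ((real (card B))\<^sup>2 * h) \<le> (g / 8) * (real t * w)" .
    have 2: "(real v)\<^sup>2 * w \<le> (real t * (g / 8)) * w"
      using tbig w0 unfolding v_def g_def by (intro mult_right_mono) auto
    have "(real v)\<^sup>2 * (real t ^ (v - 2) * (w + (real (card B))\<^sup>2 * h))
       = real t ^ (v - 2) * ((real v)\<^sup>2 * w + (real v)\<^sup>2 * ((real (card B))\<^sup>2 * h))" by (simp add: algebra_simps)
    also have "\<dots> \<le> real t ^ (v - 2) * ((real t * (g / 8)) * w + (g / 8) * (real t * w))"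
      using 1 2 by (intro mult_left_mono add_mono) auto
    also have "\<dots> = real t ^ (v - 1) * g * (w / 4)" unfolding tv by simp
    finally show ?thesis .
  qed
  finally show ?thesis unfolding v_def[symmetric] g_def[symmetric] w_def[symmetric] by (simp add: algebra_simps)
qed

definition link :: "'x \<times> 'y \<Rightarrow> 'v set" where "link = (\<lambda>(x, u). {\<alpha> x, \<beta> u})"
definition image_edges where "image_edges y = link ` arc y ` slots"

lemma copy_arcs:
  assumes y: "y \<in> copies"
  shows "arc y ` slots \<subseteq> \<Gamma>" "inj_on (arc y) slots"
proof -
  obtain x u s where yy: "y = (x, u, s)" by (cases y)
  have b: "(x, u) \<in> bases" and s: "s \<in> (\<Pi>\<^sub>E e\<in>E. cn (u ` ends e))"
    and si: "inj_on (\<alpha> \<circ> s) E" and sx: "\<forall>e\<in>E. s e \<noteq> x"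
    using y unfolding yy copies_def homs_def by auto
  have sg: "(s e, u i) \<in> \<Gamma>" if "e \<in> E" "i \<in> ends e" for e i
    using PiE_mem[OF s that(1)] that(2) unfolding cn_def by auto
  show "arc y ` slots \<subseteq> \<Gamma>" unfolding yy slots_def using basesD(3)[OF b] sg by auto
  have ui: "i = j" if "i \<in> V" "j \<in> V" "u i = u j" for i j
    using basesD(4)[OF b that(1,2)] that(3) unfolding good_def by auto
  have se: "e = e'" if "e \<in> E" "e' \<in> E" "s e = s e'" for e e'
    using inj_onD[OF si _ that(1,2)] that(3) by simp
  have eV: "i \<in> V" if "e \<in> E" "i \<in> ends e" for e i using ends that by blast
  show "inj_on (arc y) slots"
    unfolding yy slots_def
    by (rule inj_onI) (use ui se sx eV in \<open>auto; metis\<close>)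
qed

text \<open>The weight of an edge set is the total weight of the copies with this edge set. The lower bound on
the number of bases bounds the total from below, and \<open>homs_degree_bound\<close> bounds all degrees from
above.\<close>

lemma balanced_weights:
  assumes A: "real (card A) \<le> 2 * n" and B: "real (card B) \<le> 2 * n"
    and w: "n * real t \<le> 2 * real (card \<Gamma>)" and w0: "card \<Gamma> > 0"
    and c0small: "8 * c\<^sub>0 * (real (card V))\<^sup>2 \<le> (1 / 8) ^ (card V - 1) / 8"
    and tbig: "(real (card V))\<^sup>2 \<le> real t * ((1 / 8) ^ (card V - 1) / 8)"
  defines "r \<equiv> card V + 2 * card E"
  defines "K \<equiv> real r ^ r * (1 / c\<^sub>0) ^ card E * (2 ^ card E * 8 ^ (card V - 1) * 4)"
  shows "\<exists>H. (\<forall>\<epsilon>. H \<epsilon> \<ge> 0) \<and> wdeg (link ` \<Gamma>) r H {} > 0 \<and>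
    degs_le (link ` \<Gamma>) r H (\<lambda>j. K * wdeg (link ` \<Gamma>) r H {} / card (link ` \<Gamma>) * \<tau> ^ (j - 1)) \<and>
    (\<forall>\<epsilon>. H \<epsilon> \<noteq> 0 \<longrightarrow> (\<exists>y\<in>copies. \<epsilon> = image_edges y))"
proof -
  define H where "H \<epsilon> = (\<Sum>y | y \<in> copies \<and> image_edges y = \<epsilon>. wt y)" for \<epsilon>
  let ?W = "link ` \<Gamma>"
  have finC: "finite copies" using finite_homs unfolding copies_def by (rule finite_subset[rotated]) auto
  have injl: "inj_on link \<Gamma>" using inj by (simp add: link_def)
  have finG: "finite \<Gamma>" using Gam finA finB finite_subset by blast
  have cW: "card ?W = card \<Gamma>" using card_image[OF injl] .
  have H0: "H \<epsilon> \<ge> 0" for \<epsilon> unfolding H_def by (intro sum_nonneg) (use wt_nonneg in auto)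
  have ie: "image_edges y \<in> [?W]\<^bsup>r\<^esup>" if "y \<in> copies" for y
  proof -
    note c = copy_arcs[OF that]
    have "inj_on link (arc y ` slots)" using inj_on_subset[OF injl c(1)] .
    then have "card (image_edges y) = card slots"
      unfolding image_edges_def by (simp add: card_image c(2))
    then show ?thesis using c(1) finite_slots unfolding nsets_def image_edges_def r_def card_slots by auto
  qed
  have wd: "wdeg ?W r H T = (\<Sum>y | y \<in> copies \<and> T \<subseteq> image_edges y. wt y)" for T
  proof -
    have "wdeg ?W r H T = (\<Sum>\<epsilon> | \<epsilon> \<in> [?W]\<^bsup>r\<^esup> \<and> T \<subseteq> \<epsilon>. \<Sum>y | y \<in> {y \<in> copies. T \<subseteq> image_edges y} \<and> image_edges y = \<epsilon>. wt y)"
      unfolding wdeg_def H_def by (intro sum.cong refl) auto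
    also have "\<dots> = (\<Sum>y | y \<in> copies \<and> T \<subseteq> image_edges y. wt y)"
      by (rule sum.group) (use finC finG ie in auto)
    finally show ?thesis .
  qed
  have tot: "wdeg ?W r H {} \<ge> (1 / 2) ^ card E * ((1 / 8) ^ (card V - 1) / 4 * real t ^ (card V - 1) * real (card \<Gamma>))"
  proof -
    have "(1 / 2) ^ card E * ((1 / 8) ^ (card V - 1) / 4 * real t ^ (card V - 1) * real (card \<Gamma>))
        \<le> (1 / 2) ^ card E * real (card bases)"
      using card_bases_dense[OF A B w c0small tbig] by (intro mult_left_mono) auto
    also have "\<dots> \<le> (\<Sum>y\<in>copies. wt y)" by (rule copies_weight_lower)
    finally show ?thesis unfolding wd by simp
  qed
  have tpos: "real t > 0" using t by simp
  have tot0: "wdeg ?W r H {} > 0"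
  proof -
    have "0 < (1 / 2) ^ card E * ((1 / 8) ^ (card V - 1) / 4 * real t ^ (card V - 1) * real (card \<Gamma>))"
      using tpos w0 by (intro mult_pos_pos) auto
    then show ?thesis using tot by linarith
  qed
  have degs: "wdeg ?W r H T \<le> K * wdeg ?W r H {} / card ?W * \<tau> ^ (card T - 1)"
    if T: "T \<subseteq> ?W" "T \<noteq> {}" for T
  proof -
    define T' where "T' = {a \<in> \<Gamma>. link a \<in> T}"
    have T'im: "link ` T' = T" using T unfolding T'_def by auto
    have T'i: "inj_on link T'" using injl by (rule inj_on_subset) (auto simp: T'_def)
    have cT: "card T' = card T" using card_image[OF T'i] T'im by simp
    have finT': "finite T'" using finG unfolding T'_def by auto
    have T'ne: "T' \<noteq> {}" using T'im T(2) by auto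
    have sub: "{y. y \<in> copies \<and> T \<subseteq> image_edges y} \<subseteq> {y. y \<in> homs \<and> T' \<subseteq> arc y ` slots}"
    proof clarify
      fix x u s assume y: "(x, u, s) \<in> copies" and Ty: "T \<subseteq> image_edges (x, u, s)"
      have "T' \<subseteq> arc (x, u, s) ` slots"
      proof
        fix a assume a: "a \<in> T'"
        then have "link a \<in> link ` arc (x, u, s) ` slots" using Ty unfolding T'_def image_edges_def by auto
        then obtain a' where a': "a' \<in> arc (x, u, s) ` slots" "link a = link a'" by auto
        have "a = a'" using inj_onD[OF injl a'(2)] a a'(1) copy_arcs(1)[OF y] unfolding T'_def by auto
        then show "a \<in> arc (x, u, s) ` slots" using a'(1) by simp
      qed
      then show "(x, u, s) \<in> homs \<and> T' \<subseteq> arc (x, u, s) ` slots" using y unfolding copies_def by auto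
    qed
    have "wdeg ?W r H T \<le> (\<Sum>y | y \<in> homs \<and> T' \<subseteq> arc y ` slots. wt y)"
      unfolding wd by (rule sum_mono2) (use sub finite_homs wt_nonneg in auto)
    also have "\<dots> \<le> real r ^ r * (1 / c\<^sub>0) ^ card E * \<tau> ^ (card T - 1) * real t ^ (card V - 1)"
      using homs_degree_bound[OF T'ne finT'] unfolding card_slots r_def[symmetric] cT .
    also have "\<dots> = K * \<tau> ^ (card T - 1) / real (card \<Gamma>) *
       ((1 / 2) ^ card E * ((1 / 8) ^ (card V - 1) / 4 * real t ^ (card V - 1) * real (card \<Gamma>)))"
      using w0 by (simp add: K_def power_divide)
    also have "\<dots> \<le> K * \<tau> ^ (card T - 1) / real (card \<Gamma>) * wdeg ?W r H {}"
      using tot tau c0 by (intro mult_left_mono) (auto simp: K_def)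
    also have "\<dots> = K * wdeg ?W r H {} / card ?W * \<tau> ^ (card T - 1)" unfolding cW by simp
    finally show ?thesis .
  qed
  have "\<exists>y\<in>copies. \<epsilon> = image_edges y" if "H \<epsilon> \<noteq> 0" for \<epsilon>
  proof -
    have "{y. y \<in> copies \<and> image_edges y = \<epsilon>} \<noteq> {}" using that unfolding H_def by (metis sum.empty)
    then show ?thesis by blast
  qed
  then show ?thesis using H0 tot0 degs unfolding degs_le_def by (intro exI[of _ H]) blast
qed

end

section \<open>Balanced supersaturation\<close>

text \<open>A set is cut into pieces of at most \<open>t\<close> elements, all of them full except one.\<close>

lemma ex_chunks:
  assumes "finite Y" "t > 0"
  shows "\<exists>c :: 'a \<Rightarrow> nat. (\<forall>k. card {x \<in> Y. c x = k} \<le> t) \<and> (\<forall>x\<in>Y. c x < card Y div t + 1)"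
proof -
  obtain g where g: "bij_betw g Y {0..<card Y}" using ex_bij_betw_finite_nat[OF assms(1)] by blast
  have "card {x \<in> Y. g x div t = k} \<le> t" for k
  proof -
    have "card {x \<in> Y. g x div t = k} \<le> card {k * t..<k * t + t}"
    proof (rule card_inj_on_le)
      show "inj_on g {x \<in> Y. g x div t = k}"
        using g unfolding bij_betw_def by (auto intro: inj_on_subset)
      show "g ` {x \<in> Y. g x div t = k} \<subseteq> {k * t..<k * t + t}"
      proof
        fix y assume "y \<in> g ` {x \<in> Y. g x div t = k}"
        then have k: "y div t = k" by auto
        have "y = y div t * t + y mod t" by simp
        moreover have "y mod t < t" using assms(2) by simp
        ultimately show "y \<in> {k * t..<k * t + t}" using k by (metis atLeastLessThan_iff le_add1 nat_add_left_cancel_less)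
      qed
    qed simp
    then show ?thesis by simp
  qed
  moreover have "g x div t < card Y div t + 1" if "x \<in> Y" for x
  proof -
    have "g x < card Y" using g that unfolding bij_betw_def by auto
    then show ?thesis by (simp add: div_le_mono le_imp_less_Suc)
  qed
  ultimately show ?thesis by (intro exI[of _ "\<lambda>x. g x div t"]) auto
qed

text \<open>The number of pieces when every neighbourhood of a graph on \<open>n\<close> vertices is cut in this way.\<close>

lemma card_chunked_le:
  assumes fin: "finite D" and t: "t > 0" and D: "\<And>a b. (a, b) \<in> D \<Longrightarrow> a < n"
    and c: "\<And>a b. (a, b) \<in> D \<Longrightarrow> c a b < card {b. (a, b) \<in> D} div t + 1"
  shows "real (card ((\<lambda>(a, b). (a, c a b)) ` D)) \<le> real n + real (card D) / real t"
proof -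
  let ?O = "\<lambda>a. {b. (a, b) \<in> D}"
  have finO: "finite (?O a)" for a
    by (rule finite_subset[OF _ finite_imageI[OF fin, of snd]]) force
  have "(\<lambda>(a, b). (a, c a b)) ` D \<subseteq> (SIGMA a:{..<n}. {..<card (?O a) div t + 1})"
    using D c by auto
  then have "card ((\<lambda>(a, b). (a, c a b)) ` D) \<le> card (SIGMA a:{..<n}. {..<card (?O a) div t + 1})"
    by (intro card_mono) auto
  also have "\<dots> = (\<Sum>a<n. card (?O a) div t + 1)" by (subst card_SigmaI) auto
  finally have "real (card ((\<lambda>(a, b). (a, c a b)) ` D)) \<le> real (\<Sum>a<n. card (?O a) div t + 1)"
    by (rule of_nat_mono)
  also have "\<dots> = (\<Sum>a<n. real (card (?O a) div t + 1))" by (rule of_nat_sum)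
  also have "\<dots> \<le> (\<Sum>a<n. real (card (?O a)) / real t + 1)"
  proof (rule sum_mono)
    fix a show "real (card (?O a) div t + 1) \<le> real (card (?O a)) / real t + 1"
      using of_nat_div_le_of_nat[of "card (?O a)" t, where 'a = real] by simp
  qed
  also have "\<dots> = real (\<Sum>a<n. card (?O a)) / real t + real n"
    by (simp add: sum.distrib sum_divide_distrib)
  also have "(\<Sum>a<n. card (?O a)) = card (SIGMA a:{..<n}. ?O a)"
    using finO by (subst card_SigmaI) auto
  also have "(SIGMA a:{..<n}. ?O a) = D" using D by auto
  finally show ?thesis by simp
qed

text \<open>Every graph \<open>W\<close> on \<open>n\<close> vertices with at least \<open>K\<^sub>0 n powr (3/2)\<close> edges carries a balanced weighting
of copies of the graph of the multigraph. Edges are oriented upwards, and the out- and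
in-neighbourhoods of each vertex are cut into pieces of size at most \<open>t \<approx> card W / n\<close>, each piece
belonging to one clone of the vertex. This gives at most \<open>n + card W / t \<le> 2 n\<close> clones on either
side, so that the average degree is still of order \<open>t\<close>. The value
\<open>\<tau> = max (1 / h) (n powr (e / (v - 1 + 2 e)) / t)\<close> makes the two conditions on \<open>\<tau>\<close> hold, and \<open>\<tau> * card W\<close>
is the maximum of the two terms in the statement up to a constant.\<close>

theorem balanced_supersaturation:
  fixes M :: "('i, 'e) multigraph"
  assumes M: "loopless_multigraph M" and e1: "card (medges M) \<ge> 1"
    and bal: "\<And>\<mu>. \<mu> \<subseteq> mverts M \<Longrightarrow> card \<mu> \<ge> 2 \<Longrightarrow>
      card {e \<in> medges M. ends M e \<subseteq> \<mu>} * (card (mverts M) - 1) \<le> card (medges M) * (card \<mu> - 1)"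
  defines "v \<equiv> card (mverts M)" and "e \<equiv> card (medges M)"
  shows "\<exists>K\<^sub>0\<ge>3. \<exists>K>0. \<exists>C>0. \<forall>n W. n \<ge> 1 \<longrightarrow> W \<subseteq> [{..<n}]\<^bsup>2\<^esup> \<longrightarrow>
      real (card W) \<ge> K\<^sub>0 * real n powr (3/2) \<longrightarrow>
      (\<exists>H \<tau>. \<tau> > 0 \<and> \<tau> * real (card W) \<le> C * (real n ^ 3 / real (card W)
              + real n powr (1 + real e / (real v - 1 + 2 * real e))) \<and>
        (\<forall>\<epsilon>. H \<epsilon> \<ge> 0) \<and> wdeg W (v + 2 * e) H {} > 0 \<and>
        degs_le W (v + 2 * e) H (\<lambda>j. K * wdeg W (v + 2 * e) H {} / real (card W) * \<tau> ^ (j - 1)) \<and>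
        (\<forall>I\<subseteq>W. \<not> contains_copy \<lparr>verts = {..<n}, edges = I\<rparr> (F_graph M) \<longrightarrow> windep (v + 2 * e) H I))"
proof -
  let ?V = "mverts M" and ?E = "medges M"
  have finV: "finite ?V" and finE: "finite ?E" and endsM: "\<And>e. e \<in> ?E \<Longrightarrow> ends M e \<subseteq> ?V \<and> card (ends M e) = 2"
    using M unfolding loopless_multigraph_def nsets_def by auto
  obtain e' where "e' \<in> ?E" using e1 by (metis card.empty equals0I not_one_le_zero)
  then have v2: "v \<ge> 2" unfolding v_def using endsM card_mono[OF finV] by metis
  have e1: "e \<ge> 1" using e1 by (simp add: e_def)
  define g where "g = (1 / 8 :: real) ^ (v - 1)"
  define c\<^sub>0 where "c\<^sub>0 = g / (64 * (real v)\<^sup>2)"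
  define h\<^sub>0 where "h\<^sub>0 = 2 * (1 + real v + real e)"
  define K\<^sub>0 where "K\<^sub>0 = 3 + 8 * (real v)\<^sup>2 / g + h\<^sub>0 / c\<^sub>0"
  define r where "r = v + 2 * e"
  define K where "K = real r ^ r * (1 / c\<^sub>0) ^ e * (2 ^ e * 8 ^ (v - 1) * 4)"
  define C where "C = 1 / c\<^sub>0 + 1"
  have g: "0 < g" "g \<le> 1" by (auto simp: g_def intro: power_le_one)
  have v21: "(real v)\<^sup>2 \<ge> 1" using v2 by (intro one_le_power) auto
  have c0: "0 < c\<^sub>0" "c\<^sub>0 \<le> 1"
  proof -
    have "0 < 64 * (real v)\<^sup>2" "g \<le> 64 * (real v)\<^sup>2" using v21 g by linarith+
    then show "0 < c\<^sub>0" "c\<^sub>0 \<le> 1" using g unfolding c\<^sub>0_def by (auto simp: divide_le_eq simp del: zero_less_mult_iff)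
  qed
  have h0: "h\<^sub>0 > 0" unfolding h\<^sub>0_def by (simp add: add_pos_nonneg)
  have K0: "K\<^sub>0 \<ge> 3" "K\<^sub>0 \<ge> 8 * (real v)\<^sup>2 / g" "K\<^sub>0 \<ge> h\<^sub>0 / c\<^sub>0" unfolding K\<^sub>0_def using g c0 h0 by auto
  have r0: "r > 0" using v2 by (simp add: r_def)
  have K: "K > 0" unfolding K_def using c0 r0 by simp
  have C: "C > 0" unfolding C_def using c0 by (simp add: add_pos_pos)
  have "\<exists>H \<tau>. \<tau> > 0 \<and> \<tau> * real (card W) \<le> C * (real n ^ 3 / real (card W)
              + real n powr (1 + real e / (real v - 1 + 2 * real e))) \<and>
        (\<forall>\<epsilon>. H \<epsilon> \<ge> 0) \<and> wdeg W r H {} > 0 \<and>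
        degs_le W r H (\<lambda>j. K * wdeg W r H {} / real (card W) * \<tau> ^ (j - 1)) \<and>
        (\<forall>I\<subseteq>W. \<not> contains_copy \<lparr>verts = {..<n}, edges = I\<rparr> (F_graph M) \<longrightarrow> windep r H I)"
    if n: "n \<ge> 1" and W: "W \<subseteq> [{..<n}]\<^bsup>2\<^esup>" and big: "real (card W) \<ge> K\<^sub>0 * real n powr (3/2)" for n W
  proof -
    define w where "w = real (card W)"
    define t where "t = nat \<lceil>w / real n\<rceil>"
    have n0: "real n \<ge> 1" using n by simp
    have sq: "real n powr (3/2) = real n * sqrt (real n)"
    proof -
      have "real n powr (3/2) = real n powr (1 + 1/2)" by simp
      also have "\<dots> = real n * sqrt (real n)" unfolding powr_add using n0 by (simp add: powr_half_sqrt)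
      finally show ?thesis .
    qed
    have sq1: "sqrt (real n) \<ge> 1" using n0 by simp
    have wn: "w / real n \<ge> K\<^sub>0 * sqrt (real n)"
      using big n0 unfolding w_def sq by (simp add: le_divide_eq mult_ac)
    have K0s: "K\<^sub>0 * sqrt (real n) \<ge> K\<^sub>0" using sq1 K0 by (simp add: mult_le_cancel_left1)
    have tw: "real t \<ge> w / real n" unfolding t_def by linarith
    have wn1: "w / real n \<ge> 1" using wn K0s K0 by linarith
    have tw2: "real t \<le> 2 * (w / real n)"
    proof -
      have "real t \<le> w / real n + 1" unfolding t_def using wn1 by linarith
      then show ?thesis using wn1 by linarith
    qed
    have tK: "real t \<ge> K\<^sub>0" "real t \<ge> K\<^sub>0 * sqrt (real n)" using tw wn K0s by linarith+
    have t1: "real t \<ge> 1" using tK K0 by linarith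
    have tsq: "real t \<ge> sqrt (real n)"
    proof -
      have "1 * sqrt (real n) \<le> K\<^sub>0 * sqrt (real n)" using K0 sq1 by (intro mult_right_mono) auto
      then show ?thesis using tK by linarith
    qed
    have nt: "real n \<le> (real t)\<^sup>2"
      using tsq n0 by (metis real_sqrt_le_iff real_sqrt_unique sqrt_le_D of_nat_0_le_iff)
    have w0: "w > 0" using wn1 n0 by (simp add: le_divide_eq)
    have finW: "finite W" using w0 unfolding w_def by (metis card.infinite of_nat_0 less_irrefl)
    define h where "h = c\<^sub>0 * (real t)\<^sup>2 / real n"
    have hbig: "h \<ge> h\<^sub>0"
    proof -
      have "(K\<^sub>0 * sqrt (real n))\<^sup>2 \<le> (real t)\<^sup>2" using tK K0 sq1 by (intro power_mono) auto
      then have "K\<^sub>0\<^sup>2 * real n \<le> (real t)\<^sup>2" using n0 by (simp add: power_mult_distrib)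
      moreover have "K\<^sub>0 * real n \<le> K\<^sub>0\<^sup>2 * real n" using K0 n0 by (intro mult_right_mono) (auto simp: power2_eq_square)
      ultimately have "K\<^sub>0 * real n \<le> (real t)\<^sup>2" by linarith
      then have "K\<^sub>0 \<le> (real t)\<^sup>2 / real n" using n0 by (simp add: le_divide_eq)
      then have "h\<^sub>0 / c\<^sub>0 \<le> (real t)\<^sup>2 / real n" using K0 by linarith
      then have "c\<^sub>0 * (h\<^sub>0 / c\<^sub>0) \<le> c\<^sub>0 * ((real t)\<^sup>2 / real n)" using c0 by (intro mult_left_mono) auto
      then show ?thesis using c0 by (simp add: h_def)
    qed
    have hp: "h > 0" using hbig h0 by linarith
    have "h\<^sub>0 \<ge> 1" unfolding h\<^sub>0_def by simp
    then have h1: "h \<ge> 1" using hbig by linarith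
    define \<nu> where "\<nu> = real n powr (real e / (real v - 1 + 2 * real e))"
    define \<tau> where "\<tau> = max (1 / h) (\<nu> / real t)"
    have nu0: "\<nu> > 0" using n0 by (simp add: \<nu>_def)
    have tau: "0 < \<tau>" "1 / h \<le> \<tau>" "\<nu> \<le> \<tau> * real t"
    proof -
      show "0 < \<tau>" using hp unfolding \<tau>_def by (simp add: less_max_iff_disj)
      show "1 / h \<le> \<tau>" by (simp add: \<tau>_def)
      have "\<nu> / real t \<le> \<tau>" by (simp add: \<tau>_def)
      then show "\<nu> \<le> \<tau> * real t" using t1 by (simp add: divide_le_eq)
    qed
    have tau1: "\<tau> \<le> 1"
    proof -
      have "real e / (real v - 1 + 2 * real e) \<le> 1/2" using v2 e1 by (simp add: divide_le_eq)
      then have "\<nu> \<le> real n powr (1/2)" unfolding \<nu>_def using n0 by (intro powr_mono) auto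
      also have "\<dots> = sqrt (real n)" using n0 by (simp add: powr_half_sqrt)
      also have "\<dots> \<le> real t" by (rule tsq)
      finally have "\<nu> / real t \<le> 1" using t1 by (simp add: divide_le_eq)
      moreover have "1 / h \<le> 1" using h1 by simp
      ultimately show ?thesis by (simp add: \<tau>_def)
    qed
    \<comment> \<open>One arc for every edge, directed from its smaller to its larger end.\<close>
    define D where "D = {(a, b). a < b \<and> {a, b} \<in> W}"
    have DW: "a < n \<and> b < n" if "(a, b) \<in> D" for a b using that W unfolding D_def nsets_def by auto
    have finD: "finite D" by (rule finite_subset[of _ "{..<n} \<times> {..<n}"]) (use DW in auto)
    have WD: "(\<lambda>(a, b). {a, b}) ` D = W"
    proof (intro equalityI subsetI)
      fix \<epsilon> assume e: "\<epsilon> \<in> W"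
      then obtain a b where ab: "\<epsilon> = {a, b}" "a \<noteq> b" using W unfolding nsets_def by (auto simp: card_2_iff)
      show "\<epsilon> \<in> (\<lambda>(a, b). {a, b}) ` D"
      proof (cases "a < b")
        case True
        then have "(a, b) \<in> D" using e ab by (auto simp: D_def)
        then show ?thesis using ab by force
      next
        case False
        then have "(b, a) \<in> D" using e ab by (auto simp: D_def insert_commute)
        then show ?thesis using ab by (force simp: insert_commute)
      qed
    qed (auto simp: D_def)
    have injD: "inj_on (\<lambda>(a, b). {a, b}) D" unfolding D_def by (auto simp: inj_on_def doubleton_eq_iff)
    have cD: "card D = card W" using card_image[OF injD] WD by simp
    have tpos: "t > 0" using t1 by simp
    have finO: "finite {b. (a, b) \<in> D}" "finite {b. (b, a) \<in> D}" for a
      using DW by (auto intro!: finite_subset[of _ "{..<n}"])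
    have "\<exists>c :: nat \<Rightarrow> nat. (\<forall>k. card {b \<in> {b. (a, b) \<in> D}. c b = k} \<le> t) \<and>
        (\<forall>b\<in>{b. (a, b) \<in> D}. c b < card {b. (a, b) \<in> D} div t + 1)" for a
      by (rule ex_chunks[OF finO(1) tpos])
    then have "\<exists>ca :: nat \<Rightarrow> nat \<Rightarrow> nat. \<forall>a. (\<forall>k. card {b \<in> {b. (a, b) \<in> D}. ca a b = k} \<le> t) \<and>
        (\<forall>b\<in>{b. (a, b) \<in> D}. ca a b < card {b. (a, b) \<in> D} div t + 1)"
      by (intro choice allI)
    then obtain ca :: "nat \<Rightarrow> nat \<Rightarrow> nat" where ca0: "\<forall>a. (\<forall>k. card {b \<in> {b. (a, b) \<in> D}. ca a b = k} \<le> t) \<and>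
        (\<forall>b\<in>{b. (a, b) \<in> D}. ca a b < card {b. (a, b) \<in> D} div t + 1)" by (elim exE) (rule that)
    have ca: "card {b \<in> {b. (a, b) \<in> D}. ca a b = k} \<le> t" for a k using ca0 by simp
    have ca': "ca a b < card {b. (a, b) \<in> D} div t + 1" if "(a, b) \<in> D" for a b using ca0 that by simp
    have "\<exists>c :: nat \<Rightarrow> nat. (\<forall>k. card {b \<in> {b. (b, a) \<in> D}. c b = k} \<le> t) \<and>
        (\<forall>b\<in>{b. (b, a) \<in> D}. c b < card {b. (b, a) \<in> D} div t + 1)" for a
      by (rule ex_chunks[OF finO(2) tpos])
    then have "\<exists>cb :: nat \<Rightarrow> nat \<Rightarrow> nat. \<forall>a. (\<forall>k. card {b \<in> {b. (b, a) \<in> D}. cb a b = k} \<le> t) \<and>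
        (\<forall>b\<in>{b. (b, a) \<in> D}. cb a b < card {b. (b, a) \<in> D} div t + 1)"
      by (intro choice allI)
    then obtain cb :: "nat \<Rightarrow> nat \<Rightarrow> nat" where cb0: "\<forall>a. (\<forall>k. card {b \<in> {b. (b, a) \<in> D}. cb a b = k} \<le> t) \<and>
        (\<forall>b\<in>{b. (b, a) \<in> D}. cb a b < card {b. (b, a) \<in> D} div t + 1)" by (elim exE) (rule that)
    have cb: "card {b \<in> {b. (b, a) \<in> D}. cb a b = k} \<le> t" for a k using cb0 by simp
    have cb': "cb a b < card {b. (b, a) \<in> D} div t + 1" if "(b, a) \<in> D" for a b using cb0 that by simp
    \<comment> \<open>A clone is a pair of a vertex and the number of a piece of its out- or in-neighbourhood.\<close>
    define \<Gamma> where "\<Gamma> = (\<lambda>(a, b). ((a, ca a b), (b, cb b a))) ` D"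
    have comp: "(\<lambda>(x, u). {fst x, fst u}) \<circ> (\<lambda>(a, b). ((a, ca a b), (b, cb b a))) = (\<lambda>(a, b). {a, b})" by auto
    have fstG: "(\<lambda>(x, u). {fst x, fst u}) ` \<Gamma> = W" unfolding \<Gamma>_def image_comp comp WD ..
    have injG: "inj_on (\<lambda>(x, u). {fst x, fst u}) \<Gamma>"
      unfolding \<Gamma>_def by (rule inj_on_imageI) (unfold comp, rule injD)
    have finG: "finite \<Gamma>" using finD by (simp add: \<Gamma>_def)
    have cG: "card \<Gamma> = card W" using card_image[OF injG] fstG by simp
    have "w / real t \<le> real n"
    proof -
      have "w \<le> real t * real n" using tw n0 by (simp add: divide_le_eq)
      then show ?thesis using t1 by (simp add: divide_le_eq mult.commute)
    qed
    note wt = this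
    have cA: "real (card (fst ` \<Gamma>)) \<le> 2 * real n"
    proof -
      have "fst ` \<Gamma> = (\<lambda>(a, b). (a, ca a b)) ` D" unfolding \<Gamma>_def image_comp by (rule image_cong) auto
      moreover have "real (card ((\<lambda>(a, b). (a, ca a b)) ` D)) \<le> real n + real (card D) / real t"
        by (rule card_chunked_le[OF finD tpos]) (use DW ca' in auto)
      ultimately show ?thesis using wt unfolding cD w_def by simp
    qed
    have cB: "real (card (snd ` \<Gamma>)) \<le> 2 * real n"
    proof -
      let ?D' = "{(b, a). (a, b) \<in> D}"
      have D': "?D' = (\<lambda>(a, b). (b, a)) ` D" by auto
      have "inj_on (\<lambda>(a, b). (b, a)) D" by (auto simp: inj_on_def)
      then have cD': "card ?D' = card D" unfolding D' by (rule card_image)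
      have finD': "finite ?D'" unfolding D' using finD by simp
      have "snd ` \<Gamma> = (\<lambda>(a, b). (a, cb a b)) ` ?D'" unfolding \<Gamma>_def D' image_comp by (rule image_cong) auto
      moreover have "real (card ((\<lambda>(a, b). (a, cb a b)) ` ?D')) \<le> real n + real (card ?D') / real t"
        by (rule card_chunked_le[OF finD' tpos]) (use DW cb' in auto)
      ultimately show ?thesis using wt unfolding cD' cD w_def by simp
    qed
    have dA: "card {u. (x, u) \<in> \<Gamma>} \<le> t" for x
    proof -
      have "{u. (x, u) \<in> \<Gamma>} \<subseteq> (\<lambda>b. (b, cb b (fst x))) ` {b \<in> {b. (fst x, b) \<in> D}. ca (fst x) b = snd x}"
        unfolding \<Gamma>_def by (cases x) auto
      moreover have fin: "finite {b \<in> {b. (fst x, b) \<in> D}. ca (fst x) b = snd x}" using finO(1) by simp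
      ultimately have "card {u. (x, u) \<in> \<Gamma>}
          \<le> card ((\<lambda>b. (b, cb b (fst x))) ` {b \<in> {b. (fst x, b) \<in> D}. ca (fst x) b = snd x})"
        by (intro card_mono finite_imageI)
      also have "\<dots> \<le> card {b \<in> {b. (fst x, b) \<in> D}. ca (fst x) b = snd x}" using fin by (rule card_image_le)
      finally have "card {u. (x, u) \<in> \<Gamma>} \<le> card {b \<in> {b. (fst x, b) \<in> D}. ca (fst x) b = snd x}" .
      then show ?thesis using ca le_trans by blast
    qed
    have dB: "card {x. (x, u) \<in> \<Gamma>} \<le> t" for u
    proof -
      have "{x. (x, u) \<in> \<Gamma>} \<subseteq> (\<lambda>b. (b, ca b (fst u))) ` {b \<in> {b. (b, fst u) \<in> D}. cb (fst u) b = snd u}"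
        unfolding \<Gamma>_def by (cases u) auto
      moreover have fin: "finite {b \<in> {b. (b, fst u) \<in> D}. cb (fst u) b = snd u}" using finO(2) by simp
      ultimately have "card {x. (x, u) \<in> \<Gamma>}
          \<le> card ((\<lambda>b. (b, ca b (fst u))) ` {b \<in> {b. (b, fst u) \<in> D}. cb (fst u) b = snd u})"
        by (intro card_mono finite_imageI)
      also have "\<dots> \<le> card {b \<in> {b. (b, fst u) \<in> D}. cb (fst u) b = snd u}" using fin by (rule card_image_le)
      finally have "card {x. (x, u) \<in> \<Gamma>} \<le> card {b \<in> {b. (b, fst u) \<in> D}. cb (fst u) b = snd u}" .
      then show ?thesis using cb le_trans by blast
    qed
    interpret dense_arc_system "fst ` \<Gamma>" "snd ` \<Gamma>" \<Gamma> fst fst t ?V ?E "ends M" h "real n" \<tau> c\<^sub>0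
    proof unfold_locales
      show "2 * (1 + real (card ?V) + real (card ?E)) \<le> h" using hbig by (simp add: h\<^sub>0_def v_def e_def)
      show "\<Gamma> \<subseteq> fst ` \<Gamma> \<times> snd ` \<Gamma>" by (auto simp: image_iff) force+
      show "\<And>x u. (x, u) \<in> \<Gamma> \<Longrightarrow> fst x \<noteq> fst u" unfolding \<Gamma>_def D_def by auto
      show "real n powr (real (card ?E) / (real (card ?V) - 1 + 2 * real (card ?E))) \<le> \<tau> * real t"
        using tau(3) by (simp add: \<nu>_def v_def e_def)
    qed (use finG dA dB injG finV finE endsM n0 t1 nt c0 h_def tau tau1 v2 e1 bal in \<open>auto simp: v_def e_def\<close>)
    have ln: "link = (\<lambda>(x, u). {fst x, fst u})" by (rule link_def)
    have lG: "link ` \<Gamma> = W" unfolding ln by (rule fstG)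
    have "\<exists>H. (\<forall>\<epsilon>. H \<epsilon> \<ge> 0) \<and> wdeg W r H {} > 0 \<and>
      degs_le W r H (\<lambda>j. K * wdeg W r H {} / card W * \<tau> ^ (j - 1)) \<and>
      (\<forall>\<epsilon>. H \<epsilon> \<noteq> 0 \<longrightarrow> (\<exists>y\<in>copies. \<epsilon> = image_edges y))"
      unfolding K_def r_def v_def e_def
    proof (rule balanced_weights[unfolded lG])
      show "real n * real t \<le> 2 * real (card \<Gamma>)"
        using tw2 n0 unfolding cG w_def by (simp add: le_divide_eq mult.commute)
      show "card \<Gamma> > 0" using w0 unfolding cG w_def by simp
      show "8 * c\<^sub>0 * (real (card ?V))\<^sup>2 \<le> (1 / 8) ^ (card ?V - 1) / 8"
        using v21 by (simp add: c\<^sub>0_def g_def v_def)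
      show "(real (card ?V))\<^sup>2 \<le> real t * ((1 / 8) ^ (card ?V - 1) / 8)"
      proof -
        have "8 * (real v)\<^sup>2 / g \<le> real t" using tK K0 by linarith
        then have "8 * (real v)\<^sup>2 \<le> real t * g" using g by (simp add: divide_le_eq)
        then show ?thesis by (simp add: g_def v_def)
      qed
    qed (rule cA cB)+
    then obtain H where H: "\<forall>\<epsilon>. H \<epsilon> \<ge> 0" "wdeg W r H {} > 0"
      "degs_le W r H (\<lambda>j. K * wdeg W r H {} / card W * \<tau> ^ (j - 1))"
      "\<forall>\<epsilon>. H \<epsilon> \<noteq> 0 \<longrightarrow> (\<exists>y\<in>copies. \<epsilon> = image_edges y)" by (elim exE conjE) (rule that)
    have free: "windep r H I" if "I \<subseteq> W" "\<not> contains_copy \<lparr>verts = {..<n}, edges = I\<rparr> (F_graph M)" for I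
      unfolding windep_def
    proof (rule ballI, rule ccontr)
      fix \<epsilon> assume eI: "\<epsilon> \<in> [I]\<^bsup>r\<^esup>" and "H \<epsilon> \<noteq> 0"
      then obtain y where y: "y \<in> copies" "\<epsilon> = image_edges y" using H(4) by blast
      obtain x u s where yy: "y = (x, u, s)" by (cases y)
      have b: "(x, u) \<in> bases" and s: "s \<in> (\<Pi>\<^sub>E e\<in>?E. cn (u ` ends M e))"
        and si: "inj_on (fst \<circ> s) ?E" and sx: "\<forall>e\<in>?E. s e \<noteq> x"
        and sb: "\<forall>e\<in>?E. \<forall>j\<in>?V. fst (s e) \<noteq> fst (u j)"
        using y(1) unfolding yy copies_def homs_def by auto
      have xu: "(x, u i) \<in> \<Gamma>" if "i \<in> ?V" for i using basesD(3)[OF b that] .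
      have su: "(s e, u i) \<in> \<Gamma>" if "e \<in> ?E" "i \<in> ends M e" for e i
        using PiE_mem[OF s that(1)] that(2) unfolding cn_def by auto
      have ee: "link (arc y \<sigma>) \<in> I" if "\<sigma> \<in> slots" for \<sigma>
        using that eI y(2) unfolding image_edges_def nsets_def by auto
      \<comment> \<open>The copy behind an edge of the hypergraph inside \<open>I\<close>.\<close>
      define \<phi> where "\<phi> z = (case z of Branch i \<Rightarrow> fst (u i) | Subdiv e \<Rightarrow> fst (s e) | Apex \<Rightarrow> fst x)" for z
      have ltn: "fst a < n \<and> fst b' < n" if "(a, b') \<in> \<Gamma>" for a b' using that DW unfolding \<Gamma>_def by auto
      have i1: "i = j" if "i \<in> ?V" "j \<in> ?V" "fst (u i) = fst (u j)" for i j
      proof (rule ccontr)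
        assume "i \<noteq> j"
        then have "good (u i) (u j)" using basesD(4)[OF b that(1,2)] by blast
        then have "u i \<noteq> u j" by (simp add: good_def)
        then show False using arc_eqD2[OF xu[OF that(1)] xu[OF that(2)] that(3)] by blast
      qed
      have i2: "e = e'" if "e \<in> ?E" "e' \<in> ?E" "fst (s e) = fst (s e')" for e e'
        using inj_onD[OF si _ that(1,2)] that(3) by simp
      have i3: "fst (s e) \<noteq> fst x" if eE: "e \<in> ?E" for e
      proof
        assume eq: "fst (s e) = fst x"
        obtain i j where "ends M e = {i, j}" "i \<in> ?V" using ends_pair[OF eE] by metis
        then have "(s e, u i) \<in> \<Gamma>" "(x, u i) \<in> \<Gamma>" using su[OF eE, of i] xu by auto
        then have "s e = x" using arc_eqD1 eq by blast
        then show False using sx eE by blast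
      qed
      have i4: "fst x \<noteq> fst (u i)" if "i \<in> ?V" for i using loopfree[OF xu[OF that]] .
      have V0: "?V \<noteq> {}" using v2 unfolding v_def by auto
      have "inj_on \<phi> (verts (F_graph M))"
        unfolding F_graph_def \<phi>_def
        by (rule inj_onI) (use i1 i2 i3 i4 sb in \<open>auto split: F_vertex.splits; metis\<close>)
      moreover have "\<phi> ` verts (F_graph M) \<subseteq> {..<n}"
      proof -
        have "fst x < n" using V0 xu ltn by blast
        moreover have "fst (u i) < n" if "i \<in> ?V" for i using xu[OF that] ltn by blast
        moreover have "fst (s e) < n" if eE: "e \<in> ?E" for e
        proof -
          obtain i j where "ends M e = {i, j}" using ends_pair[OF eE] by metis
          then show ?thesis using su[OF eE, of i] ltn by blast
        qed
        ultimately show ?thesis unfolding F_graph_def \<phi>_def by auto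
      qed
      moreover have "\<phi> ` f \<in> I" if fE: "f \<in> edges (F_graph M)" for f
      proof -
        consider (sub) i e where "e \<in> ?E" "i \<in> ends M e" "f = {Branch i, Subdiv e}"
          | (apex) i where "i \<in> ?V" "f = {Apex, Branch i}"
          using fE unfolding F_graph_def by auto
        then show ?thesis
        proof cases
          case sub
          have "(Some e, i) \<in> slots" using sub unfolding slots_def by auto
          then have "{fst (s e), fst (u i)} \<in> I" using ee[of "(Some e, i)"] unfolding yy ln by simp
          then show ?thesis using sub by (simp add: \<phi>_def insert_commute)
        next
          case apex
          have "(None, i) \<in> slots" using apex unfolding slots_def by auto
          then have "{fst x, fst (u i)} \<in> I" using ee[of "(None, i)"] unfolding yy ln by simp
          then show ?thesis using apex by (simp add: \<phi>_def)
        qed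
      qed
      ultimately have "contains_copy \<lparr>verts = {..<n}, edges = I\<rparr> (F_graph M)"
        unfolding contains_copy_def by (intro exI[of _ \<phi>]) auto
      then show False using that by blast
    qed
    have size: "\<tau> * w \<le> C * (real n ^ 3 / w + real n powr (1 + real e / (real v - 1 + 2 * real e)))"
    proof -
      have "\<tau> * w \<le> (1 / h) * w + (\<nu> / real t) * w"
      proof -
        have "\<tau> \<le> 1 / h + \<nu> / real t" using hp nu0 t1 unfolding \<tau>_def by simp
        then have "\<tau> * w \<le> (1 / h + \<nu> / real t) * w" using w0 by (intro mult_right_mono) auto
        then show ?thesis by (simp add: distrib_right)
      qed
      also have "(\<nu> / real t) * w = \<nu> * (w / real t)" by simp
      also have "\<dots> \<le> \<nu> * real n" using wt nu0 by (intro mult_left_mono) auto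
      also have "\<nu> * real n = real n powr (1 + real e / (real v - 1 + 2 * real e))"
        using n0 by (simp add: \<nu>_def powr_add)
      also have "(1 / h) * w \<le> (1 / c\<^sub>0) * (real n ^ 3 / w)"
      proof -
        have "(w / real n)\<^sup>2 \<le> (real t)\<^sup>2" using tw w0 n0 by (intro power_mono) auto
        then have "c\<^sub>0 * (w / real n)\<^sup>2 / real n \<le> h" unfolding h_def using c0 n0
          by (intro divide_right_mono mult_left_mono) auto
        moreover have "0 < c\<^sub>0 * (w / real n)\<^sup>2 / real n" using c0 w0 n0 by simp
        ultimately have "1 / h \<le> 1 / (c\<^sub>0 * (w / real n)\<^sup>2 / real n)" by (intro frac_le) auto
        then have "1 / h * w \<le> 1 / (c\<^sub>0 * (w / real n)\<^sup>2 / real n) * w" using w0 by (intro mult_right_mono) auto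
        also have "\<dots> = (1 / c\<^sub>0) * (real n ^ 3 / w)"
          using w0 n0 c0 by (simp add: power2_eq_square power3_eq_cube field_simps)
        finally show ?thesis .
      qed
      finally have "\<tau> * w \<le> (1 / c\<^sub>0) * (real n ^ 3 / w) + real n powr (1 + real e / (real v - 1 + 2 * real e))" by simp
      also have "\<dots> \<le> C * (real n ^ 3 / w) + C * real n powr (1 + real e / (real v - 1 + 2 * real e))"
        unfolding C_def using c0 w0 n0 by (intro add_mono mult_right_mono) auto
      finally show ?thesis by (simp add: distrib_left)
    qed
    show ?thesis
      using H tau(1) size free unfolding w_def by (intro exI[of _ H] exI[of _ \<tau>]) blast
  qed
  then show ?thesis using K0(1) K C unfolding r_def by blast
qed

section \<open>Free subgraphs of the binomial random graph\<close>

text \<open>Finite graphs with at least one edge and no isolated vertices. For such \<open>F\<close>, whether a graph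
contains a copy depends on its edge set only.\<close>

definition proper_graph :: "'b graph \<Rightarrow> bool" where
  "proper_graph F \<longleftrightarrow> finite (verts F) \<and> edges F \<subseteq> [verts F]\<^bsup>2\<^esup> \<and> edges F \<noteq> {} \<and>
     (\<forall>x\<in>verts F. \<exists>e\<in>edges F. x \<in> e)"

definition free_edges :: "nat \<Rightarrow> 'b graph \<Rightarrow> nat set set \<Rightarrow> bool" where
  "free_edges n F I \<longleftrightarrow> \<not> contains_copy \<lparr>verts = {..<n}, edges = I\<rparr> F"

definition graph_on :: "nat \<Rightarrow> nat graph \<Rightarrow> bool" where
  "graph_on n G \<longleftrightarrow> verts G = {..<n} \<and> edges G \<subseteq> [{..<n}]\<^bsup>2\<^esup>"

lemma finite_edges: "graph_on n G \<Longrightarrow> finite (edges G)"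
  unfolding graph_on_def using finite_imp_finite_nsets[of "{..<n}" 2] finite_subset by auto

lemma free_edges_mono: "free_edges n F I \<Longrightarrow> J \<subseteq> I \<Longrightarrow> free_edges n F J"
  unfolding free_edges_def contains_copy_def graph.simps by blast

lemma free_edges_empty: "proper_graph F \<Longrightarrow> free_edges n F {}"
  unfolding free_edges_def contains_copy_def proper_graph_def by auto

lemma free_subgraph_iff:
  assumes F: "proper_graph F" and G: "graph_on n G" and H: "subgraph H G"
  shows "contains_copy H F \<longleftrightarrow> \<not> free_edges n F (edges H)"
proof -
  have VH: "verts H \<subseteq> {..<n}" and EH: "edges H \<subseteq> [verts H]\<^bsup>2\<^esup>"
    using H G unfolding subgraph_def simple_graph_def graph_on_def by auto
  have "\<phi> ` verts F \<subseteq> verts H" if ed: "\<forall>e\<in>edges F. \<phi> ` e \<in> edges H" for \<phi>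
  proof
    fix y assume "y \<in> \<phi> ` verts F"
    then obtain x where x: "x \<in> verts F" "y = \<phi> x" by auto
    then obtain e where "e \<in> edges F" "x \<in> e" using F unfolding proper_graph_def by auto
    then have "y \<in> \<phi> ` e" "\<phi> ` e \<in> edges H" using x ed by auto
    then show "y \<in> verts H" using EH unfolding nsets_def by auto
  qed
  then show ?thesis unfolding free_edges_def contains_copy_def using VH by auto
qed

lemma ex_number_Max:
  assumes F: "proper_graph F" and G: "graph_on n G"
  shows "\<exists>I\<subseteq>edges G. free_edges n F I \<and> card I = ex_number G F"
    and "\<And>I. I \<subseteq> edges G \<Longrightarrow> free_edges n F I \<Longrightarrow> card I \<le> ex_number G F"
proof -
  let ?S = "{card (edges H) | H. subgraph H G \<and> \<not> contains_copy H F}"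
  have finE: "finite (edges G)" using finite_edges[OF G] .
  have "?S \<subseteq> {..card (edges G)}"
    using card_mono[OF finE] unfolding subgraph_def by auto
  then have finS: "finite ?S" using finite_subset by blast
  have in_S: "card I \<in> ?S" if "I \<subseteq> edges G" "free_edges n F I" for I
  proof -
    let ?H = "\<lparr>verts = {..<n}, edges = I\<rparr>"
    have "subgraph ?H G" using G that(1) unfolding subgraph_def simple_graph_def graph_on_def by auto
    moreover have "\<not> contains_copy ?H F" using that(2) by (simp add: free_edges_def)
    ultimately show ?thesis by force
  qed
  show "card I \<le> ex_number G F" if "I \<subseteq> edges G" "free_edges n F I" for I
    unfolding ex_number_def using Max_ge[OF finS in_S[OF that]] .
  have "?S \<noteq> {}" using in_S[of "{}"] free_edges_empty[OF F] by blast
  then have "Max ?S \<in> ?S" using Max_in[OF finS] by blast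
  then obtain H where H: "subgraph H G" "\<not> contains_copy H F" "card (edges H) = Max ?S" by auto
  then have "edges H \<subseteq> edges G" "free_edges n F (edges H)"
    using free_subgraph_iff[OF F G H(1)] unfolding subgraph_def by auto
  then show "\<exists>I\<subseteq>edges G. free_edges n F I \<and> card I = ex_number G F"
    using H(3) unfolding ex_number_def by blast
qed

lemma ex_number_le_edges:
  assumes "proper_graph F" "graph_on n G" shows "ex_number G F \<le> card (edges G)"
  using ex_number_Max(1)[OF assms] card_mono[OF finite_edges[OF assms(2)]] by metis

lemma ex_number_mono:
  assumes F: "proper_graph F" and G: "graph_on n G" "graph_on n G'" and sub: "edges G \<subseteq> edges G'"
  shows "ex_number G F \<le> ex_number G' F"
  using ex_number_Max(1)[OF F G(1)] ex_number_Max(2)[OF F G(2)] sub by (metis order_trans)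

text \<open>Deletion method: removing one edge from each copy leaves a graph without copies. \<open>\<T>\<close> is any
collection of edge sets that includes those of all potential copies.\<close>

lemma ex_number_delete:
  assumes F: "proper_graph F" and G: "graph_on n G" and finT: "finite \<T>"
    and T: "\<And>\<phi>. inj_on \<phi> (verts F) \<Longrightarrow> \<phi> ` verts F \<subseteq> {..<n} \<Longrightarrow> (`) \<phi> ` edges F \<in> \<T>"
    and Tne: "\<And>T. T \<in> \<T> \<Longrightarrow> T \<noteq> {}"
  shows "card (edges G) \<le> ex_number G F + card {T \<in> \<T>. T \<subseteq> edges G}"
proof -
  let ?B = "{T \<in> \<T>. T \<subseteq> edges G}"
  let ?X = "(\<lambda>T. SOME e. e \<in> T) ` ?B"
  let ?I = "edges G - ?X"
  have pick: "(SOME e. e \<in> T) \<in> T" if "T \<in> \<T>" for T using Tne[OF that] some_in_eq by blast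
  have "free_edges n F ?I"
    unfolding free_edges_def contains_copy_def
  proof (rule notI, elim exE conjE)
    fix \<phi> assume \<phi>: "inj_on \<phi> (verts F)" "\<phi> ` verts F \<subseteq> verts \<lparr>verts = {..<n}, edges = ?I\<rparr>"
      "\<forall>e\<in>edges F. \<phi> ` e \<in> edges \<lparr>verts = {..<n}, edges = ?I\<rparr>"
    let ?T = "(`) \<phi> ` edges F"
    have "?T \<in> \<T>" using T \<phi>(1,2) by simp
    moreover have TI: "?T \<subseteq> ?I" using \<phi>(3) by auto
    ultimately have "(SOME e. e \<in> ?T) \<in> ?X" by blast
    moreover have "(SOME e. e \<in> ?T) \<in> ?I" using pick[OF \<open>?T \<in> \<T>\<close>] TI by blast
    ultimately show False by blast
  qed
  then have "card ?I \<le> ex_number G F" by (intro ex_number_Max(2)[OF F G]) auto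
  moreover have "card (edges G) \<le> card ?I + card ?X"
  proof -
    have "finite ?X" using finT by simp
    then have "card (edges G) - card ?X \<le> card ?I" by (rule diff_card_le_card_Diff)
    then show ?thesis by linarith
  qed
  moreover have "card ?X \<le> card ?B" using finT by (intro card_image_le) simp
  ultimately show ?thesis by linarith
qed

abbreviation edge_slots :: "nat \<Rightarrow> nat set set" where "edge_slots n \<equiv> [{..<n}]\<^bsup>2\<^esup>"

lemma finite_edge_slots [simp]: "finite (edge_slots n)" by (simp add: finite_imp_finite_nsets)
lemma card_edge_slots: "card (edge_slots n) = n choose 2" by (simp add: card_nsets)

abbreviation coins :: "nat \<Rightarrow> real \<Rightarrow> (nat set \<Rightarrow> bool) pmf" where
  "coins n p \<equiv> Pi_pmf (edge_slots n) False (\<lambda>_. bernoulli_pmf p)"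

definition coin_graph :: "nat \<Rightarrow> (nat set \<Rightarrow> bool) \<Rightarrow> nat graph" where
  "coin_graph n f = \<lparr>verts = {..<n}, edges = {e \<in> edge_slots n. f e}\<rparr>"

lemma gnp_eq: "gnp n p = map_pmf (coin_graph n) (coins n p)"
  unfolding gnp_def coin_graph_def ..

lemma prob_gnp: "measure_pmf.prob (gnp n p) {G. P G} = measure_pmf.prob (coins n p) {f. P (coin_graph n f)}"
  unfolding gnp_eq by (simp add: vimage_def)

lemma graph_on_coin_graph [simp]: "graph_on n (coin_graph n f)"
  by (auto simp: graph_on_def coin_graph_def)

lemma prob_gnp_mono:
  assumes "\<And>G. graph_on n G \<Longrightarrow> P G \<Longrightarrow> Q G"
  shows "measure_pmf.prob (gnp n p) {G. P G} \<le> measure_pmf.prob (gnp n p) {G. Q G}"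
  unfolding prob_gnp by (rule measure_pmf.finite_measure_mono) (use assms in auto)

lemma prob_gnp_contains:
  assumes T: "T \<subseteq> edge_slots n" and p: "0 \<le> p" "p \<le> 1"
  shows "measure_pmf.prob (gnp n p) {G. T \<subseteq> edges G} = p ^ card T"
proof -
  have "measure_pmf.prob (gnp n p) {G. T \<subseteq> edges G}
      = measure_pmf.prob (coins n p) (Pi (edge_slots n) (\<lambda>e. if e \<in> T then {True} else UNIV))"
    unfolding prob_gnp coin_graph_def using T by (intro arg_cong[of _ _ "measure_pmf.prob _"]) (auto simp: Pi_def)
  also have "\<dots> = (\<Prod>e\<in>edge_slots n. if e \<in> T then p else 1)"
    unfolding measure_Pi_pmf_Pi[OF finite_edge_slots]
    by (rule prod.cong[OF refl]) (use p in \<open>auto simp: measure_pmf_single\<close>)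
  also have "\<dots> = p ^ card T"
    using T by (simp add: prod.If_cases Int_absorb1)
  finally show ?thesis .
qed

lemma inclusion_bound_gnp: "0 \<le> p \<Longrightarrow> p \<le> 1 \<Longrightarrow> inclusion_bound (gnp n p) edges (edge_slots n) p"
  unfolding inclusion_bound_def by (simp add: prob_gnp_contains)

text \<open>Coupling: keep each edge of the denser random graph independently with probability \<open>q / p\<close>.\<close>

lemma gnp_monotone:
  assumes p: "0 \<le> q" "q \<le> p" "p \<le> 1"
    and up: "\<And>G G'. graph_on n G \<Longrightarrow> graph_on n G' \<Longrightarrow> edges G \<subseteq> edges G' \<Longrightarrow> P G \<Longrightarrow> P G'"
  shows "measure_pmf.prob (gnp n q) {G. P G} \<le> measure_pmf.prob (gnp n p) {G. P G}"
proof (cases "p = 0")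
  case True
  then show ?thesis using p by simp
next
  case False
  then have p0: "p > 0" using p by linarith
  define r where "r = q / p"
  have r: "0 \<le> r" "r \<le> 1" using p p0 by (auto simp: r_def divide_le_eq)
  let ?B = "pair_pmf (bernoulli_pmf p) (bernoulli_pmf r)"
  let ?D = "Pi_pmf (edge_slots n) (False, False) (\<lambda>_. ?B)"
  have "map_pmf (\<lambda>(a, b). a \<and> b) ?B = bernoulli_pmf q"
  proof (rule pmf_eqI)
    fix x :: bool
    have T: "pmf (map_pmf (\<lambda>(a, b). a \<and> b) ?B) True = q"
    proof -
      have "pmf (map_pmf (\<lambda>(a, b). a \<and> b) ?B) True = measure_pmf.prob ?B {(True, True)}"
        unfolding pmf_map by (intro arg_cong[of _ _ "measure_pmf.prob _"]) auto
      also have "\<dots> = p * r" using p r by (simp add: measure_pmf_single pmf_pair)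
      finally show ?thesis using p0 by (simp add: r_def)
    qed
    then show "pmf (map_pmf (\<lambda>(a, b). a \<and> b) ?B) x = pmf (bernoulli_pmf q) x"
      using p by (cases x) (auto simp: pmf_False_conv_True)
  qed
  then have q_eq: "coins n q = map_pmf (\<lambda>h. (\<lambda>(a, b). a \<and> b) \<circ> h) ?D"
    using Pi_pmf_map[OF finite_edge_slots, of "\<lambda>(a, b). a \<and> b" "(False, False)" False n "\<lambda>_. ?B"] by simp
  have p_eq: "coins n p = map_pmf (\<lambda>h. fst \<circ> h) ?D"
    using Pi_pmf_map[OF finite_edge_slots, of fst "(False, False)" False n "\<lambda>_. ?B"] by (simp add: map_fst_pair_pmf)
  have "measure_pmf.prob (gnp n q) {G. P G} = measure_pmf.prob ?D {h. P (coin_graph n ((\<lambda>(a, b). a \<and> b) \<circ> h))}"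
    unfolding prob_gnp q_eq by (simp add: vimage_def)
  also have "\<dots> \<le> measure_pmf.prob ?D {h. P (coin_graph n (fst \<circ> h))}"
  proof (rule measure_pmf.finite_measure_mono)
    have "edges (coin_graph n ((\<lambda>(a, b). a \<and> b) \<circ> h)) \<subseteq> edges (coin_graph n (fst \<circ> h))" for h
      by (auto simp: coin_graph_def case_prod_beta)
    then show "{h. P (coin_graph n ((\<lambda>(a, b). a \<and> b) \<circ> h))} \<subseteq> {h. P (coin_graph n (fst \<circ> h))}"
      using up[OF graph_on_coin_graph graph_on_coin_graph] by blast
  qed simp
  also have "\<dots> = measure_pmf.prob (gnp n p) {G. P G}"
    unfolding prob_gnp p_eq by (simp add: vimage_def)
  finally show ?thesis .
qed

text \<open>Exponential moments for both tails at once: for \<open>z > 1\<close> the event says that the number of edges is at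
least \<open>z\<close> times its mean, for \<open>z < 1\<close> that it is at most this number.\<close>

lemma gnp_edges_tail:
  fixes z :: real
  assumes p: "0 \<le> p" "p \<le> 1" and z: "z > 0"
  shows "measure_pmf.prob (gnp n p) {G. z powr (z * (p * real (n choose 2))) \<le> z powr real (card (edges G))}
    \<le> exp (p * real (n choose 2) * (z - 1 - z * ln z))"
proof -
  let ?N = "n choose 2"
  let ?c = "z powr (z * (p * real ?N))"
  let ?X = "\<lambda>f. \<Prod>e\<in>edge_slots n. if f e then z else 1"
  have c0: "?c > 0" using z by simp
  have Xeq: "?X f = z powr real (card (edges (coin_graph n f)))" for f
    using z by (simp add: coin_graph_def prod.If_cases powr_realpow Int_def)
  have EX: "measure_pmf.expectation (coins n p) ?X = (1 + p * (z - 1)) ^ ?N"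
  proof -
    have "measure_pmf.expectation (coins n p) ?X
        = (\<Prod>e\<in>edge_slots n. measure_pmf.expectation (bernoulli_pmf p) (\<lambda>b. if b then z else 1))"
      by (rule expectation_prod_Pi_pmf) (use z in \<open>auto intro: integrable_measure_pmf_finite\<close>)
    also have "measure_pmf.expectation (bernoulli_pmf p) (\<lambda>b. if b then z else 1) = 1 + p * (z - 1)"
      using p by (simp add: integral_bernoulli_pmf algebra_simps)
    finally show ?thesis by (simp add: card_edge_slots)
  qed
  have int: "integrable (measure_pmf (coins n p)) ?X"
  proof (rule measure_pmf.integrable_const_bound[where B = "(max z 1) ^ ?N"])
    have "?X f \<le> (max z 1) ^ ?N" for f
    proof -
      have "?X f \<le> (\<Prod>e\<in>edge_slots n. max z 1)" by (rule prod_mono) (use z in auto)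
      then show ?thesis by (simp add: card_edge_slots)
    qed
    moreover have "?X f \<ge> 0" for f using z by (intro prod_nonneg) auto
    ultimately show "AE f in measure_pmf (coins n p). norm (?X f) \<le> (max z 1) ^ ?N" by auto
  qed simp
  have "measure_pmf.prob (gnp n p) {G. ?c \<le> z powr real (card (edges G))}
      = measure_pmf.prob (coins n p) {f \<in> space (measure_pmf (coins n p)). ?X f \<ge> ?c}"
    unfolding prob_gnp Xeq by simp
  also have "\<dots> \<le> measure_pmf.expectation (coins n p) ?X / ?c"
  proof (rule integral_Markov_inequality_measure[where A = "{}"])
    show "AE f in measure_pmf (coins n p). 0 \<le> ?X f" using z by (auto intro!: prod_nonneg)
  qed (use int c0 in auto)
  also have "\<dots> = (1 + p * (z - 1)) ^ ?N / ?c" unfolding EX ..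
  also have "\<dots> \<le> exp (p * (z - 1)) ^ ?N / ?c"
  proof (intro divide_right_mono power_mono)
    have "p * z \<ge> 0" using p z by simp
    then show "0 \<le> 1 + p * (z - 1)" using p by (simp add: algebra_simps)
  qed (use c0 in auto)
  also have "\<dots> = exp (p * real ?N * (z - 1 - z * ln z))"
    using z by (simp add: powr_def exp_of_nat_mult[symmetric] exp_diff[symmetric] algebra_simps)
  finally show ?thesis .
qed

lemma minus_one_less_mult_ln:
  fixes z :: real assumes "z > 0" "z \<noteq> 1" shows "z - 1 - z * ln z < 0"
proof -
  have "ln (1 / z) < 1 / z - 1"
  proof -
    have "ln (1 / z) \<le> 1 / z - 1" using assms by (intro ln_le_minus_one) simp
    moreover have "ln (1 / z) \<noteq> 1 / z - 1" using ln_eq_minus_one[of "1 / z"] assms by auto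
    ultimately show ?thesis by linarith
  qed
  then have "z * ln (1 / z) < z * (1 / z - 1)" using assms by (intro mult_strict_left_mono) auto
  then show ?thesis using assms by (simp add: ln_div algebra_simps)
qed

lemma gnp_edges_concentrated:
  fixes \<epsilon> p :: real and n :: nat
  assumes p: "0 \<le> p" "p \<le> 1" and eps: "0 < \<epsilon>" "\<epsilon> < 1"
  defines "\<mu> \<equiv> p * real (n choose 2)"
  defines "c \<equiv> max (\<epsilon> - (1 + \<epsilon>) * ln (1 + \<epsilon>)) (- \<epsilon> - (1 - \<epsilon>) * ln (1 - \<epsilon>))"
  shows "measure_pmf.prob (gnp n p) {G. \<epsilon> * \<mu> \<le> \<bar>real (card (edges G)) - \<mu>\<bar>} \<le> 2 * exp (c * \<mu>)"
proof -
  have mu0: "\<mu> \<ge> 0" using p by (simp add: \<mu>_def)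
  let ?U = "{G :: nat graph. (1 + \<epsilon>) powr ((1 + \<epsilon>) * \<mu>) \<le> (1 + \<epsilon>) powr real (card (edges G))}"
  let ?L = "{G :: nat graph. (1 - \<epsilon>) powr ((1 - \<epsilon>) * \<mu>) \<le> (1 - \<epsilon>) powr real (card (edges G))}"
  have "{G :: nat graph. \<epsilon> * \<mu> \<le> \<bar>real (card (edges G)) - \<mu>\<bar>} \<subseteq> ?U \<union> ?L"
  proof
    fix G :: "nat graph" assume "G \<in> {G. \<epsilon> * \<mu> \<le> \<bar>real (card (edges G)) - \<mu>\<bar>}"
    then have "(1 + \<epsilon>) * \<mu> \<le> real (card (edges G)) \<or> real (card (edges G)) \<le> (1 - \<epsilon>) * \<mu>"
      by (auto simp: algebra_simps abs_if split: if_splits)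
    then consider "(1 + \<epsilon>) * \<mu> \<le> real (card (edges G))" | "real (card (edges G)) \<le> (1 - \<epsilon>) * \<mu>"
      by blast
    then show "G \<in> ?U \<union> ?L"
    proof cases
      case 1
      then have "G \<in> ?U" using eps by simp
      then show ?thesis by blast
    next
      case 2
      then have "G \<in> ?L" using eps by (simp add: powr_mono')
      then show ?thesis by blast
    qed
  qed
  then have "measure_pmf.prob (gnp n p) {G. \<epsilon> * \<mu> \<le> \<bar>real (card (edges G)) - \<mu>\<bar>}
      \<le> measure_pmf.prob (gnp n p) (?U \<union> ?L)" by (intro measure_pmf.finite_measure_mono) auto
  also have "\<dots> \<le> measure_pmf.prob (gnp n p) ?U + measure_pmf.prob (gnp n p) ?L"
    by (rule measure_Un_le) auto
  also have "measure_pmf.prob (gnp n p) ?U \<le> exp (\<mu> * ((1 + \<epsilon>) - 1 - (1 + \<epsilon>) * ln (1 + \<epsilon>)))"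
    unfolding \<mu>_def by (rule gnp_edges_tail) (use p eps in auto)
  also have "\<dots> \<le> exp (c * \<mu>)" using mu0 by (simp add: c_def mult.commute mult_left_mono)
  also have "measure_pmf.prob (gnp n p) ?L \<le> exp (\<mu> * ((1 - \<epsilon>) - 1 - (1 - \<epsilon>) * ln (1 - \<epsilon>)))"
    unfolding \<mu>_def by (rule gnp_edges_tail) (use p eps in auto)
  also have "\<dots> \<le> exp (c * \<mu>)" using mu0 by (simp add: c_def mult.commute mult_left_mono)
  finally show ?thesis by simp
qed

lemma gnp_copies_markov:
  assumes p: "0 \<le> p" "p \<le> 1" and T: "finite \<T>" "\<And>T. T \<in> \<T> \<Longrightarrow> T \<subseteq> edge_slots n \<and> card T = k" and c: "c > 0"
  shows "measure_pmf.prob (gnp n p) {G. c \<le> real (card {T \<in> \<T>. T \<subseteq> edges G})} \<le> real (card \<T>) * p ^ k / c"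
proof -
  let ?Y = "\<lambda>G :: nat graph. \<Sum>T\<in>\<T>. indicator {G. T \<subseteq> edges G} G :: real"
  have Y: "real (card {T \<in> \<T>. T \<subseteq> edges G}) = ?Y G" for G :: "nat graph"
    using T(1) by (simp add: indicator_def sum.If_cases Int_def)
  have int: "integrable (measure_pmf (gnp n p)) (indicator {G. T \<subseteq> edges G} :: nat graph \<Rightarrow> real)" for T
    by (rule measure_pmf.integrable_const_bound[where B = 1]) (auto simp: indicator_def)
  have "measure_pmf.prob (gnp n p) {G. c \<le> real (card {T \<in> \<T>. T \<subseteq> edges G})}
     = measure_pmf.prob (gnp n p) {G \<in> space (measure_pmf (gnp n p)). ?Y G \<ge> c}" unfolding Y by simp
  also have "\<dots> \<le> measure_pmf.expectation (gnp n p) ?Y / c"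
    by (rule integral_Markov_inequality_measure[where A = "{}"]) (use int c in \<open>auto intro!: sum_nonneg\<close>)
  also have "measure_pmf.expectation (gnp n p) ?Y = (\<Sum>T\<in>\<T>. measure_pmf.prob (gnp n p) {G. T \<subseteq> edges G})"
    using int by (subst Bochner_Integration.integral_sum) auto
  also have "\<dots> = (\<Sum>T\<in>\<T>. p ^ k)" by (rule sum.cong) (use T prob_gnp_contains p in auto)
  finally show ?thesis by simp
qed

lemma container_map_mono:
  assumes "container_map W ind \<delta> c f" "\<And>I. I \<subseteq> W \<Longrightarrow> ind' I \<Longrightarrow> ind I" "c \<le> c'"
  shows "container_map W ind' \<delta> c' f"
  unfolding container_map_def
proof (intro allI impI)
  fix I assume I: "I \<subseteq> W" "ind' I"
  from assms(1)[unfolded container_map_def, rule_format, OF I(1) assms(2)[OF I]]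
  obtain S where S: "S \<subseteq> I" "real (card S) \<le> c" "I \<subseteq> f I \<union> S" "f I \<subseteq> W"
      "real (card (f I)) \<le> (1 - \<delta>) * real (card W)" "\<forall>J. S \<subseteq> J \<and> J \<subseteq> I \<longrightarrow> f J = f I"
    by (elim exE conjE) (rule that)
  have c: "real (card S) \<le> c'" using S(2) assms(3) by linarith
  show "\<exists>S\<subseteq>I. real (card S) \<le> c' \<and> I \<subseteq> f I \<union> S \<and> f I \<subseteq> W \<and>
       real (card (f I)) \<le> (1 - \<delta>) * real (card W) \<and> (\<forall>J. S \<subseteq> J \<and> J \<subseteq> I \<longrightarrow> f J = f I)"
    by (intro exI[of _ S] conjI) (fact S c)+
qed

lemma proper_F_graph:
  assumes M: "loopless_multigraph M" and e1: "card (medges M) \<ge> 1"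
  shows "proper_graph (F_graph M)"
    and "card (verts (F_graph M)) = card (mverts M) + card (medges M) + 1"
    and "card (edges (F_graph M)) = card (mverts M) + 2 * card (medges M)"
proof -
  have finV: "finite (mverts M)" and finE: "finite (medges M)" and ends: "\<And>e. e \<in> medges M \<Longrightarrow> ends M e \<subseteq> mverts M \<and> card (ends M e) = 2"
    using M unfolding loopless_multigraph_def nsets_def by auto
  have fe: "finite (ends M e)" if "e \<in> medges M" for e using ends[OF that] finV finite_subset by blast
  let ?X = "(\<lambda>(e, u). {Branch u, Subdiv e} :: ('a, 'b) F_vertex set) ` (SIGMA e:medges M. ends M e)"
  let ?Y = "(\<lambda>u. {Apex, Branch u} :: ('a, 'b) F_vertex set) ` mverts M"
  have E: "edges (F_graph M) = ?X \<union> ?Y" unfolding F_graph_def by (auto simp: image_iff)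
  have V: "verts (F_graph M) = (Branch ` mverts M \<union> Subdiv ` medges M) \<union> {Apex}" unfolding F_graph_def by simp
  obtain e0 where e0: "e0 \<in> medges M" using e1 by (metis card.empty equals0I not_one_le_zero)
  have "\<exists>f\<in>edges (F_graph M). x \<in> f" if x: "x \<in> verts (F_graph M)" for x
  proof -
    have ne: "\<exists>u. u \<in> ends M e \<and> u \<in> mverts M" if "e \<in> medges M" for e
      using ends[OF that] by (metis card.empty ex_in_conv subsetD zero_neq_numeral)
    show ?thesis
    proof (cases x)
      case (Branch u)
      then have "{Apex, Branch u} \<in> edges (F_graph M)" using x unfolding F_graph_def by auto
      then show ?thesis using Branch by blast
    next
      case (Subdiv e)
      then have "e \<in> medges M" using x unfolding F_graph_def by auto
      then obtain u where "u \<in> ends M e" using ne by blast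
      then have "{Branch u, Subdiv e} \<in> edges (F_graph M)"
        using \<open>e \<in> medges M\<close> unfolding F_graph_def by auto
      then show ?thesis using Subdiv by blast
    next
      case Apex
      obtain u where "u \<in> mverts M" using ne[OF e0] by blast
      then have "{Apex, Branch u} \<in> edges (F_graph M)" unfolding F_graph_def by auto
      then show ?thesis using Apex by blast
    qed
  qed
  moreover have "edges (F_graph M) \<noteq> {}" using e0 ends[OF e0] unfolding E by fastforce
  moreover have "edges (F_graph M) \<subseteq> [verts (F_graph M)]\<^bsup>2\<^esup>"
  proof
    fix f assume "f \<in> edges (F_graph M)"
    then consider (sub) u e where "e \<in> medges M" "u \<in> ends M e" "f = {Branch u, Subdiv e}"
      | (apex) u where "u \<in> mverts M" "f = {Apex, Branch u}" unfolding F_graph_def by auto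
    then show "f \<in> [verts (F_graph M)]\<^bsup>2\<^esup>"
    proof cases
      case sub
      then have "u \<in> mverts M" using ends by blast
      then show ?thesis using sub unfolding F_graph_def by auto
    qed (auto simp: F_graph_def)
  qed
  ultimately show "proper_graph (F_graph M)" unfolding proper_graph_def V using finV finE by auto
  have "card (Branch ` mverts M \<union> Subdiv ` medges M :: ('a, 'b) F_vertex set) = card (mverts M) + card (medges M)"
    using finV finE by (subst card_Un_disjoint) (auto simp: card_image inj_on_def)
  then show "card (verts (F_graph M)) = card (mverts M) + card (medges M) + 1"
    unfolding V using finV finE by (subst card_Un_disjoint) auto
  have "card ?X = card (SIGMA e:medges M. ends M e)"
    by (rule card_image) (auto simp: inj_on_def doubleton_eq_iff)
  also have "\<dots> = (\<Sum>e\<in>medges M. card (ends M e))" using finE fe by (intro card_SigmaI) auto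
  also have "\<dots> = 2 * card (medges M)" using ends by simp
  finally have cX: "card ?X = 2 * card (medges M)" .
  have cY: "card ?Y = card (mverts M)" by (rule card_image) (auto simp: inj_on_def doubleton_eq_iff)
  have "card (?X \<union> ?Y) = card ?X + card ?Y"
    using finV finE fe by (intro card_Un_disjoint) (auto simp: doubleton_eq_iff)
  then show "card (edges (F_graph M)) = card (mverts M) + 2 * card (medges M)" unfolding E cX cY by simp
qed

section \<open>Bipartite graphs without quadrilaterals\<close>

lemma two_eq_0_bit_closure: "(x :: bit alg_closure) + x = 0"
proof -
  have "(1 :: bit) + 1 = 0" by simp
  then have "to_ac (1 :: bit) + to_ac 1 = to_ac 0" by (simp only: to_ac_add[symmetric])
  then have "(1 :: bit alg_closure) + 1 = 0" by (simp only: to_ac_0 to_ac_1)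
  then have "x * (1 + 1) = x * 0" by (rule arg_cong)
  then show ?thesis by (simp only: distrib_left mult_1_right mult_zero_right)
qed

lemma frobenius_add:
  fixes x y :: "bit alg_closure"
  shows "(x + y) ^ (2 ^ r) = x ^ (2 ^ r) + y ^ (2 ^ r)"
proof (induction r)
  case (Suc r)
  have sq: "(a + b) ^ 2 = a ^ 2 + b ^ 2" for a b :: "bit alg_closure"
  proof -
    have "(a + b) ^ 2 = a ^ 2 + b ^ 2 + (a * b + a * b)" by (simp add: power2_eq_square algebra_simps)
    then show ?thesis by (simp only: two_eq_0_bit_closure add_0_right)
  qed
  have "(x + y) ^ (2 ^ Suc r) = ((x + y) ^ (2 ^ r)) ^ 2" by (simp only: power_mult[symmetric] power_Suc2)
  also have "\<dots> = (x ^ (2 ^ r)) ^ 2 + (y ^ (2 ^ r)) ^ 2" unfolding Suc.IH by (rule sq)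
  also have "\<dots> = x ^ (2 ^ Suc r) + y ^ (2 ^ Suc r)" by (simp only: power_mult[symmetric] power_Suc2)
  finally show ?case .
qed simp

text \<open>A field with \<open>2 ^ r\<close> elements, as the set of roots of \<open>X ^ (2 ^ r) - X\<close> in an algebraic closure of
the field with two elements. The roots are simple since the derivative is \<open>-1\<close>, and they are closed
under addition because the \<open>r\<close>-th power of the Frobenius map is additive. Only closure under the
operations is recorded; the field axioms are those of the ambient field.\<close>

lemma ex_finite_subfield:
  assumes r: "r \<ge> 1"
  shows "\<exists>K :: bit alg_closure set. finite K \<and> card K = 2 ^ r \<and> (\<forall>x\<in>K. \<forall>y\<in>K. x + y \<in> K \<and> x * y \<in> K)"
proof -
  define p :: "bit alg_closure poly" where "p = Polynomial.monom 1 (2 ^ r) - Polynomial.monom 1 1"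
  let ?K = "{x :: bit alg_closure. x ^ (2 ^ r) = x}"
  have two: "(2 :: nat) ^ r \<ge> 2" using power_increasing[of 1 r "2::nat"] r by simp
  have root: "poly p x = 0 \<longleftrightarrow> x \<in> ?K" for x by (simp add: p_def poly_monom)
  have deg: "Polynomial.degree p = 2 ^ r"
    unfolding p_def diff_conv_add_uminus using two by (subst degree_add_eq_left) (auto simp: degree_monom_eq)
  have p0: "p \<noteq> 0" using deg two by auto
  have even0: "of_nat (2 ^ r) = (0 :: bit alg_closure)"
  proof -
    obtain k where k: "r = Suc k" using r by (cases r) auto
    have "of_nat (2 ^ r) = (of_nat (2 ^ k) :: bit alg_closure) + of_nat (2 ^ k)" unfolding k by (simp flip: of_nat_add)
    then show ?thesis by (simp only: two_eq_0_bit_closure)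
  qed
  have der: "pderiv p = [:-1:]"
    unfolding p_def pderiv_diff pderiv_monom using even0 by (simp add: monom_0 del: of_nat_power)
  obtain A where A: "size A = Polynomial.degree p" "p = Polynomial.smult (Polynomial.lead_coeff p) (\<Prod>x\<in>#A. [:-x, 1:])"
    using alg_closed_imp_factorization[OF p0] by blast
  have roots: "x \<in># A \<longleftrightarrow> x \<in> ?K" for x
  proof -
    have "poly p x = Polynomial.lead_coeff p * (\<Prod>y\<in>#A. x - y)"
      by (subst A(2)) (simp add: poly_prod_mset image_mset.compositionality o_def)
    moreover have "Polynomial.lead_coeff p \<noteq> 0" using p0 by simp
    ultimately have "poly p x = 0 \<longleftrightarrow> x \<in># A" by (auto simp: prod_mset_zero_iff)
    then show ?thesis using root by simp
  qed
  have simple: "count A x \<le> 1" for x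
  proof (rule ccontr)
    assume "\<not> count A x \<le> 1"
    then have "2 \<le> count A x" by simp
    then have "replicate_mset 2 x \<subseteq># A" by (simp only: count_le_replicate_mset_subset_eq)
    then obtain B where B: "A = replicate_mset 2 x + B" by (metis subset_mset.add_diff_inverse)
    define q where "q = Polynomial.smult (Polynomial.lead_coeff p) (\<Prod>x\<in>#B. [:-x, 1:])"
    have "p = [:-x, 1:] * ([:-x, 1:] * q)"
      by (subst A(2)) (simp add: B q_def numeral_2_eq_2 mult_ac)
    then have "pderiv p = [:-x, 1:] * pderiv ([:-x, 1:] * q) + ([:-x, 1:] * q) * pderiv [:-x, 1:]"
      by (metis pderiv_mult)
    then have "poly (pderiv p) x = 0" by simp
    then show False unfolding der by simp
  qed
  have "A = mset_set ?K"
  proof (rule multiset_eqI)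
    fix x
    have fin: "finite ?K" using poly_roots_finite[OF p0] root by simp
    show "count A x = count (mset_set ?K) x"
    proof (cases "x \<in> ?K")
      case True
      then have "count A x > 0" using roots by simp
      then have "count A x = 1" using simple[of x] by linarith
      then show ?thesis using fin True by simp
    next
      case False
      then have "x \<notin># A" using roots by simp
      then have "count A x = 0" by (simp only: not_in_iff)
      then show ?thesis using fin False by simp
    qed
  qed
  then have card: "card ?K = 2 ^ r" using A(1) deg by simp
  then have fin: "finite ?K" using two by (metis card.infinite not_numeral_le_zero)
  have "x + y \<in> ?K \<and> x * y \<in> ?K" if "x \<in> ?K" "y \<in> ?K" for x y
    using that by (simp add: frobenius_add power_mult_distrib)
  then show ?thesis using fin card by (intro exI[of _ ?K]) blast
qed

text \<open>Incidences between the points \<open>(x, y)\<close> and the lines \<open>y = a x + b\<close> of the affine plane over a field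
with \<open>q\<close> elements: two points lie on at most one common line. The parametrisation by \<open>(x, a, b)\<close> shows
that there are \<open>q ^ 3\<close> incidences.\<close>

theorem ex_quadrilateral_free_bipartite:
  assumes r: "r \<ge> 1"
  defines "q \<equiv> 2 ^ r"
  shows "\<exists>J \<subseteq> {..<q\<^sup>2} \<times> {..<q\<^sup>2 :: nat}. card J = q ^ 3 \<and>
    (\<forall>a a' b b'. (a, b) \<in> J \<longrightarrow> (a, b') \<in> J \<longrightarrow> (a', b) \<in> J \<longrightarrow> (a', b') \<in> J \<longrightarrow> a = a' \<or> b = b')"
proof -
  obtain K :: "bit alg_closure set" where K: "finite K" "card K = q" "\<And>x y. x \<in> K \<Longrightarrow> y \<in> K \<Longrightarrow> x + y \<in> K \<and> x * y \<in> K"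
    using ex_finite_subfield[OF r] unfolding q_def by blast
  have cKK: "card (K \<times> K) = q\<^sup>2" by (simp add: card_cartesian_product K(2) power2_eq_square)
  obtain g where g: "bij_betw g (K \<times> K) {..<q\<^sup>2}"
    using ex_bij_betw_finite_nat[of "K \<times> K"] K(1) cKK by (auto simp: atLeast0LessThan)
  define P where "P = (\<lambda>(x, a, b). (g (x, a * x + b), g (a, b))) ` (K \<times> K \<times> K)"
  have gi: "inj_on g (K \<times> K)" and gr: "g ` (K \<times> K) = {..<q\<^sup>2}" using g by (auto simp: bij_betw_def)
  have ginj: "(x, y) = (x', y')" if "g (x, y) = g (x', y')" "x \<in> K" "y \<in> K" "x' \<in> K" "y' \<in> K" for x y x' y'
    using inj_onD[OF gi that(1)] that(2-) by blast
  have lin: "a * x + b \<in> K" if "x \<in> K" "a \<in> K" "b \<in> K" for x a b using that K(3) by blast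
  have sub: "P \<subseteq> {..<q\<^sup>2} \<times> {..<q\<^sup>2}" unfolding P_def gr[symmetric] using K(3) by auto
  have "inj_on (\<lambda>(x, a, b). (g (x, a * x + b), g (a, b))) (K \<times> K \<times> K)"
  proof (rule inj_onI)
    fix z z' assume z: "z \<in> K \<times> K \<times> K" "z' \<in> K \<times> K \<times> K"
      and eq: "(\<lambda>(x, a, b). (g (x, a * x + b), g (a, b))) z = (\<lambda>(x, a, b). (g (x, a * x + b), g (a, b))) z'"
    obtain x a b x' a' b' where zz: "z = (x, a, b)" "z' = (x', a', b')" by (cases z; cases z') auto
    have K6: "x \<in> K" "a \<in> K" "b \<in> K" "x' \<in> K" "a' \<in> K" "b' \<in> K" using z zz by auto
    have "(x, a * x + b) = (x', a' * x' + b')"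
      by (rule ginj) (use eq K6 lin zz in auto)
    moreover have "(a, b) = (a', b')" by (rule ginj) (use eq K6 zz in auto)
    ultimately show "z = z'" using zz by simp
  qed
  then have "card P = card (K \<times> K \<times> K)" unfolding P_def by (rule card_image)
  then have cP: "card P = q ^ 3" by (simp add: card_cartesian_product K(2) power3_eq_cube)
  have form: "\<exists>x a b. x \<in> K \<and> a \<in> K \<and> b \<in> K \<and> m = g (x, a * x + b) \<and> k = g (a, b)" if "(m, k) \<in> P" for m k
    using that unfolding P_def by auto
  have "m = m' \<or> k = k'" if J: "(m, k) \<in> P" "(m, k') \<in> P" "(m', k) \<in> P" "(m', k') \<in> P" for m m' k k'
  proof -
    obtain x a b where 1: "x \<in> K" "a \<in> K" "b \<in> K" "m = g (x, a * x + b)" "k = g (a, b)" using form[OF J(1)] by blast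
    obtain x2 a2 b2 where 2: "x2 \<in> K" "a2 \<in> K" "b2 \<in> K" "m = g (x2, a2 * x2 + b2)" "k' = g (a2, b2)" using form[OF J(2)] by blast
    obtain x3 a3 b3 where 3: "x3 \<in> K" "a3 \<in> K" "b3 \<in> K" "m' = g (x3, a3 * x3 + b3)" "k = g (a3, b3)" using form[OF J(3)] by blast
    obtain x4 a4 b4 where 4: "x4 \<in> K" "a4 \<in> K" "b4 \<in> K" "m' = g (x4, a4 * x4 + b4)" "k' = g (a4, b4)" using form[OF J(4)] by blast
    have "(x, a * x + b) = (x2, a2 * x2 + b2)"
      by (rule ginj[OF trans[OF 1(4)[symmetric] 2(4)] 1(1) lin[OF 1(1-3)] 2(1) lin[OF 2(1-3)]])
    moreover have "(x3, a3 * x3 + b3) = (x4, a4 * x4 + b4)"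
      by (rule ginj[OF trans[OF 3(4)[symmetric] 4(4)] 3(1) lin[OF 3(1-3)] 4(1) lin[OF 4(1-3)]])
    moreover have "(a, b) = (a3, b3)"
      by (rule ginj[OF trans[OF 1(5)[symmetric] 3(5)] 1(2,3) 3(2,3)])
    moreover have "(a2, b2) = (a4, b4)"
      by (rule ginj[OF trans[OF 2(5)[symmetric] 4(5)] 2(2,3) 4(2,3)])
    ultimately have e: "a * x + b = a2 * x + b2" "a * x3 + b = a2 * x3 + b2" "x2 = x" "x4 = x3" "a3 = a" "b3 = b" by auto
    have "(a - a2) * (x - x3) = (a * x + b) - (a * x3 + b) - ((a2 * x + b2) - (a2 * x3 + b2))" by (simp add: algebra_simps)
    also have "\<dots> = 0" unfolding e by simp
    finally consider "a = a2" | "x = x3" by auto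
    then show ?thesis
    proof cases
      case 1
      then have "b = b2" using e(1) by simp
      then show ?thesis using \<open>a = a2\<close> 1 2 \<open>k = g (a, b)\<close> by simp
    next
      case 2
      then have "m = m'" using \<open>m = g (x, a * x + b)\<close> 3(4) e by simp
      then show ?thesis by simp
    qed
  qed
  then show ?thesis using sub cP by (intro exI[of _ P]) blast
qed

section \<open>Lower bound from a blown-up incidence graph\<close>

text \<open>\<open>J\<close> is a bipartite graph without quadrilaterals, with \<open>N\<close> vertices on either side. Every vertex of \<open>J\<close>
is replaced by a cell of \<open>t\<close> vertices of the random graph, and every edge of \<open>J\<close> becomes a block, the
complete bipartite graph between two cells. In each block those random edges are kept that meet no
other random edge of the block. A quadrilateral of kept edges cannot have two adjacent edges in one
block, so that it would project to a quadrilateral of \<open>J\<close>. For \<open>t \<approx> 1 / p\<close> a block has about \<open>t\<close> random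
edges, and a constant fraction of them is kept.\<close>

locale blown_up_blocks =
  fixes n t N :: nat and J :: "(nat \<times> nat) set" and p :: real
  assumes t: "t \<ge> 1" and J: "J \<subseteq> {..<N} \<times> {..<N}" and size: "2 * N * t \<le> n"
    and quad: "\<And>a a' b b'. (a, b) \<in> J \<Longrightarrow> (a, b') \<in> J \<Longrightarrow> (a', b) \<in> J \<Longrightarrow> (a', b') \<in> J \<Longrightarrow> a = a' \<or> b = b'"
    and p: "0 \<le> p" "p \<le> 1"
begin

text \<open>The indicator \<open>alone z a b\<close> of the event that \<open>{a, b}\<close> is kept is written as a product over the edges of
the block: its expectation then factorises, and it is a measurable function of the edges of the block.\<close>

definition left :: "nat \<Rightarrow> nat set" where "left i = {i * t..<i * t + t}"
definition right :: "nat \<Rightarrow> nat set" where "right j = {(N + j) * t..<(N + j) * t + t}"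
definition block :: "nat \<times> nat \<Rightarrow> nat set set" where
  "block z = (\<lambda>(a, b). {a, b}) ` (left (fst z) \<times> right (snd z))"
definition alone :: "nat \<times> nat \<Rightarrow> nat \<Rightarrow> nat \<Rightarrow> (nat set \<Rightarrow> bool) \<Rightarrow> real" where
  "alone z a b f = (\<Prod>e\<in>block z. if e = {a, b} then of_bool (f e)
     else if e \<inter> {a, b} \<noteq> {} then of_bool (\<not> f e) else 1)"
definition isolated_count :: "nat \<times> nat \<Rightarrow> (nat set \<Rightarrow> bool) \<Rightarrow> real" where
  "isolated_count z f = (\<Sum>(a, b)\<in>left (fst z) \<times> right (snd z). alone z a b f)"
definition kept :: "(nat set \<Rightarrow> bool) \<Rightarrow> nat set set" where
  "kept f = (\<Union>z\<in>J. (\<lambda>(a, b). {a, b}) ` {(a, b) \<in> left (fst z) \<times> right (snd z). alone z a b f \<noteq> 0})"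

lemma finJ: "finite J" using J finite_subset by blast
lemma fin_block [simp]: "finite (block z)" by (simp add: block_def left_def right_def)

lemma left_bound: "i < N \<Longrightarrow> a \<in> left i \<Longrightarrow> a < N * t \<and> a div t = i"
proof -
  assume "i < N" "a \<in> left i"
  then have a: "i * t \<le> a" "a < (i + 1) * t" by (auto simp: left_def)
  then have d: "a div t = i" by (metis add.commute div_nat_eqI mult.commute plus_1_eq_Suc)
  have "(i + 1) * t \<le> N * t" using \<open>i < N\<close> by (intro mult_right_mono) auto
  then show ?thesis using a d by simp
qed

lemma right_bound: "j < N \<Longrightarrow> b \<in> right j \<Longrightarrow> N * t \<le> b \<and> b < n \<and> b div t = N + j"
proof -
  assume "j < N" "b \<in> right j"
  then have b: "(N + j) * t \<le> b" "b < (N + j + 1) * t" by (auto simp: right_def)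
  then have d: "b div t = N + j" by (metis add.commute div_nat_eqI mult.commute plus_1_eq_Suc)
  have "(N + j + 1) * t \<le> (2 * N) * t" using \<open>j < N\<close> by (intro mult_right_mono) auto
  moreover have "N * t \<le> (N + j) * t" by (intro mult_right_mono) auto
  ultimately show ?thesis using b d size by linarith
qed

lemma J_bounds: "z \<in> J \<Longrightarrow> fst z < N \<and> snd z < N" using J by auto

lemma block_slots: "z \<in> J \<Longrightarrow> block z \<subseteq> edge_slots n"
proof
  fix e assume z: "z \<in> J" and "e \<in> block z"
  then obtain a b where ab: "a \<in> left (fst z)" "b \<in> right (snd z)" "e = {a, b}" by (auto simp: block_def)
  have "a < N * t" "N * t \<le> b" "b < n"
    using left_bound[OF _ ab(1)] right_bound[OF _ ab(2)] J_bounds[OF z] by auto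
  then show "e \<in> edge_slots n" using ab(3) by simp
qed

lemma pair_block_unique:
  assumes "z \<in> J" "w \<in> J" "a \<in> left (fst z)" "b \<in> right (snd z)" "a' \<in> left (fst w)" "b' \<in> right (snd w)" "{a, b} = {a', b'}"
  shows "z = w" "a = a'" "b = b'"
proof -
  have bz: "a < N * t" "N * t \<le> b" "a div t = fst z" "b div t = N + snd z"
    using left_bound[OF _ assms(3)] right_bound[OF _ assms(4)] J_bounds[OF assms(1)] by auto
  have bw: "a' < N * t" "N * t \<le> b'" "a' div t = fst w" "b' div t = N + snd w"
    using left_bound[OF _ assms(5)] right_bound[OF _ assms(6)] J_bounds[OF assms(2)] by auto
  show "a = a'" "b = b'" using assms(7) bz(1,2) bw(1,2) by (auto simp: doubleton_eq_iff)
  then show "z = w" using bz(3,4) bw(3,4) by (simp add: prod_eq_iff)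
qed

lemma disjoint_blocks: "disjoint_family_on block J"
  unfolding disjoint_family_on_def
proof (intro ballI impI)
  fix z w assume "z \<in> J" "w \<in> J" "z \<noteq> w"
  show "block z \<inter> block w = {}"
  proof (rule ccontr)
    assume "block z \<inter> block w \<noteq> {}"
    then obtain a b a' b' where "a \<in> left (fst z)" "b \<in> right (snd z)" "a' \<in> left (fst w)" "b' \<in> right (snd w)"
      "{a, b} = {a', b'}" unfolding block_def by auto
    then have "z = w" using pair_block_unique(1)[of z w a b a' b'] \<open>z \<in> J\<close> \<open>w \<in> J\<close> by blast
    then show False using \<open>z \<noteq> w\<close> by blast
  qed
qed

lemma alone_01: "alone z a b f = 0 \<or> alone z a b f = 1"
proof (cases "\<exists>e\<in>block z. (if e = {a, b} then of_bool (f e) else if e \<inter> {a, b} \<noteq> {} then of_bool (\<not> f e) else 1) = (0::real)")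
  case True
  then show ?thesis unfolding alone_def using fin_block[of z] by (simp only: prod_zero_iff) blast
next
  case False
  then have "alone z a b f = (\<Prod>e\<in>block z. 1)"
    unfolding alone_def by (intro prod.cong refl) (auto simp: of_bool_def split: if_splits)
  then show ?thesis by simp
qed

lemma alone_nonneg: "alone z a b f \<ge> 0" using alone_01[of z a b f] by auto

lemma alone_factor:
  assumes "alone z a b f \<noteq> 0" "e \<in> block z"
  shows "e = {a, b} \<Longrightarrow> f e" "e \<noteq> {a, b} \<Longrightarrow> e \<inter> {a, b} \<noteq> {} \<Longrightarrow> \<not> f e"
proof -
  have nz: "(if e = {a, b} then of_bool (f e) else if e \<inter> {a, b} \<noteq> {} then of_bool (\<not> f e) else 1) \<noteq> (0::real)"
  proof
    assume "(if e = {a, b} then of_bool (f e) else if e \<inter> {a, b} \<noteq> {} then of_bool (\<not> f e) else 1) = (0::real)"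
    then have "alone z a b f = 0" unfolding alone_def by (rule prod_zero[OF fin_block bexI]) (rule assms(2))
    then show False using assms(1) by blast
  qed
  show "e = {a, b} \<Longrightarrow> f e" using nz by (simp add: of_bool_def split: if_splits)
  show "e \<noteq> {a, b} \<Longrightarrow> e \<inter> {a, b} \<noteq> {} \<Longrightarrow> \<not> f e" using nz by (simp add: of_bool_def split: if_splits)
qed

lemma alone_unique:
  assumes "alone z a b f \<noteq> 0" "alone z a' b' f \<noteq> 0" "a \<in> left (fst z)" "b \<in> right (snd z)"
    "a' \<in> left (fst z)" "b' \<in> right (snd z)" "a = a' \<or> b = b'"
  shows "{a, b} = {a', b'}"
proof (rule ccontr)
  assume ne: "\<not> ?thesis"
  have "{a', b'} \<in> block z" using assms unfolding block_def by auto
  moreover have "{a', b'} \<inter> {a, b} \<noteq> {}" using assms(7) by auto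
  ultimately have "\<not> f {a', b'}" using alone_factor(2)[OF assms(1)] ne by metis
  moreover have "f {a', b'}" using alone_factor(1)[OF assms(2)] \<open>{a', b'} \<in> block z\<close> by simp
  ultimately show False by blast
qed

lemma isolated_count_card:
  "isolated_count z f = real (card {(a, b) \<in> left (fst z) \<times> right (snd z). alone z a b f \<noteq> 0})"
proof -
  have "isolated_count z f = (\<Sum>y\<in>left (fst z) \<times> right (snd z). if alone z (fst y) (snd y) f \<noteq> 0 then 1 else 0)"
    unfolding isolated_count_def
  proof (rule sum.cong[OF refl])
    fix y assume "y \<in> left (fst z) \<times> right (snd z)"
    show "(case y of (a, b) \<Rightarrow> alone z a b f) = (if alone z (fst y) (snd y) f \<noteq> 0 then 1 else 0)"
      using alone_01[of z "fst y" "snd y" f] by (cases y) auto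
  qed
  also have "\<dots> = real (card {y \<in> left (fst z) \<times> right (snd z). alone z (fst y) (snd y) f \<noteq> 0})"
    by (subst sum.If_cases) (auto simp: left_def right_def Int_def)
  also have "{y \<in> left (fst z) \<times> right (snd z). alone z (fst y) (snd y) f \<noteq> 0}
      = {(a, b) \<in> left (fst z) \<times> right (snd z). alone z a b f \<noteq> 0}" by auto
  finally show ?thesis .
qed

text \<open>Kept edges of one block form a matching.\<close>

lemma isolated_count_le: assumes z: "z \<in> J" shows "isolated_count z f \<le> t"
proof -
  let ?S = "{(a, b) \<in> left (fst z) \<times> right (snd z). alone z a b f \<noteq> 0}"
  have "card ?S \<le> card (left (fst z))"
  proof (rule card_inj_on_le[of fst])
    show "inj_on fst ?S"
    proof (rule inj_onI)
      fix y y' assume y: "y \<in> ?S" "y' \<in> ?S" "fst y = fst y'"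
      have "{fst y, snd y} = {fst y', snd y'}" using alone_unique[of z "fst y" "snd y" f "fst y'" "snd y'"] y by auto
      then have "snd y = snd y'" using pair_block_unique(3)[OF z z, of "fst y" "snd y" "fst y'" "snd y'"] y by auto
      then show "y = y'" using y(3) by (simp add: prod_eq_iff)
    qed
  qed (auto simp: left_def)
  then show ?thesis unfolding isolated_count_card by (simp add: left_def)
qed

lemma kept_sub: "kept f \<subseteq> {e \<in> edge_slots n. f e}"
proof
  fix e assume "e \<in> kept f"
  then obtain z a b where z: "z \<in> J" "a \<in> left (fst z)" "b \<in> right (snd z)" "alone z a b f \<noteq> 0" "e = {a, b}"
    unfolding kept_def by auto
  have "{a, b} \<in> block z" using z unfolding block_def by auto
  then have "f {a, b}" "{a, b} \<in> edge_slots n" using alone_factor(1)[OF z(4)] block_slots[OF z(1)] by blast+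
  then show "e \<in> {e \<in> edge_slots n. f e}" unfolding z(5) by simp
qed

lemma card_kept: "real (card (kept f)) = (\<Sum>z\<in>J. isolated_count z f)"
proof -
  let ?S = "\<lambda>z. {(a, b) \<in> left (fst z) \<times> right (snd z). alone z a b f \<noteq> 0}"
  let ?g = "\<lambda>(a :: nat, b). {a, b}"
  have finS: "finite (?S z)" for z by (rule finite_subset[of _ "left (fst z) \<times> right (snd z)"]) (auto simp: left_def right_def)
  have "card (kept f) = (\<Sum>z\<in>J. card (?g ` ?S z))"
    unfolding kept_def
  proof (rule card_UN_disjoint)
    show "\<forall>z\<in>J. \<forall>w\<in>J. z \<noteq> w \<longrightarrow> ?g ` ?S z \<inter> ?g ` ?S w = {}"
    proof (intro ballI impI)
      fix z w assume zw: "z \<in> J" "w \<in> J" "z \<noteq> w"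
      have sub: "?g ` ?S z \<subseteq> block z" "?g ` ?S w \<subseteq> block w" unfolding block_def by auto
      have d: "block z \<inter> block w = {}"
        using disjoint_blocks zw unfolding disjoint_family_on_def by simp
      have "?g ` ?S z \<inter> ?g ` ?S w \<subseteq> block z \<inter> block w" by (rule Int_mono[OF sub])
      then show "?g ` ?S z \<inter> ?g ` ?S w = {}" unfolding d by (simp only: subset_empty)
    qed
  qed (use finJ finS in auto)
  also have "\<dots> = (\<Sum>z\<in>J. card (?S z))"
  proof (rule sum.cong[OF refl], rule card_image)
    fix z assume z: "z \<in> J"
    show "inj_on ?g (?S z)"
    proof (rule inj_onI)
      fix y y' assume y: "y \<in> ?S z" "y' \<in> ?S z" "?g y = ?g y'"
      then show "y = y'" using pair_block_unique(2,3)[OF z z, of "fst y" "snd y" "fst y'" "snd y'"]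
        by (auto simp: prod_eq_iff split_beta)
    qed
  qed
  finally show ?thesis unfolding isolated_count_card by simp
qed

lemma kept_edge:
  assumes "{x, y} \<in> kept f"
  shows "\<exists>z\<in>J. (x \<in> left (fst z) \<and> y \<in> right (snd z) \<and> alone z x y f \<noteq> 0) \<or>
    (y \<in> left (fst z) \<and> x \<in> right (snd z) \<and> alone z y x f \<noteq> 0)"
proof -
  obtain z a b where z: "z \<in> J" "a \<in> left (fst z)" "b \<in> right (snd z)" "alone z a b f \<noteq> 0" "{x, y} = {a, b}"
    using assms unfolding kept_def by auto
  then show ?thesis by (auto simp: doubleton_eq_iff)
qed

lemma kept_no_quad_left:
  assumes e: "{x, u} \<in> kept f" "{x, w} \<in> kept f" "{s, u} \<in> kept f" "{s, w} \<in> kept f"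
    and x: "x < N * t" and ne: "x \<noteq> s" "u \<noteq> w"
  shows False
proof -
  have side: "\<exists>z\<in>J. y \<in> left (fst z) \<and> v \<in> right (snd z) \<and> alone z y v f \<noteq> 0"
    if "{y, v} \<in> kept f" "y < N * t" for y v
    using kept_edge[OF that(1)] that(2) right_bound J_bounds by (meson leD)
  obtain z1 where z1: "z1 \<in> J" "x \<in> left (fst z1)" "u \<in> right (snd z1)" "alone z1 x u f \<noteq> 0" using side[OF e(1) x] by blast
  obtain z2 where z2: "z2 \<in> J" "x \<in> left (fst z2)" "w \<in> right (snd z2)" "alone z2 x w f \<noteq> 0" using side[OF e(2) x] by blast
  have "N * t \<le> u" using right_bound[OF _ z1(3)] J_bounds[OF z1(1)] by blast
  then have "s < N * t"
    using kept_edge[OF e(3)] left_bound J_bounds by (meson leD)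
  obtain z3 where z3: "z3 \<in> J" "s \<in> left (fst z3)" "u \<in> right (snd z3)" "alone z3 s u f \<noteq> 0" using side[OF e(3) \<open>s < N * t\<close>] by blast
  obtain z4 where z4: "z4 \<in> J" "s \<in> left (fst z4)" "w \<in> right (snd z4)" "alone z4 s w f \<noteq> 0" using side[OF e(4) \<open>s < N * t\<close>] by blast
  have f12: "fst z1 = fst z2" "fst z3 = fst z4"
    using left_bound z1(2) z2(2) z3(2) z4(2) J_bounds z1(1) z2(1) z3(1) z4(1) by metis+
  have s13: "snd z1 = snd z3"
    using right_bound[OF _ z1(3)] right_bound[OF _ z3(3)] J_bounds[OF z1(1)] J_bounds[OF z3(1)] by simp
  have s24: "snd z2 = snd z4"
    using right_bound[OF _ z2(3)] right_bound[OF _ z4(3)] J_bounds[OF z2(1)] J_bounds[OF z4(1)] by simp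
  have "fst z1 = fst z3 \<or> snd z1 = snd z2"
    using quad[of "fst z1" "snd z1" "snd z2" "fst z3"] z1(1) z2(1) z3(1) z4(1) f12 s13 s24 by (metis prod.collapse)
  then show False
  proof
    assume "fst z1 = fst z3"
    then have "z1 = z3" using s13 by (simp add: prod_eq_iff)
    then have "{x, u} = {s, u}" using alone_unique[OF z1(4) _ z1(2,3)] z3 by blast
    then show False using ne(1) by (auto simp: doubleton_eq_iff)
  next
    assume "snd z1 = snd z2"
    then have "z1 = z2" using f12 by (simp add: prod_eq_iff)
    then have "{x, u} = {x, w}" using alone_unique[OF z1(4) _ z1(2,3)] z2 by blast
    then show False using ne(2) by (auto simp: doubleton_eq_iff)
  qed
qed

lemma kept_no_quad:
  assumes e: "{x, u} \<in> kept f" "{x, w} \<in> kept f" "{s, u} \<in> kept f" "{s, w} \<in> kept f"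
    and ne: "x \<noteq> s" "u \<noteq> w"
  shows False
proof (cases "x < N * t")
  case True
  then show False using kept_no_quad_left e ne by blast
next
  case False
  then have "u < N * t" using kept_edge[OF e(1)] left_bound J_bounds by blast
  then show False
    using kept_no_quad_left[of u x f s w] e ne by (simp add: insert_commute)
qed

lemma expectation_alone:
  assumes z: "z \<in> J" and ab: "a \<in> left (fst z)" "b \<in> right (snd z)"
  shows "p * (1 - p) ^ (2 * (t - 1)) \<le> measure_pmf.expectation (coins n p) (alone z a b)"
proof -
  let ?h = "\<lambda>e v. if e \<in> block z then (if e = {a, b} then of_bool v
     else if e \<inter> {a, b} \<noteq> {} then of_bool (\<not> v) else 1) else (1 :: real)"
  let ?X = "{e \<in> block z. e \<noteq> {a, b} \<and> e \<inter> {a, b} \<noteq> {}}"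
  have abB: "{a, b} \<in> block z" using ab unfolding block_def by auto
  have a_eq: "alone z a b f = (\<Prod>e\<in>edge_slots n. ?h e (f e))" for f
    unfolding alone_def by (rule prod.mono_neutral_cong_left) (use block_slots[OF z] in auto)
  have "measure_pmf.expectation (coins n p) (alone z a b)
      = (\<Prod>e\<in>edge_slots n. measure_pmf.expectation (bernoulli_pmf p) (?h e))"
    unfolding a_eq by (rule expectation_prod_Pi_pmf) (auto intro: integrable_measure_pmf_finite)
  also have "\<dots> = (\<Prod>e\<in>edge_slots n. if e \<in> block z then (if e = {a, b} then p else if e \<in> ?X then 1 - p else 1) else 1)"
    by (rule prod.cong[OF refl]) (use p in \<open>auto simp: integral_bernoulli_pmf\<close>)
  also have "\<dots> = (\<Prod>e\<in>block z. if e = {a, b} then p else if e \<in> ?X then 1 - p else 1)"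
    by (rule prod.mono_neutral_cong_right) (use block_slots[OF z] in auto)
  also have "\<dots> = p * (\<Prod>e\<in>block z - {{a, b}}. if e \<in> ?X then 1 - p else 1)"
    by (subst prod.remove[OF fin_block abB]) (auto intro!: prod.cong)
  also have "(\<Prod>e\<in>block z - {{a, b}}. if e \<in> ?X then 1 - p else 1) = (\<Prod>e\<in>?X. 1 - p)"
    by (rule prod.mono_neutral_cong_right) auto
  finally have E: "measure_pmf.expectation (coins n p) (alone z a b) = p * (1 - p) ^ card ?X" by simp
  have "card ?X \<le> card ((\<lambda>a'. {a', b}) ` (left (fst z) - {a}) \<union> (\<lambda>b'. {a, b'}) ` (right (snd z) - {b}))"
  proof (rule card_mono)
    show "?X \<subseteq> (\<lambda>a'. {a', b}) ` (left (fst z) - {a}) \<union> (\<lambda>b'. {a, b'}) ` (right (snd z) - {b})"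
    proof
      fix e assume e: "e \<in> ?X"
      then obtain a' b' where ab': "a' \<in> left (fst z)" "b' \<in> right (snd z)" "e = {a', b'}" unfolding block_def by auto
      have lt: "a < N * t" "a' < N * t" "N * t \<le> b" "N * t \<le> b'"
        using left_bound ab ab' right_bound J_bounds[OF z] by blast+
      then have "a = a' \<or> b = b'" using e ab' by auto
      then show "e \<in> (\<lambda>a'. {a', b}) ` (left (fst z) - {a}) \<union> (\<lambda>b'. {a, b'}) ` (right (snd z) - {b})"
        using e ab' by auto
    qed
  qed (auto simp: left_def right_def)
  also have "\<dots> \<le> card (left (fst z) - {a}) + card (right (snd z) - {b})"
    by (rule order_trans[OF card_Un_le]) (intro add_mono card_image_le; simp add: left_def right_def)
  also have "\<dots> = 2 * (t - 1)" using ab by (simp add: left_def right_def)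
  finally have "card ?X \<le> 2 * (t - 1)" .
  then have "(1 - p) ^ (2 * (t - 1)) \<le> (1 - p) ^ card ?X" using p by (intro power_decreasing) auto
  then show ?thesis unfolding E using p by (intro mult_left_mono) auto
qed

lemma integrable_alone: "integrable (measure_pmf (coins n p)) (alone z a b)"
proof (rule measure_pmf.integrable_const_bound[where B = 1])
  have "norm (alone z a b f) \<le> 1" for f using alone_01[of z a b f] by auto
  then show "AE f in measure_pmf (coins n p). norm (alone z a b f) \<le> 1" by simp
qed simp

lemma expectation_isolated_count:
  assumes z: "z \<in> J"
  shows "real t ^ 2 * (p * (1 - p) ^ (2 * (t - 1))) \<le> measure_pmf.expectation (coins n p) (isolated_count z)"
proof -
  have "isolated_count z = (\<lambda>f. \<Sum>y\<in>left (fst z) \<times> right (snd z). alone z (fst y) (snd y) f)"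
    by (simp add: isolated_count_def split_beta fun_eq_iff)
  then have "measure_pmf.expectation (coins n p) (isolated_count z)
     = (\<Sum>y\<in>left (fst z) \<times> right (snd z). measure_pmf.expectation (coins n p) (alone z (fst y) (snd y)))"
    using integrable_alone by (simp add: Bochner_Integration.integral_sum)
  also have "\<dots> \<ge> (\<Sum>y\<in>left (fst z) \<times> right (snd z). p * (1 - p) ^ (2 * (t - 1)))"
    by (rule sum_mono) (use expectation_alone[OF z] in auto)
  also have "(\<Sum>y\<in>left (fst z) \<times> right (snd z). p * (1 - p) ^ (2 * (t - 1))) = real t ^ 2 * (p * (1 - p) ^ (2 * (t - 1)))"
    by (simp add: card_cartesian_product left_def right_def power2_eq_square)
  finally show ?thesis .
qed

lemma indep_isolated_counts:
  "prob_space.indep_vars (measure_pmf (coins n p)) (\<lambda>_. borel) isolated_count J"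
proof -
  have ind: "prob_space.indep_vars (measure_pmf (coins n p)) (\<lambda>_. count_space UNIV) (\<lambda>e (f :: nat set \<Rightarrow> bool). f e) (edge_slots n)"
    by (rule indep_vars_Pi_pmf) simp
  have "prob_space.indep_vars (measure_pmf (coins n p)) (\<lambda>z. PiM (block z) (\<lambda>_. count_space UNIV)) (\<lambda>z (f :: nat set \<Rightarrow> bool). restrict (\<lambda>e. f e) (block z)) J"
    by (rule prob_space.indep_vars_restrict[OF measure_pmf.prob_space_axioms ind block_slots disjoint_blocks])
  then have "prob_space.indep_vars (measure_pmf (coins n p)) (\<lambda>_. borel) (\<lambda>z (f :: nat set \<Rightarrow> bool). isolated_count z (restrict (\<lambda>e. f e) (block z))) J"
  proof (rule prob_space.indep_vars_compose2[OF measure_pmf.prob_space_axioms])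
    fix z
    have comp: "(\<lambda>f :: nat set \<Rightarrow> bool. f e) \<in> measurable (PiM (block z) (\<lambda>_. count_space UNIV)) (count_space UNIV)"
      if "e \<in> block z" for e using that by (rule measurable_component_singleton)
    have "(\<lambda>f :: nat set \<Rightarrow> bool. if e = {a, b} then of_bool (f e)
        else if e \<inter> {a, b} \<noteq> {} then of_bool (\<not> f e) else (1 :: real)) \<in> borel_measurable (PiM (block z) (\<lambda>_. count_space UNIV))"
      if e: "e \<in> block z" for e a b
      by (rule measurable_compose[OF comp[OF e], of "\<lambda>v. if e = {a, b} then of_bool v
        else if e \<inter> {a, b} \<noteq> {} then of_bool (\<not> v) else (1 :: real)"]) simp
    then have "alone z a b \<in> borel_measurable (PiM (block z) (\<lambda>_. count_space UNIV))" for a b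
      unfolding alone_def[abs_def] by (intro borel_measurable_prod) auto
    then show "isolated_count z \<in> borel_measurable (PiM (block z) (\<lambda>_. count_space UNIV))"
      unfolding isolated_count_def[abs_def] split_beta by (intro borel_measurable_sum) auto
  qed
  moreover have "isolated_count z (restrict (\<lambda>e. f e) (block z)) = isolated_count z f" for z f
    unfolding isolated_count_def alone_def by (intro sum.cong refl) (auto intro!: prod.cong)
  ultimately show ?thesis by simp
qed

text \<open>The numbers of kept edges in different blocks are independent and lie between 0 and \<open>t\<close>, so
Hoeffding's inequality applies to their sum, whose mean is at least \<open>card J * t / 16\<close>.\<close>

lemma kept_large:
  assumes J0: "J \<noteq> {}" and low: "real t / 16 \<le> real t ^ 2 * (p * (1 - p) ^ (2 * (t - 1)))"
  shows "measure_pmf.prob (coins n p) {f. real (card (kept f)) \<le> real (card J) * real t / 32} \<le> exp (- real (card J) / 512)"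
proof -
  define \<mu> where "\<mu> = (\<Sum>z\<in>J. measure_pmf.expectation (coins n p) (isolated_count z))"
  have cJ: "real (card J) > 0" using J0 finJ by (simp add: card_gt_0_iff)
  have "real (card J) * (real t / 16) = (\<Sum>z\<in>J. real t / 16)" by simp
  also have "\<dots> \<le> \<mu>" unfolding \<mu>_def
    by (rule sum_mono) (use low expectation_isolated_count in \<open>meson order_trans\<close>)
  finally have mu: "real (card J) * real t / 16 \<le> \<mu>" by simp
  interpret Hoeffding_ineq "measure_pmf (coins n p)" J isolated_count "\<lambda>_. 0" "\<lambda>_. real t" \<mu>
  proof unfold_locales
    show "finite J" by (rule finJ)
    show "prob_space.indep_vars (measure_pmf (coins n p)) (\<lambda>_. borel) isolated_count J" by (rule indep_isolated_counts)
    show "AE f in measure_pmf (coins n p). isolated_count z f \<in> {0..real t}" if "z \<in> J" for z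
      using isolated_count_le[OF that] unfolding isolated_count_card by (intro AE_pmfI) auto
  qed (simp add: \<mu>_def)
  have S: "(\<Sum>z\<in>J. (real t - 0)\<^sup>2) = real (card J) * (real t)\<^sup>2" by simp
  have S0: "(\<Sum>z\<in>J. (real t - 0)\<^sup>2) > 0" unfolding S using cJ t by simp
  let ?\<epsilon> = "real (card J) * real t / 32"
  have "{f. real (card (kept f)) \<le> ?\<epsilon>} \<subseteq> {f \<in> space (measure_pmf (coins n p)). (\<Sum>z\<in>J. isolated_count z f) \<le> \<mu> - ?\<epsilon>}"
    using mu unfolding card_kept by auto
  then have "measure_pmf.prob (coins n p) {f. real (card (kept f)) \<le> ?\<epsilon>}
      \<le> measure_pmf.prob (coins n p) {f \<in> space (measure_pmf (coins n p)). (\<Sum>z\<in>J. isolated_count z f) \<le> \<mu> - ?\<epsilon>}"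
    by (intro measure_pmf.finite_measure_mono) auto
  also have "\<dots> \<le> exp (- 2 * ?\<epsilon>\<^sup>2 / (\<Sum>z\<in>J. (real t - 0)\<^sup>2))"
    by (rule Hoeffding_ineq_le) (use S0 in auto)
  also have "- 2 * ?\<epsilon>\<^sup>2 / (\<Sum>z\<in>J. (real t - 0)\<^sup>2) = - real (card J) / 512"
    unfolding S using cJ t by (simp add: power2_eq_square field_simps)
  finally show ?thesis .
qed

end

text \<open>Any graph that contains a quadrilateral is avoided by the kept edges. The cell size is
\<open>t = \<lfloor>1 / p\<rfloor>\<close>, and \<open>q = 2 ^ r\<close> is the largest power of two for which the \<open>2 q\<^sup>2\<close> cells fit into \<open>n\<close>
vertices, so that \<open>q\<^sup>2 \<ge> n / (8 t)\<close>. The \<open>q ^ 3\<close> blocks yield about \<open>q ^ 3 * t\<close> edges, which is of the order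
\<open>(n p) powr (3/2) / p = p powr (1/2) * n powr (3/2)\<close>.\<close>

lemma ex_number_gnp_lower:
  assumes pp: "0 < p" "p \<le> 1" and n: "real n * p \<ge> 8"
    and F: "proper_graph F"
    and quadF: "\<exists>x u w s. x \<noteq> s \<and> u \<noteq> w \<and> {x, s, u, w} \<subseteq> verts F \<and>
       {x, u} \<in> edges F \<and> {x, w} \<in> edges F \<and> {s, u} \<in> edges F \<and> {s, w} \<in> edges F"
  shows "1 - exp (- ((real n * p / 8) powr (3/2)) / 512)
    \<le> measure_pmf.prob (gnp n p) {G. p powr (1/2) * real n powr (3/2) / 1000 \<le> real (ex_number G F)}"
proof -
  define t where "t = nat \<lfloor>1 / p\<rfloor>"
  have ip: "1 / p \<ge> 1" using pp by simp
  have t1: "t \<ge> 1" unfolding t_def using ip by linarith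
  have tp: "real t \<le> 1 / p" unfolding t_def using ip by linarith
  have tp2: "real t \<ge> 1 / (2 * p)"
  proof -
    have "real t \<ge> 1 / p - 1" unfolding t_def using ip by linarith
    moreover have "real t \<ge> 1" using t1 by simp
    ultimately have "2 * real t \<ge> 1 / p" by linarith
    then show ?thesis by (simp add: field_simps)
  qed
  have n8: "8 * real t \<le> real n"
  proof -
    have "8 * real t \<le> 8 * (1 / p)" using tp by simp
    also have "\<dots> \<le> real n" using n pp by (simp add: divide_le_eq)
    finally show ?thesis .
  qed
  let ?P = "\<lambda>r::nat. 2 * 4 ^ r * t \<le> n"
  have P1: "?P 1" using n8 by (simp flip: of_nat_mult of_nat_le_iff add: of_nat_le_iff[where 'a = real, symmetric])
  have bound: "\<And>r. ?P r \<Longrightarrow> r \<le> n"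
  proof -
    fix r assume "?P r"
    have "r < 2 ^ r" by (rule less_exp)
    also have "(2::nat) ^ r \<le> 4 ^ r" by (rule power_mono) auto
    also have "4 ^ r \<le> 2 * 4 ^ r * t" using t1 by simp
    finally show "r \<le> n" using \<open>?P r\<close> by linarith
  qed
  define r where "r = Greatest ?P"
  have Pr: "?P r" unfolding r_def using P1 bound by (rule GreatestI_nat)
  have r1: "r \<ge> 1" unfolding r_def by (rule Greatest_le_nat[of ?P 1 n]) (use P1 bound in auto)
  have nPr: "\<not> ?P (Suc r)"
  proof
    assume "?P (Suc r)"
    then have "Suc r \<le> r" unfolding r_def by (intro Greatest_le_nat[of ?P "Suc _" n]) (use bound in auto)
    then show False by simp
  qed
  define q :: nat where "q = 2 ^ r"
  have q2: "q\<^sup>2 = 4 ^ r"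
  proof -
    have "q\<^sup>2 = 2 ^ (2 * r)" by (simp add: q_def mult.commute flip: power_mult)
    then show ?thesis by (simp add: power_mult)
  qed
  obtain J where Jx: "J \<subseteq> {..<q\<^sup>2} \<times> {..<q\<^sup>2}" "card J = q ^ 3"
    "\<forall>a a' b b'. (a, b) \<in> J \<longrightarrow> (a, b') \<in> J \<longrightarrow> (a', b) \<in> J \<longrightarrow> (a', b') \<in> J \<longrightarrow> a = a' \<or> b = b'"
    using ex_quadrilateral_free_bipartite[OF r1, folded q_def] by (elim exE conjE) (rule that)
  interpret blown_up_blocks n t "q\<^sup>2" J p
  proof unfold_locales
    show "2 * q\<^sup>2 * t \<le> n" using Pr unfolding q2 .
  qed (use t1 Jx pp in auto)
  have J0: "J \<noteq> {}" using Jx(2) unfolding q_def by auto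
  have low: "real t / 16 \<le> real t ^ 2 * (p * (1 - p) ^ (2 * (t - 1)))"
  proof -
    \<comment> \<open>Since \<open>t - 1 \<le> (1 - p) / p\<close>, the power is at least \<open>exp (-2)\<close>.\<close>
    have e: "(1 - p) ^ (2 * (t - 1)) \<ge> 1 / 8"
    proof (cases "t = 1")
      case False
      then have "real t \<ge> 2" using t1 by simp
      then have "2 \<le> 1 / p" using tp by linarith
      then have p1: "p < 1" using pp by (simp add: le_divide_eq)
      have "real (t - 1) \<le> (1 - p) / p" using tp t1 pp by (simp add: of_nat_diff diff_divide_distrib)
      moreover have "ln (1 - p) \<ge> - p / (1 - p)"
      proof -
        have "ln (1 / (1 - p)) \<le> 1 / (1 - p) - 1" using p1 by (intro ln_le_minus_one) simp
        also have "\<dots> = p / (1 - p)" using p1 by (simp add: field_simps)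
        finally show ?thesis using p1 by (simp add: ln_div)
      qed
      ultimately have "real (t - 1) * (- ln (1 - p)) \<le> (1 - p) / p * (p / (1 - p))"
        using pp p1 by (intro mult_mono) auto
      then have "real (t - 1) * ln (1 - p) \<ge> - 1" using pp p1 by simp
      then have "- 2 \<le> 2 * (real (t - 1) * ln (1 - p))" by linarith
      then have "exp (- 2) \<le> exp (2 * real (t - 1) * ln (1 - p))" by (simp add: mult.assoc)
      also have "\<dots> = (1 - p) ^ (2 * (t - 1))"
      proof -
        have "exp (real (2 * (t - 1)) * ln (1 - p)) = exp (ln (1 - p)) ^ (2 * (t - 1))" by (rule exp_of_nat_mult)
        then show ?thesis using p1 by simp
      qed
      finally have "exp (- 2) \<le> (1 - p) ^ (2 * (t - 1))" .
      moreover have "exp (2::real) \<le> 8"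
      proof -
        have "exp (1::real) ^ 2 \<le> 2.75 ^ 2" using e_less_272 by (intro power_mono) auto
        then show ?thesis by (simp add: exp_of_nat_mult[symmetric] power2_eq_square flip: exp_add)
      qed
      then have "1 / 8 \<le> exp (- 2 :: real)" by (simp add: exp_minus inverse_eq_divide frac_le)
      ultimately show ?thesis by linarith
    qed simp
    have "1 / 2 \<le> real t * p" using tp2 pp by (simp add: field_simps)
    then have "1 / 2 * (1 / 8) \<le> real t * p * (1 - p) ^ (2 * (t - 1))" using e pp by (intro mult_mono) auto
    then have "real t * (1 / 16) \<le> real t * (real t * p * (1 - p) ^ (2 * (t - 1)))" by (intro mult_left_mono) auto
    then show ?thesis by (simp add: power2_eq_square mult_ac)
  qed
  have q3: "(real n * p / 8) powr (3/2) \<le> real (q ^ 3)" "p powr (1/2) * real n powr (3/2) / 1000 \<le> real (q ^ 3) * real t / 32"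
  proof -
    have "real n < 8 * real (q\<^sup>2) * real t"
    proof -
      have "n < 8 * q\<^sup>2 * t" using nPr unfolding q2 by simp
      then show ?thesis by (metis of_nat_less_iff of_nat_mult of_nat_numeral)
    qed
    then have nq: "real n / (8 * real t) \<le> (real q)\<^sup>2" using t1 by (simp add: divide_le_eq mult_ac)
    have q0: "real q > 0" unfolding q_def by simp
    have "(real n / (8 * real t)) powr (3/2) \<le> ((real q)\<^sup>2) powr (3/2)" using nq by (intro powr_mono2) auto
    also have "(real q)\<^sup>2 = real q powr 2" using q0 by simp
    also have "(real q powr 2) powr (3/2) = real q powr real 3" unfolding powr_powr by simp
    also have "\<dots> = real q ^ 3" using q0 by (rule powr_realpow)
    finally have A: "(real n / (8 * real t)) powr (3/2) \<le> real q ^ 3" .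
    have "real n * p / 8 \<le> real n / (8 * real t)"
    proof -
      have "real t * p \<le> 1" using tp pp by (simp add: field_simps)
      then have "real n * (real t * p) \<le> real n * 1" by (intro mult_left_mono) auto
      then show ?thesis using t1 by (simp add: field_simps)
    qed
    then have "(real n * p / 8) powr (3/2) \<le> (real n / (8 * real t)) powr (3/2)" using pp by (intro powr_mono2) auto
    then show "(real n * p / 8) powr (3/2) \<le> real (q ^ 3)" using A by simp
    have t0: "real t > 0" using t1 by simp
    have "p powr (1/2) * real n powr (3/2) \<le> (1 / real t) powr (1/2) * real n powr (3/2)"
    proof (intro mult_right_mono powr_mono2)
      show "p \<le> 1 / real t" using tp pp t0 by (simp add: field_simps)
    qed (use pp in auto)
    also have "(1 / real t) powr (1/2) * real n powr (3/2) = 8 powr (3/2) * ((real n / (8 * real t)) powr (3/2) * real t)"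
    proof -
      have "(real n / (8 * real t)) powr (3/2) = real n powr (3/2) / (8 powr (3/2) * real t powr (3/2))"
        using t0 by (simp add: powr_divide powr_mult)
      moreover have "real t powr (3/2) = real t powr (1/2) * real t"
      proof -
        have "real t powr (3/2) = real t powr (1/2 + 1)" by simp
        then show ?thesis unfolding powr_add using t0 by simp
      qed
      moreover have "(1 / real t) powr (1/2) = 1 / real t powr (1/2)" using t0 by (simp add: powr_divide)
      ultimately show ?thesis using t0 by simp
    qed
    also have "\<dots> \<le> 8 powr (3/2) * (real q ^ 3 * real t)" using A by (intro mult_left_mono mult_right_mono) auto
    also have "8 powr (3/2) \<le> (30::real)"
    proof -
      have "(8::real) powr (3/2) \<le> 9 powr (3/2)" by (intro powr_mono2) auto
      also have "(9::real) powr (3/2) = (3 powr 2) powr (3/2)" by simp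
      also have "\<dots> = 27" unfolding powr_powr by simp
      finally show ?thesis by simp
    qed
    finally have B: "p powr (1/2) * real n powr (3/2) \<le> 30 * (real q ^ 3 * real t)" by (simp add: mult_right_mono)
    have X0: "0 \<le> real q ^ 3 * real t" by simp
    have X: "real (q ^ 3) * real t = real q ^ 3 * real t" by simp
    show "p powr (1/2) * real n powr (3/2) / 1000 \<le> real (q ^ 3) * real t / 32"
      unfolding X using B X0 by linarith
  qed
  have free: "free_edges n F (kept f)" for f
    unfolding free_edges_def contains_copy_def
  proof (rule notI, elim exE conjE)
    fix \<phi> assume inj: "inj_on \<phi> (verts F)"
      and ed: "\<forall>e\<in>edges F. \<phi> ` e \<in> edges \<lparr>verts = {..<n}, edges = kept f\<rparr>"
    obtain x u w s where q: "x \<noteq> s" "u \<noteq> w" "{x, s, u, w} \<subseteq> verts F"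
      "{x, u} \<in> edges F" "{x, w} \<in> edges F" "{s, u} \<in> edges F" "{s, w} \<in> edges F" using quadF by blast
    have "\<phi> ` {x, u} \<in> kept f" "\<phi> ` {x, w} \<in> kept f" "\<phi> ` {s, u} \<in> kept f" "\<phi> ` {s, w} \<in> kept f"
      using ed q(4-) by auto
    moreover have "\<phi> x \<noteq> \<phi> s" "\<phi> u \<noteq> \<phi> w" using inj q(1-3) by (auto simp: inj_on_def)
    ultimately show False using kept_no_quad[of "\<phi> x" "\<phi> u" f "\<phi> w" "\<phi> s"] by simp
  qed
  have ex_ge: "card (kept f) \<le> ex_number (coin_graph n f) F" for f
    by (rule ex_number_Max(2)[OF F graph_on_coin_graph _ free]) (use kept_sub in \<open>simp add: coin_graph_def\<close>)
  let ?m = "p powr (1/2) * real n powr (3/2) / 1000"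
  have "measure_pmf.prob (coins n p) {f. \<not> ?m \<le> real (ex_number (coin_graph n f) F)}
      \<le> measure_pmf.prob (coins n p) {f. real (card (kept f)) \<le> real (card J) * real t / 32}"
  proof (rule measure_pmf.finite_measure_mono)
    show "{f. \<not> ?m \<le> real (ex_number (coin_graph n f) F)} \<subseteq> {f. real (card (kept f)) \<le> real (card J) * real t / 32}"
    proof clarify
      fix f assume "\<not> ?m \<le> real (ex_number (coin_graph n f) F)"
      then show "real (card (kept f)) \<le> real (card J) * real t / 32"
        using q3(2) ex_ge[of f] unfolding Jx(2) by linarith
    qed
  qed simp
  also have "\<dots> \<le> exp (- real (card J) / 512)" by (rule kept_large[OF J0 low])
  also have "\<dots> \<le> exp (- ((real n * p / 8) powr (3/2)) / 512)" using q3(1) unfolding Jx(2) by simp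
  finally have bad: "measure_pmf.prob (coins n p) {f. \<not> ?m \<le> real (ex_number (coin_graph n f) F)}
      \<le> exp (- ((real n * p / 8) powr (3/2)) / 512)" .
  have "measure_pmf.prob (coins n p) {f. ?m \<le> real (ex_number (coin_graph n f) F)}
      = 1 - measure_pmf.prob (coins n p) {f. \<not> ?m \<le> real (ex_number (coin_graph n f) F)}"
    using measure_pmf.prob_compl[of "{f. \<not> ?m \<le> real (ex_number (coin_graph n f) F)}" "coins n p"]
    by (simp add: Collect_neg_eq[symmetric] Compl_eq_Diff_UNIV[symmetric])
  then have "1 - exp (- ((real n * p / 8) powr (3/2)) / 512)
      \<le> measure_pmf.prob (coins n p) {f. ?m \<le> real (ex_number (coin_graph n f) F)}"
    using bad by linarith
  then show ?thesis by (simp only: prob_gnp[of n p "\<lambda>G. ?m \<le> real (ex_number G F)"])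
qed

section \<open>Sparse random graphs and the upper bound\<close>

lemma aasI:
  assumes "\<forall>\<^sub>F n in sequentially. 1 - g n \<le> measure_pmf.prob (D n) {x. A n x}" and "g \<longlonglongrightarrow> 0"
  shows "aas D A"
  unfolding aas_def
proof (rule tendsto_sandwich)
  show "(\<lambda>n. 1 - g n) \<longlonglongrightarrow> 1" using tendsto_diff[OF tendsto_const assms(2), of 1] by simp
  show "(\<lambda>n. 1 :: real) \<longlonglongrightarrow> 1" by simp
qed (use assms(1) in auto)

lemma prob_Not: "measure_pmf.prob D {x. \<not> A x} = 1 - measure_pmf.prob D {x. A x}"
  using measure_pmf.prob_compl[of "{x. A x}" D]
  by (simp add: Collect_neg_eq[symmetric] Compl_eq_Diff_UNIV[symmetric])

lemma aas_notI:
  assumes "\<forall>\<^sub>F n in sequentially. measure_pmf.prob (D n) {x. \<not> A n x} \<le> g n" and "g \<longlonglongrightarrow> 0"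
  shows "aas D A"
proof (rule aasI[OF _ assms(2)])
  show "\<forall>\<^sub>F n in sequentially. 1 - g n \<le> measure_pmf.prob (D n) {x. A n x}"
    using assms(1) unfolding prob_Not by eventually_elim simp
qed

lemma prob_conj_ge:
  "measure_pmf.prob D {x. A x} + measure_pmf.prob D {x. B x} - 1 \<le> measure_pmf.prob D {x. A x \<and> B x}"
proof -
  have "measure_pmf.prob D {x. \<not> (A x \<and> B x)} \<le> measure_pmf.prob D {x. \<not> A x} + measure_pmf.prob D {x. \<not> B x}"
    using measure_Un_le[of "{x. \<not> A x}" "measure_pmf D" "{x. \<not> B x}"]
    by (simp add: Un_def)
  then show ?thesis unfolding prob_Not by simp
qed

lemma aas_conj:
  assumes "aas D A" "aas D B" shows "aas D (\<lambda>n x. A n x \<and> B n x)"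
proof (rule aasI)
  let ?g = "\<lambda>n. (1 - measure_pmf.prob (D n) {x. A n x}) + (1 - measure_pmf.prob (D n) {x. B n x})"
  have "?g \<longlonglongrightarrow> (1 - 1) + (1 - 1)"
    using assms unfolding aas_def by (intro tendsto_intros)
  then show "?g \<longlonglongrightarrow> 0" by simp
  show "\<forall>\<^sub>F n in sequentially. 1 - ?g n \<le> measure_pmf.prob (D n) {x. A n x \<and> B n x}"
    by (rule always_eventually) (use prob_conj_ge in \<open>auto simp: algebra_simps\<close>)
qed

lemma aas_gnp_mono:
  assumes "aas (\<lambda>n. gnp n (p n)) A"
    and "\<forall>\<^sub>F n in sequentially. \<forall>G. graph_on n G \<longrightarrow> A n G \<longrightarrow> B n G"
  shows "aas (\<lambda>n. gnp n (p n)) B"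
proof (rule aasI)
  let ?g = "\<lambda>n. 1 - measure_pmf.prob (gnp n (p n)) {x. A n x}"
  have "?g \<longlonglongrightarrow> 1 - 1" using assms(1) unfolding aas_def by (intro tendsto_intros)
  then show "?g \<longlonglongrightarrow> 0" by simp
  show "\<forall>\<^sub>F n in sequentially. 1 - ?g n \<le> measure_pmf.prob (gnp n (p n)) {x. B n x}"
    using assms(2)
  proof eventually_elim
    case (elim n)
    then show ?case using prob_gnp_mono[of n "A n" "B n" "p n"] by simp
  qed
qed

lemma aas_gnp_increase:
  assumes "aas (\<lambda>n. gnp n (q n)) A"
    and "\<forall>\<^sub>F n in sequentially. 0 \<le> q n \<and> q n \<le> p n \<and> p n \<le> 1"
    and up: "\<And>n G G'. graph_on n G \<Longrightarrow> graph_on n G' \<Longrightarrow> edges G \<subseteq> edges G' \<Longrightarrow> A n G \<Longrightarrow> A n G'"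
  shows "aas (\<lambda>n. gnp n (p n)) A"
proof (rule aasI)
  let ?g = "\<lambda>n. 1 - measure_pmf.prob (gnp n (q n)) {x. A n x}"
  have "?g \<longlonglongrightarrow> 1 - 1" using assms(1) unfolding aas_def by (intro tendsto_intros)
  then show "?g \<longlonglongrightarrow> 0" by simp
  show "\<forall>\<^sub>F n in sequentially. 1 - ?g n \<le> measure_pmf.prob (gnp n (p n)) {x. A n x}"
    using assms(2)
  proof eventually_elim
    case (elim n)
    have "measure_pmf.prob (gnp n (q n)) {x. A n x} \<le> measure_pmf.prob (gnp n (p n)) {x. A n x}"
      by (rule gnp_monotone) (use elim up in blast)+
    then show ?case by simp
  qed
qed

lemma aas_gnp_decrease:
  assumes "aas (\<lambda>n. gnp n (q n)) A"
    and "\<forall>\<^sub>F n in sequentially. 0 \<le> p n \<and> p n \<le> q n \<and> q n \<le> 1"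
    and down: "\<And>n G G'. graph_on n G \<Longrightarrow> graph_on n G' \<Longrightarrow> edges G \<subseteq> edges G' \<Longrightarrow> A n G' \<Longrightarrow> A n G"
  shows "aas (\<lambda>n. gnp n (p n)) A"
proof (rule aas_notI)
  let ?g = "\<lambda>n. 1 - measure_pmf.prob (gnp n (q n)) {x. A n x}"
  have "?g \<longlonglongrightarrow> 1 - 1" using assms(1) unfolding aas_def by (intro tendsto_intros)
  then show "?g \<longlonglongrightarrow> 0" by simp
  show "\<forall>\<^sub>F n in sequentially. measure_pmf.prob (gnp n (p n)) {x. \<not> A n x} \<le> ?g n"
    using assms(2)
  proof eventually_elim
    case (elim n)
    have "measure_pmf.prob (gnp n (p n)) {x. \<not> A n x} \<le> measure_pmf.prob (gnp n (q n)) {x. \<not> A n x}"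
      by (rule gnp_monotone) (use elim down in blast)+
    also have "\<dots> = ?g n"
      by (rule prob_Not)
    finally show ?case .
  qed
qed

lemma choose_two_bounds: "n \<ge> 2 \<Longrightarrow> real n ^ 2 / 4 \<le> real (n choose 2)" "real (n choose 2) \<le> real n ^ 2 / 2"
proof -
  have e: "real (n choose 2) = real n * (real n - 1) / 2"
  proof (cases n)
    case (Suc m)
    have "even (n * (n - 1))" using Suc by simp
    then show ?thesis unfolding choose_two by (simp add: real_of_nat_div Suc algebra_simps)
  qed simp
  show "real (n choose 2) \<le> real n ^ 2 / 2" unfolding e by (simp add: power2_eq_square algebra_simps)
  assume "n \<ge> 2"
  then have "real n * 2 \<le> real n * real n" by (intro mult_left_mono) auto
  then show "real n ^ 2 / 4 \<le> real (n choose 2)" unfolding e by (simp add: power2_eq_square algebra_simps)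
qed

text \<open>Extensional maps, so that finitely many of them give the edge sets of all copies of \<open>F\<close> in the
complete graph.\<close>

definition copy_sets :: "nat \<Rightarrow> 'b graph \<Rightarrow> nat set set set" where
  "copy_sets n F = (\<lambda>\<phi>. (`) \<phi> ` edges F) ` {\<phi> \<in> verts F \<rightarrow>\<^sub>E {..<n}. inj_on \<phi> (verts F)}"

lemma copy_sets:
  assumes F: "proper_graph F"
  shows "finite (copy_sets n F)" "card (copy_sets n F) \<le> n ^ card (verts F)"
    "\<And>T. T \<in> copy_sets n F \<Longrightarrow> T \<subseteq> edge_slots n \<and> card T = card (edges F)"
    "\<And>\<phi>. inj_on \<phi> (verts F) \<Longrightarrow> \<phi> ` verts F \<subseteq> {..<n} \<Longrightarrow> (`) \<phi> ` edges F \<in> copy_sets n F"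
proof -
  have finV: "finite (verts F)" and EV: "edges F \<subseteq> [verts F]\<^bsup>2\<^esup>" using F by (auto simp: proper_graph_def)
  have sub: "e \<subseteq> verts F" if "e \<in> edges F" for e using EV that by (auto simp: nsets_def)
  have fin: "finite (verts F \<rightarrow>\<^sub>E {..<n})" using finV by (intro finite_PiE) auto
  then show "finite (copy_sets n F)" unfolding copy_sets_def by simp
  have "card (copy_sets n F) \<le> card {\<phi> \<in> verts F \<rightarrow>\<^sub>E {..<n}. inj_on \<phi> (verts F)}"
    unfolding copy_sets_def using fin by (intro card_image_le) simp
  also have "\<dots> \<le> card (verts F \<rightarrow>\<^sub>E {..<n})" using fin by (intro card_mono) auto
  also have "\<dots> = n ^ card (verts F)" using finV by (simp add: card_PiE)
  finally show "card (copy_sets n F) \<le> n ^ card (verts F)" .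
  show "T \<subseteq> edge_slots n \<and> card T = card (edges F)" if T: "T \<in> copy_sets n F" for T
  proof -
    obtain \<phi> where \<phi>: "\<phi> \<in> verts F \<rightarrow>\<^sub>E {..<n}" "inj_on \<phi> (verts F)" "T = (`) \<phi> ` edges F"
      using T unfolding copy_sets_def by auto
    have "\<phi> ` e \<in> edge_slots n" if "e \<in> edges F" for e
    proof -
      have e: "e \<subseteq> verts F" "finite e" "card e = 2" using EV that by (auto simp: nsets_def)
      have "card (\<phi> ` e) = 2" using card_image[OF inj_on_subset[OF \<phi>(2) e(1)]] e(3) by simp
      then show ?thesis using e \<phi>(1) by (auto simp: nsets_def)
    qed
    moreover have "inj_on ((`) \<phi>) (edges F)"
      by (rule inj_on_subset[OF inj_on_image_Pow[OF \<phi>(2)]]) (use sub in auto)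
    ultimately show ?thesis unfolding \<phi>(3) by (auto simp: card_image)
  qed
  show "(`) \<phi> ` edges F \<in> copy_sets n F" if i: "inj_on \<phi> (verts F)" and r: "\<phi> ` verts F \<subseteq> {..<n}" for \<phi>
  proof -
    have "(`) \<phi> ` edges F = (`) (restrict \<phi> (verts F)) ` edges F"
      by (intro image_cong refl) (use sub in \<open>auto intro!: image_cong\<close>)
    moreover have "restrict \<phi> (verts F) \<in> verts F \<rightarrow>\<^sub>E {..<n}" using r by auto
    moreover have "inj_on (restrict \<phi> (verts F)) (verts F)" using i by (simp add: inj_on_restrict_eq)
    ultimately show ?thesis unfolding copy_sets_def by blast
  qed
qed

text \<open>Below the deletion threshold the expected number of copies of \<open>F\<close>, at most
\<open>n ^ card (verts F) * p ^ card (edges F)\<close>, is of smaller order than \<open>p * n\<^sup>2\<close>. Markov's inequality shows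
that a.a.s. deleting an edge from each copy costs only a small fraction of the edges, whose number is
concentrated around its mean.\<close>

theorem ex_number_sparse:
  fixes F :: "'b graph" and p :: "nat \<Rightarrow> real"
  assumes F: "proper_graph F" and k2: "card (edges F) \<ge> 2" and k1: "card (verts F) \<ge> 2"
    and p: "\<And>n. 0 \<le> p n \<and> p n \<le> 1"
    and lower: "(\<lambda>n. real n powr (-2)) \<in> o(p)"
    and upper: "p \<in> o(\<lambda>n. real n powr (- (real (card (verts F) - 2) / real (card (edges F) - 1))))"
    and eps: "\<epsilon> > 0"
  shows "aas (\<lambda>n. gnp n (p n)) (\<lambda>n G. \<bar>real (ex_number G F) - p n * real (n choose 2)\<bar> \<le> \<epsilon> * (p n * real (n choose 2)))"
proof -
  define k where "k = card (edges F) - 1"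
  define l where "l = card (verts F) - 2"
  define \<mu> where "\<mu> n = p n * real (n choose 2)" for n
  define \<epsilon>' where "\<epsilon>' = min (\<epsilon> / 2) (1 / 2)"
  define c where "c = max (\<epsilon>' - (1 + \<epsilon>') * ln (1 + \<epsilon>')) (- \<epsilon>' - (1 - \<epsilon>') * ln (1 - \<epsilon>'))"
  define g where "g n = p n / real n powr (- (real l / real k))" for n
  have e': "0 < \<epsilon>'" "\<epsilon>' < 1" "2 * \<epsilon>' \<le> \<epsilon>" using eps by (auto simp: \<epsilon>'_def)
  have k: "k \<ge> 1" using k2 by (simp add: k_def)
  have c0: "c < 0"
    using minus_one_less_mult_ln[of "1 + \<epsilon>'"] minus_one_less_mult_ln[of "1 - \<epsilon>'"] e' by (auto simp: c_def)
  have big: "\<forall>\<^sub>F n in sequentially. Z * real n powr (-2) \<le> p n" if "Z > 0" for Z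
  proof -
    have "\<forall>\<^sub>F n in sequentially. norm (real n powr (-2)) \<le> (1 / Z) * norm (p n)"
      using landau_o.smallD[OF lower, of "1 / Z"] that by simp
    then show ?thesis
    proof eventually_elim
      case (elim n)
      then show ?case using p[of n] that by (simp add: field_simps)
    qed
  qed
  have mu_inf: "filterlim \<mu> at_top sequentially"
    unfolding filterlim_at_top_gt[where c = 0]
  proof (intro allI impI)
    fix Z :: real assume Z: "Z > 0"
    have "\<forall>\<^sub>F n in sequentially. 4 * Z * real n powr (-2) \<le> p n" using big[of "4 * Z"] Z by simp
    then show "\<forall>\<^sub>F n in sequentially. Z \<le> \<mu> n"
      using eventually_ge_at_top[of 2]
    proof eventually_elim
      case (elim n)
      have n0: "real n > 0" using elim by simp
      have "Z = 4 * Z * real n powr (-2) * (real n ^ 2 / 4)"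
        using n0 by (simp add: powr_minus_divide)
      also have "\<dots> \<le> p n * real (n choose 2)"
        using elim p choose_two_bounds(1) Z by (intro mult_mono) auto
      finally show ?case by (simp add: \<mu>_def)
    qed
  qed
  have g0: "g \<longlonglongrightarrow> 0"
    unfolding g_def using smalloD_tendsto[OF upper] by (simp add: k_def l_def)
  have gk: "(\<lambda>n. 4 / \<epsilon>' * g n ^ k) \<longlonglongrightarrow> 0"
  proof -
    have "(\<lambda>n. 4 / \<epsilon>' * g n ^ k) \<longlonglongrightarrow> 4 / \<epsilon>' * 0 ^ k" by (intro tendsto_intros g0)
    then show ?thesis using k by (simp add: zero_power)
  qed
  have conc: "aas (\<lambda>n. gnp n (p n)) (\<lambda>n G. \<not> \<epsilon>' * \<mu> n \<le> \<bar>real (card (edges G)) - \<mu> n\<bar>)"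
  proof (rule aas_notI)
    show "\<forall>\<^sub>F n in sequentially. measure_pmf.prob (gnp n (p n)) {G. \<not> \<not> \<epsilon>' * \<mu> n \<le> \<bar>real (card (edges G)) - \<mu> n\<bar>}
        \<le> 2 * exp (c * \<mu> n)"
      unfolding not_not \<mu>_def c_def by (intro always_eventually allI gnp_edges_concentrated) (use p e' in auto)
    have "filterlim (\<lambda>n. c * \<mu> n) at_bot sequentially"
      by (rule filterlim_tendsto_neg_mult_at_bot[OF tendsto_const c0 mu_inf])
    then have "(\<lambda>n. exp (c * \<mu> n)) \<longlonglongrightarrow> 0" by (rule filterlim_compose[OF exp_at_bot])
    then have "(\<lambda>n. 2 * exp (c * \<mu> n)) \<longlonglongrightarrow> 2 * 0" by (intro tendsto_intros)
    then show "(\<lambda>n. 2 * exp (c * \<mu> n)) \<longlonglongrightarrow> 0" by simp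
  qed
  let ?Y = "\<lambda>n (G :: nat graph). real (card {T \<in> copy_sets n F. T \<subseteq> edges G})"
  have few: "aas (\<lambda>n. gnp n (p n)) (\<lambda>n G. \<not> \<epsilon>' * \<mu> n \<le> ?Y n G)"
  proof (rule aas_notI[OF _ gk])
    show "\<forall>\<^sub>F n in sequentially. measure_pmf.prob (gnp n (p n)) {G. \<not> \<not> \<epsilon>' * \<mu> n \<le> ?Y n G} \<le> 4 / \<epsilon>' * g n ^ k"
      using big[OF zero_less_one] eventually_ge_at_top[of 2]
    proof eventually_elim
      case (elim n)
      have n0: "real n > 0" using elim by simp
      have p0: "p n > 0" using elim n0 by (smt (verit) powr_gt_zero)
      have N: "real n ^ 2 / 4 \<le> real (n choose 2)" using choose_two_bounds(1) elim by blast
      have N0: "real (n choose 2) > 0" using N n0 by (smt (verit) divide_pos_pos zero_less_power)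
      have mu0: "\<mu> n > 0" unfolding \<mu>_def using p0 N0 by simp
      have "measure_pmf.prob (gnp n (p n)) {G. \<epsilon>' * \<mu> n \<le> ?Y n G}
          \<le> real (card (copy_sets n F)) * p n ^ card (edges F) / (\<epsilon>' * \<mu> n)"
        by (rule gnp_copies_markov) (use p copy_sets(1,3)[OF F] e' mu0 in auto)
      also have "\<dots> \<le> real n ^ card (verts F) * p n ^ card (edges F) / (\<epsilon>' * (p n * (real n ^ 2 / 4)))"
      proof (intro frac_le mult_right_mono mult_nonneg_nonneg)
        show "real (card (copy_sets n F)) \<le> real n ^ card (verts F)"
          using copy_sets(2)[OF F, of n] by (metis of_nat_le_iff of_nat_power)
        show "\<epsilon>' * (p n * (real n ^ 2 / 4)) \<le> \<epsilon>' * \<mu> n"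
          unfolding \<mu>_def using N e' p0 by (intro mult_left_mono) auto
      qed (use p0 n0 e' in auto)
      also have "\<dots> = 4 / \<epsilon>' * (real n ^ l * p n ^ k)"
      proof -
        have "card (verts F) = l + 2" "card (edges F) = Suc k" using k1 k2 by (simp_all add: l_def k_def)
        then show ?thesis using p0 n0 e' by (simp add: power_add field_simps power2_eq_square)
      qed
      also have "real n ^ l * p n ^ k = g n ^ k"
      proof -
        have "(real n powr (- (real l / real k))) ^ k = real n powr (- real l)"
          using k n0 by (simp add: powr_realpow[symmetric] powr_powr)
        also have "\<dots> = 1 / real n ^ l" using n0 by (simp add: powr_minus_divide powr_realpow)
        finally show ?thesis unfolding g_def power_divide using n0 by simp
      qed
      finally show ?case by simp
    qed
  qed
  show ?thesis
  proof (rule aas_gnp_mono[OF aas_conj[OF conc few]], intro always_eventually allI impI)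
    fix n and G :: "nat graph"
    assume G: "graph_on n G" and A: "\<not> \<epsilon>' * \<mu> n \<le> \<bar>real (card (edges G)) - \<mu> n\<bar> \<and> \<not> \<epsilon>' * \<mu> n \<le> ?Y n G"
    have mu0: "\<mu> n \<ge> 0" using p by (simp add: \<mu>_def)
    have "ex_number G F \<le> card (edges G)" using ex_number_le_edges[OF F G] .
    moreover have "card (edges G) \<le> ex_number G F + card {T \<in> copy_sets n F. T \<subseteq> edges G}"
    proof (rule ex_number_delete[OF F G copy_sets(1)[OF F]])
      fix T assume "T \<in> copy_sets n F"
      then have "card T = card (edges F)" using copy_sets(3)[OF F] by blast
      then show "T \<noteq> {}" using k2 by auto
    qed (use copy_sets(4)[OF F] in blast)
    ultimately have "\<bar>real (ex_number G F) - \<mu> n\<bar> \<le> 2 * \<epsilon>' * \<mu> n" using A by linarith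
    also have "\<dots> \<le> \<epsilon> * \<mu> n" using e' mu0 by (intro mult_right_mono) auto
    finally show "\<bar>real (ex_number G F) - p n * real (n choose 2)\<bar> \<le> \<epsilon> * (p n * real (n choose 2))"
      unfolding \<mu>_def .
  qed
qed

text \<open>The free subgraphs of the random graph are the independent sets in the hypergraph of copies, and
balanced supersaturation supplies container maps for every sufficiently large set of edges. With
\<open>m\<^sub>0 = p powr (1/2) * n powr (3/2)\<close>, that is \<open>m\<^sub>0\<^sup>2 = p * n ^ 3\<close>, the fingerprint size
\<open>n ^ 3 / card W + n powr (1 + e / (v - 1 + 2 e))\<close> takes the form required by
\<open>sparse_random_upper_tail\<close> with \<open>L = ln n\<close>.\<close>

theorem ex_number_gnp_upper:
  fixes M :: "('i, 'e) multigraph"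
  assumes M: "loopless_multigraph M" and e1: "card (medges M) \<ge> 1"
    and bal: "\<And>\<mu>. \<mu> \<subseteq> mverts M \<Longrightarrow> card \<mu> \<ge> 2 \<Longrightarrow>
      card {e \<in> medges M. ends M e \<subseteq> \<mu>} * (card (mverts M) - 1) \<le> card (medges M) * (card \<mu> - 1)"
  defines "v \<equiv> card (mverts M)" and "e \<equiv> card (medges M)"
  shows "\<exists>K>0. \<forall>n p. 3 \<le> n \<longrightarrow> 0 < p \<longrightarrow> p \<le> 1 \<longrightarrow>
     real n powr (1 + real e / (real v - 1 + 2 * real e)) * (ln (real n))\<^sup>2 \<le> p powr (1/2) * real n powr (3/2) \<longrightarrow>
     measure_pmf.prob (gnp n p) {G. K * (p powr (1/2) * real n powr (3/2)) \<le> real (ex_number G (F_graph M))}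
       \<le> exp (- (p powr (1/2) * real n powr (3/2)))"
proof -
  let ?F = "F_graph M" and ?r = "v + 2 * e"
  have F: "proper_graph ?F" using proper_F_graph(1)[OF M e1] .
  have "\<exists>K\<^sub>0\<ge>3. \<exists>K\<^sub>1>0. \<exists>C\<^sub>1>0. \<forall>n W. n \<ge> 1 \<longrightarrow> W \<subseteq> [{..<n}]\<^bsup>2\<^esup> \<longrightarrow>
      real (card W) \<ge> K\<^sub>0 * real n powr (3/2) \<longrightarrow>
      (\<exists>H \<tau>. \<tau> > 0 \<and> \<tau> * real (card W) \<le> C\<^sub>1 * (real n ^ 3 / real (card W)
              + real n powr (1 + real e / (real v - 1 + 2 * real e))) \<and>
        (\<forall>\<epsilon>. H \<epsilon> \<ge> 0) \<and> wdeg W ?r H {} > 0 \<and>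
        degs_le W ?r H (\<lambda>j. K\<^sub>1 * wdeg W ?r H {} / real (card W) * \<tau> ^ (j - 1)) \<and>
        (\<forall>I\<subseteq>W. \<not> contains_copy \<lparr>verts = {..<n}, edges = I\<rparr> ?F \<longrightarrow> windep ?r H I))"
    unfolding v_def e_def by (rule balanced_supersaturation[OF M e1]) (rule bal)
  then obtain K\<^sub>0 K\<^sub>1 C\<^sub>1 where K0: "K\<^sub>0 \<ge> 3" "K\<^sub>1 > 0" "C\<^sub>1 > 0" and sup: "\<forall>n W. n \<ge> 1 \<longrightarrow> W \<subseteq> [{..<n}]\<^bsup>2\<^esup> \<longrightarrow>
      real (card W) \<ge> K\<^sub>0 * real n powr (3/2) \<longrightarrow>
      (\<exists>H \<tau>. \<tau> > 0 \<and> \<tau> * real (card W) \<le> C\<^sub>1 * (real n ^ 3 / real (card W)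
              + real n powr (1 + real e / (real v - 1 + 2 * real e))) \<and>
        (\<forall>\<epsilon>. H \<epsilon> \<ge> 0) \<and> wdeg W ?r H {} > 0 \<and>
        degs_le W ?r H (\<lambda>j. K\<^sub>1 * wdeg W ?r H {} / real (card W) * \<tau> ^ (j - 1)) \<and>
        (\<forall>I\<subseteq>W. \<not> contains_copy \<lparr>verts = {..<n}, edges = I\<rparr> ?F \<longrightarrow> windep ?r H I))"
    by (elim exE conjE) (rule that)
  have r1: "?r \<ge> 1" using e1 by (simp add: e_def)
  from hypergraph_containers[OF r1 K0(2), where 'a = "nat set"]
  obtain \<delta> C\<^sub>2 where d: "\<delta> > 0" "C\<^sub>2 > 0" "\<delta> < 1" and cont: "\<forall>(V :: nat set set) H \<tau>. finite V \<longrightarrow> V \<noteq> {} \<longrightarrow> \<tau> > 0 \<longrightarrow> (\<forall>e. H e \<ge> 0) \<longrightarrow>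
     wdeg V ?r H {} > 0 \<longrightarrow> degs_le V ?r H (\<lambda>j. K\<^sub>1 * wdeg V ?r H {} / card V * \<tau> ^ (j - 1)) \<longrightarrow>
     (\<exists>f. container_map V (windep ?r H) \<delta> (C\<^sub>2 * \<tau> * card V) f)"
    by (elim exE conjE) (rule that)
  define \<sigma> where "\<sigma> = C\<^sub>2 * C\<^sub>1"
  have sig: "\<sigma> > 0" using d K0 by (simp add: \<sigma>_def)
  from sparse_random_upper_tail[OF d(1,3) sig K0(1), where 'a = "nat set" and 'x = "nat graph"]
  obtain K where K: "K > 0" and tail: "\<forall>(V :: nat set set) ind p m\<^sub>0 s\<^sub>0 L (D :: nat graph pmf) R. finite V \<longrightarrow>
    (\<forall>I J. ind I \<longrightarrow> J \<subseteq> I \<longrightarrow> ind J) \<longrightarrow> 0 < p \<longrightarrow> 0 < m\<^sub>0 \<longrightarrow> 0 \<le> s\<^sub>0 \<longrightarrow> 1 \<le> L \<longrightarrow>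
    p * real (card V) \<le> m\<^sub>0 * exp (2 * L) \<longrightarrow> s\<^sub>0 * L\<^sup>2 \<le> m\<^sub>0 \<longrightarrow> inclusion_bound D R V p \<longrightarrow>
    (\<forall>W\<subseteq>V. K\<^sub>0 * m\<^sub>0 < p * real (card W) \<longrightarrow>
       (\<exists>f. container_map W ind \<delta> (\<sigma> * (m\<^sub>0\<^sup>2 / (p * real (card W)) + s\<^sub>0)) f)) \<longrightarrow>
    measure_pmf.prob D {x. \<exists>I\<subseteq>V. I \<subseteq> R x \<and> ind I \<and> real (card I) \<ge> K * m\<^sub>0} \<le> exp (- m\<^sub>0)"
    by (elim exE conjE) (rule that)
  have "measure_pmf.prob (gnp n p) {G. K * (p powr (1/2) * real n powr (3/2)) \<le> real (ex_number G ?F)}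
       \<le> exp (- (p powr (1/2) * real n powr (3/2)))"
    if n: "3 \<le> n" and p: "0 < p" "p \<le> 1" and
      m: "real n powr (1 + real e / (real v - 1 + 2 * real e)) * (ln (real n))\<^sup>2 \<le> p powr (1/2) * real n powr (3/2)" for n p
  proof -
    define m\<^sub>0 where "m\<^sub>0 = p powr (1/2) * real n powr (3/2)"
    define s\<^sub>0 where "s\<^sub>0 = real n powr (1 + real e / (real v - 1 + 2 * real e))"
    have n0: "real n \<ge> 3" using n by simp
    have m0: "m\<^sub>0 > 0" using n0 p by (simp add: m\<^sub>0_def)
    have ln1: "ln (real n) \<ge> 1"
    proof -
      have "exp 1 \<le> real n" using n0 e_less_272 by linarith
      then show ?thesis using n0 by (simp add: ln_ge_iff)
    qed
    have n3: "(real n powr (3/2))\<^sup>2 = real n ^ 3"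
    proof -
      have "(real n powr (3/2))\<^sup>2 = real n powr (3/2 + 3/2)" by (simp only: power2_eq_square powr_add)
      also have "\<dots> = real n powr real 3" by simp
      also have "\<dots> = real n ^ 3" using n0 by (intro powr_realpow) auto
      finally show ?thesis .
    qed
    have ph: "(p powr (1/2))\<^sup>2 = p"
      using p by (simp add: powr_half_sqrt)
    have msq: "m\<^sub>0\<^sup>2 = p * real n ^ 3" unfolding m\<^sub>0_def power_mult_distrib n3 ph ..
    have V: "p * real (card (edge_slots n)) \<le> m\<^sub>0 * exp (2 * ln (real n))"
    proof -
      have ex2: "exp (2 * ln (real n)) = real n ^ 2"
        using n0 exp_of_nat_mult[of 2 "ln (real n)"] by simp
      have "real (card (edge_slots n)) \<le> real n ^ 2"
        unfolding card_edge_slots using choose_two_bounds(2)[of n] by (smt (verit) zero_le_power2 field_sum_of_halves)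
      moreover have "p \<le> m\<^sub>0"
      proof -
        have "p * 1 \<le> p powr (1/2) * real n powr (3/2)"
        proof (rule mult_mono)
          have "p powr 1 \<le> p powr (1/2)" using p by (intro powr_mono') auto
          then show "p \<le> p powr (1/2)" using p by simp
          show "1 \<le> real n powr (3/2)" using n0 by (intro ge_one_powr_ge_zero) auto
        qed (use p in auto)
        then show ?thesis by (simp add: m\<^sub>0_def)
      qed
      ultimately show ?thesis unfolding ex2 using p m0 by (intro mult_mono) auto
    qed
    have containers: "\<exists>f. container_map W (free_edges n ?F) \<delta> (\<sigma> * (m\<^sub>0\<^sup>2 / (p * real (card W)) + s\<^sub>0)) f"
      if W: "W \<subseteq> edge_slots n" "K\<^sub>0 * m\<^sub>0 < p * real (card W)" for W
    proof -
      have w0: "real (card W) > 0"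
      proof -
        have "0 < p * real (card W)" using W(2) K0 m0 by (smt (verit) mult_pos_pos)
        then show ?thesis using p by (simp add: zero_less_mult_iff)
      qed
      have "K\<^sub>0 * real n powr (3/2) \<le> real (card W)"
      proof -
        have "p * real n powr (3/2) \<le> m\<^sub>0"
        proof -
          have "p powr 1 \<le> p powr (1/2)" using p by (intro powr_mono') auto
          then show ?thesis unfolding m\<^sub>0_def using p by (intro mult_right_mono) auto
        qed
        then have "K\<^sub>0 * (p * real n powr (3/2)) \<le> K\<^sub>0 * m\<^sub>0" using K0 by (intro mult_left_mono) auto
        then have "p * (K\<^sub>0 * real n powr (3/2)) \<le> p * real (card W)" using W(2) by (simp add: mult_ac)
        then show ?thesis using p by simp
      qed
      then obtain H \<tau> where H: "\<tau> > 0" "\<tau> * real (card W) \<le> C\<^sub>1 * (real n ^ 3 / real (card W) + s\<^sub>0)"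
        "\<forall>\<epsilon>. H \<epsilon> \<ge> 0" "wdeg W ?r H {} > 0"
        "degs_le W ?r H (\<lambda>j. K\<^sub>1 * wdeg W ?r H {} / real (card W) * \<tau> ^ (j - 1))"
        "\<forall>I\<subseteq>W. \<not> contains_copy \<lparr>verts = {..<n}, edges = I\<rparr> ?F \<longrightarrow> windep ?r H I"
        using sup[rule_format, of n W] n W(1) unfolding s\<^sub>0_def by auto
      have finW: "finite W" "W \<noteq> {}" using w0 by (auto simp: card_gt_0_iff)
      obtain f where f: "container_map W (windep ?r H) \<delta> (C\<^sub>2 * \<tau> * card W) f"
        using cont[rule_format, OF finW H(1) H(3)[rule_format] H(4) H(5)] by blast
      have "container_map W (free_edges n ?F) \<delta> (\<sigma> * (m\<^sub>0\<^sup>2 / (p * real (card W)) + s\<^sub>0)) f"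
      proof (rule container_map_mono[OF f])
        show "windep ?r H I" if "I \<subseteq> W" "free_edges n ?F I" for I using H(6) that unfolding free_edges_def by blast
        have "C\<^sub>2 * (\<tau> * real (card W)) \<le> C\<^sub>2 * (C\<^sub>1 * (real n ^ 3 / real (card W) + s\<^sub>0))"
          using H(2) d by (intro mult_left_mono) auto
        moreover have "m\<^sub>0\<^sup>2 / (p * real (card W)) = real n ^ 3 / real (card W)" unfolding msq using p by simp
        ultimately show "C\<^sub>2 * \<tau> * real (card W) \<le> \<sigma> * (m\<^sub>0\<^sup>2 / (p * real (card W)) + s\<^sub>0)"
          by (simp add: \<sigma>_def mult.assoc)
      qed
      then show ?thesis by blast
    qed
    have cw: "inclusion_bound (gnp n p) edges (edge_slots n) p" using p by (intro inclusion_bound_gnp) auto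
    have "measure_pmf.prob (gnp n p) {G. K * m\<^sub>0 \<le> real (ex_number G ?F)}
        \<le> measure_pmf.prob (gnp n p) {G. \<exists>I\<subseteq>edge_slots n. I \<subseteq> edges G \<and> free_edges n ?F I \<and> real (card I) \<ge> K * m\<^sub>0}"
    proof (rule prob_gnp_mono)
      fix G assume G: "graph_on n G" and big: "K * m\<^sub>0 \<le> real (ex_number G ?F)"
      obtain I where I: "I \<subseteq> edges G" "free_edges n ?F I" "card I = ex_number G ?F" using ex_number_Max(1)[OF F G] by blast
      then show "\<exists>I\<subseteq>edge_slots n. I \<subseteq> edges G \<and> free_edges n ?F I \<and> real (card I) \<ge> K * m\<^sub>0"
        using G big unfolding graph_on_def by (intro exI[of _ I]) auto
    qed
    also have "\<dots> \<le> exp (- m\<^sub>0)"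
      by (rule tail[rule_format, of "edge_slots n" "free_edges n ?F" p m\<^sub>0 s\<^sub>0 "ln (real n)"])
         (use p m0 ln1 V m cw containers free_edges_mono in \<open>auto simp: s\<^sub>0_def m\<^sub>0_def\<close>)
    finally show ?thesis by (simp add: m\<^sub>0_def)
  qed
  then show ?thesis using K by blast
qed

section \<open>The three ranges\<close>

lemma F_graph_quadrilateral:
  assumes M: "loopless_multigraph M" and e1: "card (medges M) \<ge> 1"
  shows "\<exists>x u w s. x \<noteq> s \<and> u \<noteq> w \<and> {x, s, u, w} \<subseteq> verts (F_graph M) \<and>
    {x, u} \<in> edges (F_graph M) \<and> {x, w} \<in> edges (F_graph M) \<and> {s, u} \<in> edges (F_graph M) \<and> {s, w} \<in> edges (F_graph M)"
proof -
  obtain e where e: "e \<in> medges M" using e1 by (metis card.empty equals0I not_one_le_zero)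
  obtain i j where ij: "ends M e = {i, j}" "i \<noteq> j" "i \<in> mverts M" "j \<in> mverts M"
    using M e unfolding loopless_multigraph_def nsets_2_eq by fastforce
  have "{Subdiv e, Branch i} \<in> edges (F_graph M)" "{Subdiv e, Branch j} \<in> edges (F_graph M)"
    using e ij(1) unfolding F_graph_def by (auto simp: insert_commute)
  moreover have "{Apex, Branch i} \<in> edges (F_graph M)" "{Apex, Branch j} \<in> edges (F_graph M)"
    using ij(3,4) unfolding F_graph_def by auto
  moreover have "{Apex, Subdiv e, Branch i, Branch j} \<subseteq> verts (F_graph M)"
    using e ij(3,4) unfolding F_graph_def by auto
  ultimately show ?thesis
    using ij(2) by (intro exI[of _ Apex] exI[of _ "Branch i"] exI[of _ "Branch j"] exI[of _ "Subdiv e"]) simp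
qed

lemma balanced_multigraph:
  assumes M: "loopless_multigraph M" and v2: "card (mverts M) \<ge> 2"
    and max: "Max {real (num_edges (induced M \<mu>)) / (real (card \<mu>) - 1) | \<mu>. \<mu> \<subseteq> mverts M \<and> card \<mu> \<ge> 2}
         = real (num_edges M) / (real (num_verts M) - 1)"
    and mu: "\<mu> \<subseteq> mverts M" "card \<mu> \<ge> 2"
  shows "card {e \<in> medges M. ends M e \<subseteq> \<mu>} * (card (mverts M) - 1) \<le> card (medges M) * (card \<mu> - 1)"
proof -
  let ?f = "\<lambda>\<mu>. real (num_edges (induced M \<mu>)) / (real (card \<mu>) - 1)"
  have "finite (mverts M)" using M unfolding loopless_multigraph_def by blast
  then have "finite (?f ` {\<mu>. \<mu> \<subseteq> mverts M \<and> card \<mu> \<ge> 2})" by simp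
  then have fin: "finite {?f \<mu> | \<mu>. \<mu> \<subseteq> mverts M \<and> card \<mu> \<ge> 2}" by (simp add: setcompr_eq_image)
  have "?f \<mu> \<le> real (num_edges M) / (real (num_verts M) - 1)"
    unfolding max[symmetric] by (rule Max_ge[OF fin]) (use mu in blast)
  moreover have "num_edges (induced M \<mu>) = card {e \<in> medges M. ends M e \<subseteq> \<mu>}"
    by (simp add: num_edges_def induced_def)
  ultimately have "real (card {e \<in> medges M. ends M e \<subseteq> \<mu>}) / (real (card \<mu>) - 1)
      \<le> real (card (medges M)) / (real (card (mverts M)) - 1)" by (simp add: num_edges_def num_verts_def)
  moreover have "real (card \<mu>) - 1 > 0" "real (card (mverts M)) - 1 > 0" using mu(2) v2 by auto
  ultimately have "real (card {e \<in> medges M. ends M e \<subseteq> \<mu>}) * (real (card (mverts M)) - 1)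
      \<le> real (card (medges M)) * (real (card \<mu>) - 1)" by (simp add: divide_simps)
  then have "real (card {e \<in> medges M. ends M e \<subseteq> \<mu>} * (card (mverts M) - 1))
      \<le> real (card (medges M) * (card \<mu> - 1))" using mu(2) v2 by (simp add: of_nat_diff)
  then show ?thesis using of_nat_le_iff by blast
qed

text \<open>In the dense range the lower bound comes from the blown-up incidence graph and the upper bound from
containers. The exponents are related by \<open>3/2 - a/2 = 2 - b = 1 + e / (v - 1 + 2 e)\<close>, so at
\<open>p = n powr (-a) * ln n powr C\<close> the dense bound \<open>p powr (1/2) * n powr (3/2)\<close> equals
\<open>n powr (2 - b) * ln n powr (C/2)\<close>; containers need at least \<open>n powr (2 - b) * (ln n)\<^sup>2\<close> here, which
\<open>C = 6\<close> provides with room to spare. In the sparse range the deletion method suffices, because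
\<open>b = (card (verts F) - 2) / (card (edges F) - 1)\<close>. In the middle range the extremal number is squeezed, by
monotonicity in \<open>p\<close>, between its values at \<open>n powr (-b) / ln n\<close> in the sparse range and at
\<open>n powr (-a) * ln n powr 6\<close> in the dense range.\<close>

theorem theorem2p3:
  fixes M :: "('a, 'b) multigraph"
  assumes "loopless_multigraph M"
    and "num_edges M \<ge> 1"
    and "Max {real (num_edges (induced M \<mu>)) / (real (card \<mu>) - 1) | \<mu>. \<mu> \<subseteq> mverts M \<and> card \<mu> \<ge> 2}
         = real (num_edges M) / (real (num_verts M) - 1)"
  shows "let v = real (num_verts M); e = real (num_edges M);
             a = (v - 1) / (v + 2 * e - 1);
             b = (v + e - 1) / (v + 2 * e - 1)
         in \<exists>C>0.
           (\<exists>K>0. \<forall>p::nat \<Rightarrow> real.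
              (\<forall>n. 0 \<le> p n \<and> p n \<le> 1) \<longrightarrow>
              (\<forall>\<^sub>F n in sequentially. real n powr (-a) * ln (real n) powr C \<le> p n) \<longrightarrow>
              aas (\<lambda>n. gnp n (p n)) (\<lambda>n G.
                inverse K * (p n powr (1/2) * real n powr (3/2)) \<le> real (ex_number G (F_graph M)) \<and>
                real (ex_number G (F_graph M)) \<le> K * (p n powr (1/2) * real n powr (3/2)))) \<and>
           (\<exists>C'>0. \<forall>p::nat \<Rightarrow> real.
              (\<forall>n. 0 \<le> p n \<and> p n \<le> 1) \<longrightarrow>
              (\<lambda>n. real n powr (-b)) \<in> o(p) \<longrightarrow>
              (\<forall>\<^sub>F n in sequentially. p n \<le> real n powr (-a) * ln (real n) powr C) \<longrightarrow>
              aas (\<lambda>n. gnp n (p n)) (\<lambda>n G.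
                real n powr (2 - b) * ln (real n) powr (-C') \<le> real (ex_number G (F_graph M)) \<and>
                real (ex_number G (F_graph M)) \<le> real n powr (2 - b) * ln (real n) powr C')) \<and>
           (\<forall>p::nat \<Rightarrow> real.
              (\<forall>n. 0 \<le> p n \<and> p n \<le> 1) \<longrightarrow>
              (\<lambda>n. real n powr (-2)) \<in> o(p) \<longrightarrow>
              p \<in> o(\<lambda>n. real n powr (-b)) \<longrightarrow>
              (\<forall>\<epsilon>>0. aas (\<lambda>n. gnp n (p n)) (\<lambda>n G.
                \<bar>real (ex_number G (F_graph M)) - p n * real (n choose 2)\<bar>
                  \<le> \<epsilon> * (p n * real (n choose 2)))))"
proof -
  let ?F = "F_graph M"
  define v e where "v = card (mverts M)" and "e = card (medges M)"
  define D where "D = real v + 2 * real e - 1"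
  define a where "a = (real v - 1) / D"
  define b where "b = (real v + real e - 1) / D"
  note M = assms(1)
  have e1': "card (medges M) \<ge> 1" using assms(2) by (simp add: num_edges_def)
  then have e1: "real e \<ge> 1" by (simp add: e_def)
  have finV: "finite (mverts M)" using M unfolding loopless_multigraph_def by blast
  have v2': "card (mverts M) \<ge> 2"
  proof -
    obtain e where "e \<in> medges M" using e1' by (metis card.empty equals0I not_one_le_zero)
    then have "ends M e \<subseteq> mverts M" "card (ends M e) = 2" using M unfolding loopless_multigraph_def nsets_def by auto
    then show ?thesis using card_mono[OF finV] by metis
  qed
  then have v2: "real v \<ge> 2" by (simp add: v_def)
  have D: "D > 0" using v2 e1 by (simp add: D_def)
  have a: "0 < a" "a < 1" using v2 e1 D by (auto simp: a_def D_def)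
  have b: "0 < b" "b < 1" using v2 e1 D by (auto simp: b_def D_def)
  have ab: "3/2 - a / 2 = 2 - b" "2 - b = 1 + real e / (real v - 1 + 2 * real e)"
  proof -
    have D': "real v - 1 + 2 * real e = D" by (simp add: D_def)
    show "2 - b = 1 + real e / (real v - 1 + 2 * real e)" unfolding D' b_def using D by (simp add: field_simps D_def)
    have v: "real v = D - 2 * real e + 1" by (simp add: D_def)
    show "3/2 - a / 2 = 2 - b" unfolding a_def b_def v using D by (simp add: field_simps)
  qed
  have F: "proper_graph ?F" using proper_F_graph(1)[OF M e1'] .
  have bal: "card {e \<in> medges M. ends M e \<subseteq> \<mu>} * (card (mverts M) - 1) \<le> card (medges M) * (card \<mu> - 1)"
    if "\<mu> \<subseteq> mverts M" "card \<mu> \<ge> 2" for \<mu>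
    using balanced_multigraph[OF M v2' assms(3) that] .

  have sparse: "aas (\<lambda>n. gnp n (p n)) (\<lambda>n G. \<bar>real (ex_number G ?F) - p n * real (n choose 2)\<bar> \<le> \<epsilon> * (p n * real (n choose 2)))"
    if p: "\<forall>n. 0 \<le> p n \<and> p n \<le> 1" "(\<lambda>n. real n powr (-2)) \<in> o(p)" "p \<in> o(\<lambda>n. real n powr (-b))" and eps: "\<epsilon> > 0" for p \<epsilon>
  proof (rule ex_number_sparse[OF F _ _ _ p(2) _ eps])
    have "v + e + 1 - 2 = v + e - 1" "v + e - 1 + 1 = v + e" using v2 by auto
    then have "real (v + e - 1) + 1 = real v + real e" by (metis of_nat_1 of_nat_add)
    then have "real (card (verts ?F) - 2) = real v + real e - 1"
      unfolding proper_F_graph(2)[OF M e1', folded v_def e_def] \<open>v + e + 1 - 2 = v + e - 1\<close> by linarith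
    moreover have "real (card (edges ?F) - 1) = D"
    proof -
      have "v + 2 * e - 1 + 1 = v + 2 * e" using v2 by simp
      then have "real (v + 2 * e - 1 + 1) = real (v + 2 * e)" by (rule arg_cong)
      then have "real (v + 2 * e - 1) + 1 = real v + 2 * real e" unfolding of_nat_add of_nat_mult of_nat_1 of_nat_numeral .
      then have "real (v + 2 * e - 1) = D" unfolding D_def by linarith
      then show ?thesis unfolding proper_F_graph(3)[OF M e1', folded v_def e_def] .
    qed
    ultimately have "real (card (verts ?F) - 2) / real (card (edges ?F) - 1) = b" unfolding b_def by metis
    then show "p \<in> o(\<lambda>n. real n powr (- (real (card (verts ?F) - 2) / real (card (edges ?F) - 1))))"
      using p(3) by metis
  qed (use p(1) proper_F_graph(2,3)[OF M e1'] v2' e1' in auto)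

  have "\<exists>K>0. \<forall>n p. 3 \<le> n \<longrightarrow> 0 < p \<longrightarrow> p \<le> 1 \<longrightarrow>
     real n powr (1 + real e / (real v - 1 + 2 * real e)) * (ln (real n))\<^sup>2 \<le> p powr (1/2) * real n powr (3/2) \<longrightarrow>
     measure_pmf.prob (gnp n p) {G. K * (p powr (1/2) * real n powr (3/2)) \<le> real (ex_number G ?F)}
       \<le> exp (- (p powr (1/2) * real n powr (3/2)))"
    unfolding v_def e_def by (rule ex_number_gnp_upper[OF M e1']) (rule bal)
  then obtain K\<^sub>0 where K0: "K\<^sub>0 > 0" and upper: "\<forall>n p. 3 \<le> n \<longrightarrow> 0 < p \<longrightarrow> p \<le> 1 \<longrightarrow>
     real n powr (1 + real e / (real v - 1 + 2 * real e)) * (ln (real n))\<^sup>2 \<le> p powr (1/2) * real n powr (3/2) \<longrightarrow>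
     measure_pmf.prob (gnp n p) {G. K\<^sub>0 * (p powr (1/2) * real n powr (3/2)) \<le> real (ex_number G ?F)}
       \<le> exp (- (p powr (1/2) * real n powr (3/2)))"
    by (elim exE conjE) (rule that)
  \<comment> \<open>The constants of the upper and of the lower bound.\<close>
  define K where "K = max K\<^sub>0 1000"
  have K: "K > 0" "K \<ge> K\<^sub>0" "inverse K \<le> 1 / 1000"
    unfolding K_def using K0 by (auto simp: inverse_eq_divide frac_le)

  have threshold: "real n powr (2 - b) * ln (real n) ^ 3 \<le> p powr (1/2) * real n powr (3/2)"
    if "real n powr (-a) * ln (real n) powr 6 \<le> p" "n \<ge> 3" for n p
  proof -
    have l: "ln (real n) > 0" using that(2) by simp
    have "(ln (real n) powr 6) powr (1/2) = ln (real n) powr real 3" unfolding powr_powr by simp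
    also have "\<dots> = ln (real n) ^ 3" using l by (rule powr_realpow)
    finally have l3: "(ln (real n) powr 6) powr (1/2) = ln (real n) ^ 3" .
    have "(real n powr (-a) * ln (real n) powr 6) powr (1/2) * real n powr (3/2)
        = real n powr (3/2 - a / 2) * ln (real n) ^ 3"
    proof -
      have "(real n powr (-a) * ln (real n) powr 6) powr (1/2) = real n powr (- a / 2) * ln (real n) ^ 3"
        using l3 by (simp add: powr_mult powr_powr)
      then show ?thesis by (simp add: powr_add[symmetric] mult_ac)
    qed
    moreover have "(real n powr (-a) * ln (real n) powr 6) powr (1/2) * real n powr (3/2) \<le> p powr (1/2) * real n powr (3/2)"
      using that(1) by (intro mult_right_mono powr_mono2) auto
    ultimately show ?thesis unfolding ab(1) by linarith
  qed

  have ln1: "ln (real n) \<ge> 1" if "n \<ge> 3" for n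
  proof -
    have "exp 1 \<le> real n" using that e_less_272 by linarith
    then show ?thesis using that by (simp add: ln_ge_iff)
  qed

  have dense: "aas (\<lambda>n. gnp n (p n)) (\<lambda>n G.
      inverse K * (p n powr (1/2) * real n powr (3/2)) \<le> real (ex_number G ?F) \<and>
      real (ex_number G ?F) \<le> K * (p n powr (1/2) * real n powr (3/2)))"
    if p: "\<forall>n. 0 \<le> p n \<and> p n \<le> 1"
      and big: "\<forall>\<^sub>F n in sequentially. real n powr (-a) * ln (real n) powr 6 \<le> p n" for p
  proof (rule aas_conj)
    show "aas (\<lambda>n. gnp n (p n)) (\<lambda>n G. real (ex_number G ?F) \<le> K * (p n powr (1/2) * real n powr (3/2)))"
    proof (rule aas_notI)
      show "\<forall>\<^sub>F n in sequentially. measure_pmf.prob (gnp n (p n))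
          {G. \<not> real (ex_number G ?F) \<le> K * (p n powr (1/2) * real n powr (3/2))} \<le> exp (- real n)"
        using big eventually_ge_at_top[of 3]
      proof eventually_elim
        case (elim n)
        let ?m = "p n powr (1/2) * real n powr (3/2)"
        have l: "ln (real n) \<ge> 1" using ln1 elim by blast
        have n0: "real n \<ge> 3" using elim by simp
        have "0 < real n powr (-a) * ln (real n) powr 6" using n0 l by simp
        then have p0: "p n > 0" using elim by linarith
        have th: "real n powr (2 - b) * ln (real n) ^ 3 \<le> ?m" by (rule threshold[OF elim])
        have "real n powr (2 - b) * (ln (real n))\<^sup>2 \<le> real n powr (2 - b) * ln (real n) ^ 3"
          using l by (intro mult_left_mono power_increasing) auto
        then have th2: "real n powr (1 + real e / (real v - 1 + 2 * real e)) * (ln (real n))\<^sup>2 \<le> ?m"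
          using th unfolding ab(2) by linarith
        have "real n powr 1 * 1 \<le> real n powr (2 - b) * ln (real n) ^ 3"
          using b n0 l by (intro mult_mono powr_mono one_le_power) auto
        then have mn: "real n \<le> ?m" using th n0 by simp
        have "measure_pmf.prob (gnp n (p n)) {G. \<not> real (ex_number G ?F) \<le> K * ?m}
            \<le> measure_pmf.prob (gnp n (p n)) {G. K\<^sub>0 * ?m \<le> real (ex_number G ?F)}"
        proof (rule prob_gnp_mono)
          fix G assume "\<not> real (ex_number G ?F) \<le> K * ?m"
          moreover have "K\<^sub>0 * ?m \<le> K * ?m" using K(2) by (intro mult_right_mono) auto
          ultimately show "K\<^sub>0 * ?m \<le> real (ex_number G ?F)" by linarith
        qed
        also have "\<dots> \<le> exp (- ?m)" using upper[rule_format, OF elim(2) p0 _ th2] p by blast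
        also have "\<dots> \<le> exp (- real n)" using mn by simp
        finally show ?case .
      qed
      show "(\<lambda>n. exp (- real n)) \<longlonglongrightarrow> 0" by real_asymp
    qed
    show "aas (\<lambda>n. gnp n (p n)) (\<lambda>n G. inverse K * (p n powr (1/2) * real n powr (3/2)) \<le> real (ex_number G ?F))"
    proof (rule aasI)
      define c where "c = 1 - a"
      have c: "c > 0" using a by (simp add: c_def)
      let ?g = "\<lambda>n. exp (- ((real n powr c / 8) powr (3/2)) / 512)"
      show "?g \<longlonglongrightarrow> 0" using c by real_asymp
      have "filterlim (\<lambda>n. real n powr c) at_top sequentially" using c by real_asymp
      then have "\<forall>\<^sub>F n in sequentially. 8 \<le> real n powr c" by (simp add: filterlim_at_top)
      then show "\<forall>\<^sub>F n in sequentially. 1 - ?g n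
          \<le> measure_pmf.prob (gnp n (p n)) {G. inverse K * (p n powr (1/2) * real n powr (3/2)) \<le> real (ex_number G ?F)}"
        using big eventually_ge_at_top[of 3]
      proof eventually_elim
        case (elim n)
        let ?m = "p n powr (1/2) * real n powr (3/2)"
        have l: "ln (real n) \<ge> 1" using ln1 elim by blast
        have n0: "real n \<ge> 3" using elim by simp
        have "0 < real n powr (-a) * ln (real n) powr 6" using n0 l by simp
        then have p0: "p n > 0" using elim by linarith
        have np: "real n powr c \<le> real n * p n"
        proof -
          have "real n powr (-a) * 1 \<le> real n powr (-a) * ln (real n) powr 6"
            using l by (intro mult_left_mono ge_one_powr_ge_zero) auto
          then have "real n powr (-a) \<le> p n" using elim by linarith
          then have "real n * real n powr (-a) \<le> real n * p n" by (rule mult_left_mono) simp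
          moreover have "real n * real n powr (-a) = real n powr c"
            using n0 by (simp add: c_def powr_diff powr_minus_divide)
          ultimately show ?thesis by simp
        qed
        have "1 - ?g n \<le> 1 - exp (- ((real n * p n / 8) powr (3/2)) / 512)"
        proof -
          have "(real n powr c / 8) powr (3/2) \<le> (real n * p n / 8) powr (3/2)"
            using np by (intro powr_mono2) auto
          then show ?thesis by simp
        qed
        also have "\<dots> \<le> measure_pmf.prob (gnp n (p n)) {G. ?m / 1000 \<le> real (ex_number G ?F)}"
          by (rule ex_number_gnp_lower[OF p0 _ _ F F_graph_quadrilateral[OF M e1']]) (use p np elim in auto)
        also have "\<dots> \<le> measure_pmf.prob (gnp n (p n)) {G. inverse K * ?m \<le> real (ex_number G ?F)}"
        proof (rule prob_gnp_mono)
          fix G assume "?m / 1000 \<le> real (ex_number G ?F)"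
          moreover have "inverse K * ?m \<le> 1 / 1000 * ?m" using K(3) by (intro mult_right_mono) auto
          ultimately show "inverse K * ?m \<le> real (ex_number G ?F)" by linarith
        qed
        finally show ?case .
      qed
    qed
  qed

  have middle: "aas (\<lambda>n. gnp n (p n)) (\<lambda>n G.
      real n powr (2 - b) * ln (real n) powr (-4) \<le> real (ex_number G ?F) \<and>
      real (ex_number G ?F) \<le> real n powr (2 - b) * ln (real n) powr 4)"
    if p: "\<forall>n. 0 \<le> p n \<and> p n \<le> 1" and low: "(\<lambda>n. real n powr (-b)) \<in> o(p)"
      and up: "\<forall>\<^sub>F n in sequentially. p n \<le> real n powr (-a) * ln (real n) powr 6" for p
  proof (rule aas_conj)
    \<comment> \<open>The left end of the dense range; the minimum with 1 matters for small \<open>n\<close> only.\<close>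
    define p\<^sub>0 where "p\<^sub>0 n = min 1 (real n powr (-a) * ln (real n) powr 6)" for n :: nat
    have p01: "\<forall>n. 0 \<le> p\<^sub>0 n \<and> p\<^sub>0 n \<le> 1" by (simp add: p\<^sub>0_def)
    have "(\<lambda>n. real n powr (-a) * ln (real n) powr 6) \<longlonglongrightarrow> 0" using a(1) by real_asymp
    then have "\<forall>\<^sub>F n in sequentially. real n powr (-a) * ln (real n) powr 6 < 1" by (rule order_tendstoD) simp
    then have p0eq: "\<forall>\<^sub>F n in sequentially. p\<^sub>0 n = real n powr (-a) * ln (real n) powr 6"
      by eventually_elim (simp add: p\<^sub>0_def)
    then have "\<forall>\<^sub>F n in sequentially. real n powr (-a) * ln (real n) powr 6 \<le> p\<^sub>0 n" by eventually_elim simp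
    note d = dense[OF p01 this]
    have lnK: "\<forall>\<^sub>F n in sequentially. K \<le> ln (real n)"
    proof -
      have "filterlim (\<lambda>n. ln (real n)) at_top sequentially" by real_asymp
      then show ?thesis by (simp add: filterlim_at_top)
    qed
    have "aas (\<lambda>n. gnp n (p\<^sub>0 n)) (\<lambda>n G. real (ex_number G ?F) \<le> real n powr (2 - b) * ln (real n) powr 4)"
    proof (rule aas_gnp_mono[OF d])
      show "\<forall>\<^sub>F n in sequentially. \<forall>G. graph_on n G \<longrightarrow>
          inverse K * (p\<^sub>0 n powr (1/2) * real n powr (3/2)) \<le> real (ex_number G ?F) \<and>
          real (ex_number G ?F) \<le> K * (p\<^sub>0 n powr (1/2) * real n powr (3/2)) \<longrightarrow>
          real (ex_number G ?F) \<le> real n powr (2 - b) * ln (real n) powr 4"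
        using p0eq lnK eventually_ge_at_top[of 3]
      proof eventually_elim
        case (elim n)
        have l: "ln (real n) \<ge> 1" using ln1 elim by blast
        have "(ln (real n) powr 6) powr (1/2) = ln (real n) powr 3" unfolding powr_powr by simp
        then have "p\<^sub>0 n powr (1/2) * real n powr (3/2) = real n powr (3/2 - a / 2) * ln (real n) powr 3"
          unfolding elim(1) by (simp add: powr_mult powr_powr powr_add[symmetric] mult_ac)
        then have m: "p\<^sub>0 n powr (1/2) * real n powr (3/2) = real n powr (2 - b) * ln (real n) powr 3" unfolding ab(1) .
        have "K * (real n powr (2 - b) * ln (real n) powr 3) \<le> ln (real n) * (real n powr (2 - b) * ln (real n) powr 3)"
          using elim(2) by (intro mult_right_mono) auto
        also have "\<dots> = real n powr (2 - b) * (ln (real n) powr 1 * ln (real n) powr 3)" using l by simp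
        also have "\<dots> = real n powr (2 - b) * ln (real n) powr 4" unfolding powr_add[symmetric] by simp
        finally show ?case unfolding m by auto
      qed
    qed
    then show "aas (\<lambda>n. gnp n (p n)) (\<lambda>n G. real (ex_number G ?F) \<le> real n powr (2 - b) * ln (real n) powr 4)"
    proof (rule aas_gnp_decrease)
      show "\<forall>\<^sub>F n in sequentially. 0 \<le> p n \<and> p n \<le> p\<^sub>0 n \<and> p\<^sub>0 n \<le> 1"
        using up p0eq
      proof eventually_elim
        case (elim n)
        then show ?case using p[rule_format, of n] p01[rule_format, of n] by linarith
      qed
      show "real (ex_number G ?F) \<le> real n powr (2 - b) * ln (real n) powr 4"
        if "graph_on n G" "graph_on n G'" "edges G \<subseteq> edges G'" "real (ex_number G' ?F) \<le> real n powr (2 - b) * ln (real n) powr 4" for n G G'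
        using ex_number_mono[OF F that(1-3)] that(4) by linarith
    qed
    \<comment> \<open>A density just inside the sparse range.\<close>
    define q where "q n = (if n \<ge> 3 then real n powr (-b) / ln (real n) else 0)" for n :: nat
    have q01: "\<forall>n. 0 \<le> q n \<and> q n \<le> 1"
    proof
      fix n show "0 \<le> q n \<and> q n \<le> 1"
      proof (cases "n \<ge> 3")
        case True
        have l: "ln (real n) \<ge> 1" using ln1 True by blast
        have "real n powr (-b) \<le> real n powr 0" using b True by (intro powr_mono) auto
        then have "real n powr (-b) \<le> ln (real n)" using l True by simp
        then show ?thesis using True l by (simp add: q_def divide_le_eq)
      qed (simp add: q_def)
    qed
    have qev: "\<forall>\<^sub>F n in sequentially. q n = real n powr (-b) / ln (real n)"
      using eventually_ge_at_top[of 3] by eventually_elim (simp add: q_def)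
    have "(\<lambda>n. real n powr (-2)) \<in> o(\<lambda>n. real n powr (-b) / ln (real n))" using b by real_asymp
    then have q2: "(\<lambda>n. real n powr (-2)) \<in> o(q)" using landau_o.small.cong[OF qev] by blast
    have "(\<lambda>n. real n powr (-b) / ln (real n)) \<in> o(\<lambda>n. real n powr (-b))" using b by real_asymp
    then have qb: "q \<in> o(\<lambda>n. real n powr (-b))" using landau_o.small.in_cong[OF qev] by blast
    have qp: "\<forall>\<^sub>F n in sequentially. 0 \<le> q n \<and> q n \<le> p n \<and> p n \<le> 1"
    proof -
      have "\<forall>\<^sub>F n in sequentially. norm (real n powr (-b)) \<le> 1 * norm (p n)"
        using landau_o.smallD[OF low, of 1] by simp
      then show ?thesis using eventually_ge_at_top[of 3]
      proof eventually_elim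
        case (elim n)
        have l: "ln (real n) \<ge> 1" using ln1 elim by blast
        have "real n powr (-b) / ln (real n) \<le> real n powr (-b) / 1" using l by (intro divide_left_mono) auto
        then have "q n \<le> p n" using elim p by (simp add: q_def)
        then show ?case using p q01 by simp
      qed
    qed
    have half: "(0::real) < 1 / 2" by simp
    have "aas (\<lambda>n. gnp n (q n)) (\<lambda>n G. real n powr (2 - b) * ln (real n) powr (-4) \<le> real (ex_number G ?F))"
    proof (rule aas_gnp_mono[OF sparse[OF q01 q2 qb half]])
      have "filterlim (\<lambda>n. ln (real n)) at_top sequentially" by real_asymp
      then have "\<forall>\<^sub>F n in sequentially. 2 \<le> ln (real n)" by (simp add: filterlim_at_top)
      then show "\<forall>\<^sub>F n in sequentially. \<forall>G. graph_on n G \<longrightarrow>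
          \<bar>real (ex_number G ?F) - q n * real (n choose 2)\<bar> \<le> 1 / 2 * (q n * real (n choose 2)) \<longrightarrow>
          real n powr (2 - b) * ln (real n) powr (-4) \<le> real (ex_number G ?F)"
        using eventually_ge_at_top[of 3]
      proof eventually_elim
        case (elim n)
        have n0: "real n \<ge> 3" using elim by simp
        have l: "ln (real n) > 0" using elim by linarith
        have l4: "ln (real n) powr (-4) \<le> 1 / (8 * ln (real n))"
        proof -
          have "(2::real) ^ 3 \<le> ln (real n) ^ 3" using elim by (intro power_mono) auto
          then have "8 * ln (real n) \<le> ln (real n) ^ 3 * ln (real n)" using l by (intro mult_right_mono) auto
          also have "\<dots> = ln (real n) powr real 4" using l by (subst powr_realpow) (auto simp: power_Suc2[symmetric] numeral_eq_Suc)
          finally have "8 * ln (real n) \<le> ln (real n) powr 4" by simp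
          then have "1 / ln (real n) powr 4 \<le> 1 / (8 * ln (real n))" using l by (intro frac_le) auto
          then show ?thesis by (simp add: powr_minus_divide)
        qed
        have pw: "real n powr (2 - b) = real n powr (-b) * real n ^ 2"
        proof -
          have "real n powr (2 - b) = real n powr (-b + real 2)" by simp
          also have "\<dots> = real n powr (-b) * real n powr real 2" by (rule powr_add)
          also have "real n powr real 2 = real n ^ 2" using n0 by (intro powr_realpow) auto
          finally show ?thesis .
        qed
        have "real n powr (2 - b) * ln (real n) powr (-4) \<le> real n powr (2 - b) * (1 / (8 * ln (real n)))"
          using l4 by (intro mult_left_mono) auto
        also have "\<dots> = 1 / 2 * (q n * (real n ^ 2 / 4))"
          unfolding pw using elim by (simp add: q_def)
        also have "\<dots> \<le> 1 / 2 * (q n * real (n choose 2))"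
          using choose_two_bounds(1)[of n] q01 elim by (intro mult_left_mono) auto
        finally have "real n powr (2 - b) * ln (real n) powr (-4) \<le> 1 / 2 * (q n * real (n choose 2))" .
        then show ?case by linarith
      qed
    qed
    then show "aas (\<lambda>n. gnp n (p n)) (\<lambda>n G. real n powr (2 - b) * ln (real n) powr (-4) \<le> real (ex_number G ?F))"
    proof (rule aas_gnp_increase[OF _ qp])
      show "real n powr (2 - b) * ln (real n) powr (-4) \<le> real (ex_number G' ?F)"
        if "graph_on n G" "graph_on n G'" "edges G \<subseteq> edges G'" "real n powr (2 - b) * ln (real n) powr (-4) \<le> real (ex_number G ?F)" for n G G'
        using ex_number_mono[OF F that(1-3)] that(4) by linarith
    qed
  qed

  have a': "(real (num_verts M) - 1) / (real (num_verts M) + 2 * real (num_edges M) - 1) = a"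
    and b': "(real (num_verts M) + real (num_edges M) - 1) / (real (num_verts M) + 2 * real (num_edges M) - 1) = b"
    by (simp_all add: a_def b_def D_def v_def e_def num_verts_def num_edges_def)
  show ?thesis
    unfolding Let_def a' b'
  proof (rule exI[of _ 6], intro conjI)
    show "\<exists>K>0. \<forall>p::nat \<Rightarrow> real. (\<forall>n. 0 \<le> p n \<and> p n \<le> 1) \<longrightarrow>
        (\<forall>\<^sub>F n in sequentially. real n powr (-a) * ln (real n) powr 6 \<le> p n) \<longrightarrow>
        aas (\<lambda>n. gnp n (p n)) (\<lambda>n G.
          inverse K * (p n powr (1/2) * real n powr (3/2)) \<le> real (ex_number G ?F) \<and>
          real (ex_number G ?F) \<le> K * (p n powr (1/2) * real n powr (3/2)))"
      using dense K(1) by blast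
    show "\<exists>C'>0. \<forall>p::nat \<Rightarrow> real. (\<forall>n. 0 \<le> p n \<and> p n \<le> 1) \<longrightarrow>
        (\<lambda>n. real n powr (-b)) \<in> o(p) \<longrightarrow>
        (\<forall>\<^sub>F n in sequentially. p n \<le> real n powr (-a) * ln (real n) powr 6) \<longrightarrow>
        aas (\<lambda>n. gnp n (p n)) (\<lambda>n G.
          real n powr (2 - b) * ln (real n) powr (-C') \<le> real (ex_number G ?F) \<and>
          real (ex_number G ?F) \<le> real n powr (2 - b) * ln (real n) powr C')"
      by (rule exI[of _ 4]) (use middle in simp)
    show "\<forall>p::nat \<Rightarrow> real. (\<forall>n. 0 \<le> p n \<and> p n \<le> 1) \<longrightarrow>
        (\<lambda>n. real n powr (-2)) \<in> o(p) \<longrightarrow> p \<in> o(\<lambda>n. real n powr (-b)) \<longrightarrow>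
        (\<forall>\<epsilon>>0. aas (\<lambda>n. gnp n (p n)) (\<lambda>n G.
          \<bar>real (ex_number G ?F) - p n * real (n choose 2)\<bar> \<le> \<epsilon> * (p n * real (n choose 2))))"
      using sparse by blast
  qed simp
qed

end
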